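(* Let $\kappa:G\to Gl(n,\mathbb{R})$ be an irreducible self-dual representation of a group $G$ on $\mathbb{R}^n$. Then the triple $\big(End_{\kappa(G)}(\mathbb{R}^n),\ \dim S_{\kappa(G)}(\mathbb{R}^n),\ \dim\Lambda_{\kappa(G)}(\mathbb{R}^n)\big)$ (first entry up to isomorphism of real algebras) is one of those in the following list, and, up to conjugation in $Gl(n,\mathbb{R})$, $\kappa(G)$ is contained in the corresponding subgroup $L\subset Gl(n,\mathbb{R})$, with $p+q=n$: 1. $(\mathbb{R},1,0)$: $L=O(p,q)$; 2. $(\mathbb{R},0,1)$: $L=Sp(n/2,\mathbb{R})$; 3. $(\mathbb{C},2,0)$: $L=O(n/2,\mathbb{C})$, with $n\ge 4$; 4. $(\mathbb{C},0,2)$: $L=Sp(n/4,\mathbb{C})$; 5. $(\mathbb{C},1,1)$: $L=U(p/2,q/2)$; 6. $(\mathbb{H},1,3)$: $L=Sp(p/4,q/4)$, with $n\ge 8$; 7. $(\mathbb{H},3,1)$: $L=O^*(n/4)$, with $n\ge 8$. Moreover, with the realizations of the groups specified in the context, one has the isomorphisms $$O(n/2,\mathbb{C})\simeq O(n/2,n/2)\cap Gl(n/2,\mathbb{C}),$$ $$Sp(n/4,\mathbb{C})\simeq Sp(n/2,\mathbb{R})\cap Gl(n/2,\mathbb{C}),$$ $$U(p/2,q/2)\simeq O(p,q)\cap Sp(n/2,\mathbb{R}),$$ $$Sp(p/4,q/4)\simeq U(p/2,q/2)\cap Sp(n/4,\mathbb{C}),$$ $$O^*(n/4)\simeq U(n/4,n/4)\cap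 O(n/2,\mathbb{C}).$$
   Context: Invariants: for a group $H\subset Gl(n,\mathbb{R})$, $End_H(\mathbb{R}^n)$ is the algebra of real endomorphisms commuting with $H$; $S_H(\mathbb{R}^n)$ and $\Lambda_H(\mathbb{R}^n)$ are the real vector spaces of $H$-invariant symmetric, respectively skew-symmetric, bilinear forms on $\mathbb{R}^n$. A representation is self-dual if it is isomorphic to its dual, equivalently (for irreducible ones) if there is a non-zero invariant bilinear form. Indices such as $n/2$, $p/2$, $n/4$, $p/4$ are understood to be integers where they occur. Matrices: $\mathbb{I}_m$ is the $m\times m$ identity, $\mathbb{I}_{r,s}=\mathrm{diag}(-\mathbb{I}_r,\mathbb{I}_s)$, $\mathbb{J}_m=\begin{pmatrix}0&-\mathbb{I}_m\\ \mathbb{I}_m&0\end{pmatrix}$. Groups: $O(p,q)=\{A\in Gl(p+q,\mathbb{R}): A^t\mathbb{I}_{p,q}A=\mathbb{I}_{p,q}\}$; $O(m,\mathbb{C})=\{A\in Gl(m,\mathbb{C}):A^tA=\mathbb{I}_m\}$; $Sp(m,\mathbb{K})=\{A\in Gl(2m,\mathbb{K}):A^t\mathbb{J}_mA=\mathbb{J}_m\}$ for $\mathbb{K}=\mathbb{R},\mathbb{C}$; $U(r,s)=\{A\in Gl(r+s,\mathbb{C}):\overline{A}^t\mathbb{I}_{r,s}A=\mathbb{I}_{r,s}\}$; $Sp(r,s)=\{A\in Gl(r+s,\mathbb{H}):\overline{A}^t\mathbb{I}_{r,s}A=\mathbb{I}_{r,s}\}$; $O^*(m)=\{A\in Gl(m,\mathbb{H}):\overline{A}^t\,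 i\mathbb{I}_m A=i\mathbb{I}_m\}$. Embeddings: $Gl(n/2,\mathbb{C})\subset Gl(n,\mathbb{R})$ via $A+iB\mapsto\begin{pmatrix}A & -B\\ B & A\end{pmatrix}$, with image the centralizer of $\mathbb{J}_{n/2}$. $Gl(n/4,\mathbb{H})\subset Gl(n/2,\mathbb{C})$ via $U+Vj\mapsto\begin{pmatrix}U&-V\\ \overline{V}&\overline{U}\end{pmatrix}$ ($U,V$ complex matrices), with image $\{C:\overline{C}\,\mathbb{J}_{n/4}=\mathbb{J}_{n/4}C\}$; composing gives $Gl(n/4,\mathbb{H})\subset Gl(n,\mathbb{R})$. Realizations on the right-hand sides of the five isomorphisms (each group is conjugate to its standard form above): - first: $O(n/2,n/2)$ is the isometry group in $Gl(n,\mathbb{R})$ of $\mathrm{diag}(\mathbb{I}_{n/2},-\mathbb{I}_{n/2})$; - second: $Sp(n/2,\mathbb{R})$ is the isometry group in $Gl(n,\mathbb{R})$ of the skew form $\mathrm{diag}(\mathbb{J}_{n/4},-\mathbb{J}_{n/4})$; - third: $O(p,q)$ is the isometry group of $\mathrm{diag}(\mathbb{I}_{p/2,q/2},\mathbb{I}_{p/2,q/2})$ (the real part of the Hermitian form $\mathbb{I}_{p/2,q/2}$), and $Sp(n/2,\mathbb{R})$ is the isometry group of the skew form given by the imaginary part of that Hermitian form; - fourth: in $Gl(n/2,\mathbb{C})$, $U(p/2,q/2)$ is the isometry group of the Hermitian form $\mathrm{diag}(\mathbb{I}_{p/4,q/4},\mathbb{I}_{p/4,q/4})$ and $Sp(n/4,\mathbb{C})$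 that of the complex bilinear skew form $\begin{pmatrix}0&-\mathbb{I}_{p/4,q/4}\\ \mathbb{I}_{p/4,q/4}&0\end{pmatrix}$; - fifth: in $Gl(n/2,\mathbb{C})$, $U(n/4,n/4)$ is the isometry group of the skew-Hermitian form $\mathrm{diag}(i\mathbb{I}_{n/4},-i\mathbb{I}_{n/4})$ and $O(n/2,\mathbb{C})$ that of the complex bilinear symmetric form $\begin{pmatrix}0&\mathbb{I}_{n/4}\\ \mathbb{I}_{n/4}&0\end{pmatrix}$.
   Formalization: In item 6, (H,1,3), the condition n ≥ 8 is replaced by "n ≥ 8 or n = 4", since the unit quaternions Sp(1) acting by left multiplication on H = R^4 are irreducible and self-dual with triple (H,1,3) and n = 4. *)

theory Defs
  imports Complex_Main "Jordan_Normal_Form.VS_Connect"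
begin

subsection \<open>Quaternions\<close>

text \<open>\<open>Quat a b c d\<close> is \<open>a + b i + c j + d k = (a + b i) + (c + d i) j\<close>.\<close>

datatype quat = Quat (qRe: real) (qI: real) (qJ: real) (qK: real)

instantiation quat :: real_algebra_1
begin

definition zero_quat :: quat where "0 = Quat 0 0 0 0"

definition one_quat :: quat where "1 = Quat 1 0 0 0"

definition plus_quat :: "quat \<Rightarrow> quat \<Rightarrow> quat" where
  "x + y = Quat (qRe x + qRe y) (qI x + qI y) (qJ x + qJ y) (qK x + qK y)"

definition minus_quat :: "quat \<Rightarrow> quat \<Rightarrow> quat" where
  "x - y = Quat (qRe x - qRe y) (qI x - qI y) (qJ x - qJ y) (qK x - qK y)"

definition uminus_quat :: "quat \<Rightarrow> quat" where
  "- x = Quat (- qRe x) (- qI x) (- qJ x) (- qK x)"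

definition times_quat :: "quat \<Rightarrow> quat \<Rightarrow> quat" where
  "x * y = Quat
     (qRe x * qRe y - qI x * qI y - qJ x * qJ y - qK x * qK y)
     (qRe x * qI y + qI x * qRe y + qJ x * qK y - qK x * qJ y)
     (qRe x * qJ y - qI x * qK y + qJ x * qRe y + qK x * qI y)
     (qRe x * qK y + qI x * qJ y - qJ x * qI y + qK x * qRe y)"

definition scaleR_quat :: "real \<Rightarrow> quat \<Rightarrow> quat" where
  "r *\<^sub>R x = Quat (r * qRe x) (r * qI x) (r * qJ x) (r * qK x)"

instance
  by standard
    (simp_all add: zero_quat_def one_quat_def plus_quat_def minus_quat_def uminus_quat_def
      times_quat_def scaleR_quat_def algebra_simps)

end

definition qcnj :: "quat \<Rightarrow> quat" where
  "qcnj x = Quat (qRe x) (- qI x) (- qJ x) (- qK x)"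

definition quat_i :: quat where "quat_i = Quat 0 1 0 0"


subsection \<open>General linear groups and embeddings\<close>

definition GL :: "'a::semiring_1 itself \<Rightarrow> nat \<Rightarrow> 'a mat monoid" where
  "GL ty n = units_of (ring_mat ty n ())"

text \<open>\<open>A + i B\<close> is sent to the block matrix with rows \<open>(A, -B)\<close> and \<open>(B, A)\<close>.\<close>

definition complex_to_real_mat :: "complex mat \<Rightarrow> real mat" where
  "complex_to_real_mat C =
     four_block_mat (map_mat Re C) (- map_mat Im C) (map_mat Im C) (map_mat Re C)"

text \<open>\<open>Q = U + V j\<close> with complex matrices \<open>U\<close> and \<open>V\<close>.\<close>

definition quat_to_complex_mat :: "quat mat \<Rightarrow> complex mat" where
  "quat_to_complex_mat Q =
     (let U = map_mat (\<lambda>x. Complex (qRe x) (qI x)) Q;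
          V = map_mat (\<lambda>x. Complex (qJ x) (qK x)) Q
      in four_block_mat U (- V) (map_mat cnj V) (map_mat cnj U))"

definition quat_to_real_mat :: "quat mat \<Rightarrow> real mat" where
  "quat_to_real_mat Q = complex_to_real_mat (quat_to_complex_mat Q)"


subsection \<open>Isometry groups\<close>

definition block_diag :: "'a::zero mat \<Rightarrow> 'a mat \<Rightarrow> 'a mat" where
  "block_diag A B =
     four_block_mat A (0\<^sub>m (dim_row A) (dim_col B)) (0\<^sub>m (dim_row B) (dim_col A)) B"

definition block_antidiag :: "'a::zero mat \<Rightarrow> 'a mat \<Rightarrow> 'a mat" where
  "block_antidiag A B =
     four_block_mat (0\<^sub>m (dim_row A) (dim_col B)) A B (0\<^sub>m (dim_row B) (dim_col A))"

definition sig_mat :: "nat \<Rightarrow> nat \<Rightarrow> 'a::ring_1 mat" where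
  "sig_mat r s = block_diag (- 1\<^sub>m r) (1\<^sub>m s)"

definition J_mat :: "nat \<Rightarrow> 'a::ring_1 mat" where
  "J_mat m = block_antidiag (- 1\<^sub>m m) (1\<^sub>m m)"

definition bilinear_isometries :: "nat \<Rightarrow> 'a::comm_ring_1 mat \<Rightarrow> 'a mat set" where
  "bilinear_isometries m F = {A \<in> carrier (GL TYPE('a) m). transpose_mat A * F * A = F}"

text \<open>Here \<open>\<sigma>\<close> is the conjugation of the coefficients; \<open>F\<close> may be Hermitian or skew-Hermitian.\<close>

definition sesquilinear_isometries :: "('a::ring_1 \<Rightarrow> 'a) \<Rightarrow> nat \<Rightarrow> 'a mat \<Rightarrow> 'a mat set" where
  "sesquilinear_isometries \<sigma> m F =
     {A \<in> carrier (GL TYPE('a) m). transpose_mat (map_mat \<sigma> A) * F * A = F}"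

definition O_real :: "nat \<Rightarrow> nat \<Rightarrow> real mat set" where
  "O_real p q = bilinear_isometries (p + q) (sig_mat p q)"

definition O_complex :: "nat \<Rightarrow> complex mat set" where
  "O_complex m = bilinear_isometries m (1\<^sub>m m)"

definition Sp_real :: "nat \<Rightarrow> real mat set" where
  "Sp_real m = bilinear_isometries (2 * m) (J_mat m)"

definition Sp_complex :: "nat \<Rightarrow> complex mat set" where
  "Sp_complex m = bilinear_isometries (2 * m) (J_mat m)"

definition U_complex :: "nat \<Rightarrow> nat \<Rightarrow> complex mat set" where
  "U_complex r s = sesquilinear_isometries cnj (r + s) (sig_mat r s)"

definition Sp_quat :: "nat \<Rightarrow> nat \<Rightarrow> quat mat set" where
  "Sp_quat r s = sesquilinear_isometries qcnj (r + s) (sig_mat r s)"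

definition O_star :: "nat \<Rightarrow> quat mat set" where
  "O_star m = sesquilinear_isometries qcnj m (quat_i \<cdot>\<^sub>m 1\<^sub>m m)"


subsection \<open>Representations and their invariants\<close>

definition irreducible_rep :: "('g, 'r) monoid_scheme \<Rightarrow> nat \<Rightarrow> ('g \<Rightarrow> real mat) \<Rightarrow> bool" where
  "irreducible_rep G n \<kappa> \<longleftrightarrow> 0 < n \<and>
     (\<forall>W. VectorSpace.subspace class_ring W (module_vec TYPE(real) n) \<and>
          (\<forall>g\<in>carrier G. \<forall>w\<in>W. \<kappa> g *\<^sub>v w \<in> W)
        \<longrightarrow> W = {0\<^sub>v n} \<or> W = carrier_vec n)"

definition dual_rep :: "('g, 'r) monoid_scheme \<Rightarrow> ('g \<Rightarrow> real mat) \<Rightarrow> 'g \<Rightarrow> real mat" where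
  "dual_rep G \<kappa> g = transpose_mat (\<kappa> (inv\<^bsub>G\<^esub> g))"

definition isomorphic_reps ::
  "('g, 'r) monoid_scheme \<Rightarrow> nat \<Rightarrow> ('g \<Rightarrow> real mat) \<Rightarrow> ('g \<Rightarrow> real mat) \<Rightarrow> bool" where
  "isomorphic_reps G n \<kappa> \<kappa>' \<longleftrightarrow>
     (\<exists>P\<in>carrier (GL TYPE(real) n). \<forall>g\<in>carrier G. P * \<kappa> g = \<kappa>' g * P)"

definition self_dual_rep :: "('g, 'r) monoid_scheme \<Rightarrow> nat \<Rightarrow> ('g \<Rightarrow> real mat) \<Rightarrow> bool" where
  "self_dual_rep G n \<kappa> \<longleftrightarrow> isomorphic_reps G n \<kappa> (dual_rep G \<kappa>)"

definition End_alg :: "nat \<Rightarrow> real mat set \<Rightarrow> real mat set" where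
  "End_alg n H = {A \<in> carrier_mat n n. \<forall>h\<in>H. A * h = h * A}"

definition real_algebra_iso :: "nat \<Rightarrow> real mat set \<Rightarrow> 'b::real_algebra_1 itself \<Rightarrow> bool" where
  "real_algebra_iso n E ty \<longleftrightarrow>
     (\<exists>\<phi> :: real mat \<Rightarrow> 'b. bij_betw \<phi> E UNIV \<and> \<phi> (1\<^sub>m n) = 1 \<and>
        (\<forall>A\<in>E. \<forall>B\<in>E. \<phi> (A + B) = \<phi> A + \<phi> B \<and> \<phi> (A * B) = \<phi> A * \<phi> B) \<and>
        (\<forall>c. \<forall>A\<in>E. \<phi> (c \<cdot>\<^sub>m A) = c *\<^sub>R \<phi> A))"

text \<open>Bilinear forms on \<open>\<real>\<^sup>n\<close> are encoded by their Gram matrices in the standard basis;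
  \<open>bform\<close> is a linear isomorphism from \<open>n \<times> n\<close> matrices onto bilinear forms.\<close>

definition bform :: "real mat \<Rightarrow> real vec \<Rightarrow> real vec \<Rightarrow> real" where
  "bform B x y = x \<bullet> (B *\<^sub>v y)"

definition invariant_form :: "nat \<Rightarrow> real mat set \<Rightarrow> real mat \<Rightarrow> bool" where
  "invariant_form n H B \<longleftrightarrow>
     (\<forall>h\<in>H. \<forall>x\<in>carrier_vec n. \<forall>y\<in>carrier_vec n. bform B (h *\<^sub>v x) (h *\<^sub>v y) = bform B x y)"

definition sym_forms :: "nat \<Rightarrow> real mat set \<Rightarrow> real mat set" where
  "sym_forms n H = {B \<in> carrier_mat n n. invariant_form n H B \<and>
     (\<forall>x\<in>carrier_vec n. \<forall>y\<in>carrier_vec n. bform B x y = bform B y x)}"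

definition skew_forms :: "nat \<Rightarrow> real mat set \<Rightarrow> real mat set" where
  "skew_forms n H = {B \<in> carrier_mat n n. invariant_form n H B \<and>
     (\<forall>x\<in>carrier_vec n. \<forall>y\<in>carrier_vec n. bform B x y = - bform B y x)}"

definition dim_mats :: "nat \<Rightarrow> real mat set \<Rightarrow> nat" where
  "dim_mats n W = vectorspace.dim class_ring ((module_mat TYPE(real) n n)\<lparr>carrier := W\<rparr>)"

definition has_invariants ::
  "nat \<Rightarrow> real mat set \<Rightarrow> 'b::real_algebra_1 itself \<Rightarrow> nat \<Rightarrow> nat \<Rightarrow> bool" where
  "has_invariants n H ty s l \<longleftrightarrow> real_algebra_iso n (End_alg n H) ty \<and>
     dim_mats n (sym_forms n H) = s \<and> dim_mats n (skew_forms n H) = l"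

definition conj_into :: "nat \<Rightarrow> real mat set \<Rightarrow> real mat set \<Rightarrow> bool" where
  "conj_into n H L \<longleftrightarrow>
     (\<exists>P\<in>carrier (GL TYPE(real) n). (\<lambda>h. P * h * inv\<^bsub>GL TYPE(real) n\<^esub> P) ` H \<subseteq> L)"


subsection \<open>Realizations used in the intersections\<close>

definition O_split_realized :: "nat \<Rightarrow> real mat set" where
  "O_split_realized n = bilinear_isometries n (block_diag (1\<^sub>m (n div 2)) (- 1\<^sub>m (n div 2)))"

definition Sp_real_realized :: "nat \<Rightarrow> real mat set" where
  "Sp_real_realized n = bilinear_isometries n (block_diag (J_mat (n div 4)) (- J_mat (n div 4)))"

text \<open>Real and imaginary parts of the Hermitian form with matrix \<open>sig_mat r s\<close>, conjugate-linear
  in the first argument, in the real coordinates \<open>(x, y)\<close> of \<open>x + i y\<close>.\<close>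

definition O_real_part :: "nat \<Rightarrow> nat \<Rightarrow> real mat set" where
  "O_real_part r s = bilinear_isometries (2 * (r + s)) (block_diag (sig_mat r s) (sig_mat r s))"

definition Sp_imaginary_part :: "nat \<Rightarrow> nat \<Rightarrow> real mat set" where
  "Sp_imaginary_part r s =
     bilinear_isometries (2 * (r + s)) (block_antidiag (sig_mat r s) (- sig_mat r s))"

definition U_realized :: "nat \<Rightarrow> nat \<Rightarrow> complex mat set" where
  "U_realized r s =
     sesquilinear_isometries cnj (2 * (r + s)) (block_diag (sig_mat r s) (sig_mat r s))"

definition Sp_complex_realized :: "nat \<Rightarrow> nat \<Rightarrow> complex mat set" where
  "Sp_complex_realized r s =
     bilinear_isometries (2 * (r + s)) (block_antidiag (- sig_mat r s) (sig_mat r s))"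

definition U_skew_realized :: "nat \<Rightarrow> complex mat set" where
  "U_skew_realized m =
     sesquilinear_isometries cnj (2 * m) (block_diag (\<i> \<cdot>\<^sub>m 1\<^sub>m m) (- (\<i> \<cdot>\<^sub>m 1\<^sub>m m)))"

definition O_complex_realized :: "nat \<Rightarrow> complex mat set" where
  "O_complex_realized m = bilinear_isometries (2 * m) (block_antidiag (1\<^sub>m m) (1\<^sub>m m))"

definition GL_complex_in_real :: "nat \<Rightarrow> real mat set" where
  "GL_complex_in_real m = complex_to_real_mat ` carrier (GL TYPE(complex) m)"

text \<open>The subgroup with underlying set \<open>S\<close>, as a group in its own right.\<close>

abbreviation subgrp :: "'a::semiring_1 mat set \<Rightarrow> nat \<Rightarrow> 'a mat monoid" where
  "subgrp S m \<equiv> (GL TYPE('a) m)\<lparr>carrier := S\<rparr>"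

end

theory Submission
  imports Defs "Jordan_Normal_Form.Spectral_Radius"
begin

text \<open>
  Let \<open>H\<close> be the image of an irreducible self-dual representation on \<open>\<real>\<^sup>n\<close>. By Schur's lemma the algebra
  \<open>E\<close> of endomorphisms commuting with \<open>H\<close> has no zero divisors, and a non-zero invariant form \<open>B\<close> has
  trivial kernel; hence the invariant forms are exactly the matrices \<open>B A\<close> with \<open>A \<in> E\<close>
  (\<open>Inv_as_mult\<close>). Frobenius' theorem is immediate in this setting (\<open>End_trichotomy\<close>): a complex
  eigenvector of \<open>A \<in> E\<close> produces a real quadratic polynomial that kills \<open>A\<close>, so every non-scalar element
  yields a square root of \<open>-1\<close>, and \<open>E\<close> is spanned by \<open>1\<close>, by \<open>1, I\<close>, or by \<open>1, I, J, I J\<close>.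

  Averaging \<open>F \<mapsto> F + I\<^sup>T F I\<close> over the units and splitting into symmetric and skew part yields an
  invertible invariant form \<open>B\<close> with \<open>B\<^sup>T = \<plusminus> B\<close> for which each chosen unit of \<open>E\<close> is either self-adjoint
  or skew-adjoint (\<open>complex_unit_form\<close>, \<open>quaternion_unit_form\<close>). In the quaternionic case both units
  can always be made skew-adjoint, which is why only two quaternionic families occur. Each \<open>B U\<close>, for a
  basis element \<open>U\<close> of \<open>E\<close>, is then symmetric or skew, and counting signs gives the dimensions
  (\<open>dim_forms\<close>).

  For the position of \<open>H\<close>, the pair \<open>(E, B)\<close> amounts to a bilinear or \<open>\<epsilon>\<close>-Hermitian form over the reals, the
  complex numbers or the quaternions, and it is brought to normal form by one Gram-Schmidt argument over the reals (\<open>block_decomposition\<close>): a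
  non-zero \<open>E\<close>-stable subspace on which \<open>B\<close> is nondegenerate contains a small \<open>E\<close>-stable block with a standard
  Gram matrix, one splits it off and repeats. In the resulting basis the forms \<open>B\<close>, \<open>B I\<close>, \<open>B J\<close> have standard
  Gram matrices, and the matrices preserving all of them form the classical group in question.

  That last point is also the content of the five isomorphisms. If \<open>A\<close> preserves an invertible form \<open>F\<close> and a
  second form \<open>F X\<close>, then \<open>A\<close> commutes with \<open>X\<close> (\<open>isometry_commutes\<close>); with \<open>X\<close> the multiplication by \<open>i\<close> this
  says that \<open>A\<close> is complex. A complex isometry of a Hermitian form is quaternionic if and only if it
  also preserves the associated complex bilinear form (\<open>conj_commutes_iff_bilinear\<close>). So each group is the
  image of the one on the other side under \<open>complex_to_real_mat\<close> or \<open>quat_to_complex_mat\<close>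
  (\<open>O_complex_image\<close>, \<open>Sp_complex_image\<close>, \<open>U_complex_image\<close>, \<open>Sp_quat_image\<close>, \<open>O_star_image\<close>).

  The lowest-dimensional groups \<open>O(1, \<complex>)\<close> and \<open>O\<^sup>*(1)\<close> do not occur: they commute with a non-zero singular matrix,
  which Schur's lemma forbids.
\<close>

section \<open>Bilinear forms and Gram matrices\<close>

lemma bform_sum:
  assumes "B \<in> carrier_mat n n" "x \<in> carrier_vec n" "y \<in> carrier_vec n"
  shows "bform B x y = (\<Sum>i<n. \<Sum>j<n. x $ i * B $$ (i, j) * y $ j)"
  using assms unfolding bform_def
  by (auto simp: scalar_prod_def sum_distrib_left algebra_simps atLeast0LessThan intro!: sum.cong)

lemma bform_add_right:
  assumes "B \<in> carrier_mat n n" "x \<in> carrier_vec n" "y \<in> carrier_vec n" "z \<in> carrier_vec n"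
  shows "bform B x (y + z) = bform B x y + bform B x z"
  using assms unfolding bform_def
  by (subst mult_add_distrib_mat_vec[of _ n n], auto intro!: scalar_prod_add_distrib[of _ n])

lemma bform_add_left:
  assumes "B \<in> carrier_mat n n" "x \<in> carrier_vec n" "y \<in> carrier_vec n" "z \<in> carrier_vec n"
  shows "bform B (y + z) x = bform B y x + bform B z x"
  using assms unfolding bform_def by (auto intro!: add_scalar_prod_distrib[of _ n])

lemma bform_smult_right:
  assumes "B \<in> carrier_mat n n" "x \<in> carrier_vec n" "y \<in> carrier_vec n"
  shows "bform B x (c \<cdot>\<^sub>v y) = c * bform B x y"
  using assms unfolding bform_def
  by (subst mult_mat_vec[of _ n n], auto)

lemma bform_smult_left:
  assumes "B \<in> carrier_mat n n" "x \<in> carrier_vec n" "y \<in> carrier_vec n"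
  shows "bform B (c \<cdot>\<^sub>v y) x = c * bform B y x"
proof -
  have "B *\<^sub>v x \<in> carrier_vec n" using assms(1,2) by (rule mult_mat_vec_carrier)
  then show ?thesis unfolding bform_def using assms(3)
    by (intro smult_scalar_prod_distrib)
qed

lemma bform_zero_right:
  assumes "B \<in> carrier_mat n n" "x \<in> carrier_vec n"
  shows "bform B x (0\<^sub>v n) = 0"
proof -
  have "(0::real) \<cdot>\<^sub>v 0\<^sub>v n = 0\<^sub>v n" by auto
  then show ?thesis using bform_smult_right[OF assms zero_carrier_vec[of n], of 0] by simp
qed

lemma bform_mult_right:
  assumes "B \<in> carrier_mat n n" "A \<in> carrier_mat n n" "x \<in> carrier_vec n" "y \<in> carrier_vec n"
  shows "bform B x (A *\<^sub>v y) = bform (B * A) x y"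
  unfolding bform_def assoc_mult_mat_vec[OF assms(1,2,4)] ..

lemma bform_mult_left:
  assumes "B \<in> carrier_mat n n" "A \<in> carrier_mat n n" "x \<in> carrier_vec n" "y \<in> carrier_vec n"
  shows "bform B (A *\<^sub>v x) y = bform (transpose_mat A * B) x y"
proof -
  have By: "B *\<^sub>v y \<in> carrier_vec n" using assms(1,4) by (rule mult_mat_vec_carrier)
  have At: "transpose_mat A \<in> carrier_mat n n" using assms(2) by simp
  have Ax: "A *\<^sub>v x \<in> carrier_vec n" using assms(2,3) by (rule mult_mat_vec_carrier)
  have AB: "transpose_mat A *\<^sub>v (B *\<^sub>v y) \<in> carrier_vec n" using At By by (rule mult_mat_vec_carrier)
  have "bform B (A *\<^sub>v x) y = (B *\<^sub>v y) \<bullet> (A *\<^sub>v x)"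
    unfolding bform_def by (rule comm_scalar_prod[OF Ax By])
  also have "\<dots> = (transpose_mat A *\<^sub>v (B *\<^sub>v y)) \<bullet> x"
    by (rule transpose_vec_mult_scalar[OF assms(2,3) By, symmetric])
  also have "\<dots> = bform (transpose_mat A * B) x y"
    unfolding bform_def assoc_mult_mat_vec[OF At assms(1,4)] by (rule comm_scalar_prod[OF AB assms(3)])
  finally show ?thesis .
qed

lemma bform_transpose:
  assumes "B \<in> carrier_mat n n" "x \<in> carrier_vec n" "y \<in> carrier_vec n"
  shows "bform (transpose_mat B) x y = bform B y x"
  unfolding bform_def
  using transpose_vec_mult_scalar[OF assms(1,2,3)] transpose_vec_mult_scalar[OF assms(1,3,2)] comm_scalar_prod[OF assms(2)]
    mult_mat_vec_carrier[of "transpose_mat B" n n y] assms by (simp only: transpose_carrier_mat)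

lemma bform_mat_smult:
  assumes "B \<in> carrier_mat n n" "x \<in> carrier_vec n" "y \<in> carrier_vec n"
  shows "bform (c \<cdot>\<^sub>m B) x y = c * bform B x y"
  using assms by (simp add: bform_sum[of _ n] sum_distrib_left algebra_simps)

lemma bform_swap:
  assumes "B \<in> carrier_mat n n" "transpose_mat B = \<epsilon> \<cdot>\<^sub>m B" "x \<in> carrier_vec n" "y \<in> carrier_vec n"
  shows "bform B y x = \<epsilon> * bform B x y"
  using bform_transpose[OF assms(1,3,4)] bform_mat_smult[OF assms(1,3,4), of \<epsilon>] unfolding assms(2) by simp

lemma bform_mat_uminus:
  assumes "B \<in> carrier_mat n n" "x \<in> carrier_vec n" "y \<in> carrier_vec n"
  shows "bform (- B) x y = - bform B x y"
  using assms unfolding bform_def 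
  by (subst uminus_mult_mat_vec) (auto intro!: scalar_prod_uminus_right)

lemma bform_unit:
  assumes "B \<in> carrier_mat n n" "i < n" "j < n"
  shows "bform B (unit_vec n i) (unit_vec n j) = B $$ (i, j)"
proof -
  have "bform B (unit_vec n i) (unit_vec n j)
      = (\<Sum>k<n. \<Sum>l<n. if k = i then (if l = j then B $$ (k, l) else 0) else 0)"
    unfolding bform_sum[OF assms(1) unit_vec_carrier unit_vec_carrier]
    using assms(2,3) by (intro sum.cong refl) (auto simp: unit_vec_def)
  then show ?thesis using assms(2,3) by (simp add: sum.If_cases)
qed

lemma bform_eqI:
  assumes "B \<in> carrier_mat n n" "B' \<in> carrier_mat n n"
    and "\<And>x y. x \<in> carrier_vec n \<Longrightarrow> y \<in> carrier_vec n \<Longrightarrow> bform B x y = bform B' x y"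
  shows "B = B'"
proof (rule eq_matI)
  fix i j assume "i < dim_row B'" "j < dim_col B'"
  then have "i < n" "j < n" using assms(2) by auto
  then show "B $$ (i, j) = B' $$ (i, j)"
    using bform_unit[OF assms(1)] bform_unit[OF assms(2)]
      assms(3)[OF unit_vec_carrier unit_vec_carrier, of i j] by simp
qed (use assms in auto)

text \<open>The matrix identity is what all later computations use; it follows by testing the two forms on pairs
  of vectors.\<close>

lemma invariant_form_iff:
  assumes "B \<in> carrier_mat n n" "H \<subseteq> carrier_mat n n"
  shows "invariant_form n H B \<longleftrightarrow> (\<forall>h\<in>H. transpose_mat h * B * h = B)"
proof -
  have e: "bform B (h *\<^sub>v x) (h *\<^sub>v y) = bform (transpose_mat h * B * h) x y"
    if "h \<in> carrier_mat n n" "x \<in> carrier_vec n" "y \<in> carrier_vec n" for h x y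
    using that assms by (simp add: bform_mult_left[of _ n] bform_mult_right[of _ n])
  show ?thesis
  proof
    assume "invariant_form n H B"
    then show "\<forall>h\<in>H. transpose_mat h * B * h = B"
      unfolding invariant_form_def
      using e assms by (intro ballI bform_eqI[of _ n]) (auto simp: subset_iff)
  next
    assume "\<forall>h\<in>H. transpose_mat h * B * h = B"
    then show "invariant_form n H B"
      unfolding invariant_form_def using e assms by (metis subset_iff)
  qed
qed

lemma sym_form_iff:
  assumes "B \<in> carrier_mat n n"
  shows "(\<forall>x\<in>carrier_vec n. \<forall>y\<in>carrier_vec n. bform B x y = bform B y x) \<longleftrightarrow> transpose_mat B = B"
proof -
  have "transpose_mat B = B" if "\<forall>x\<in>carrier_vec n. \<forall>y\<in>carrier_vec n. bform B x y = bform B y x"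
    using that assms by (intro bform_eqI[of _ n]) (auto simp: bform_transpose[of _ n])
  then show ?thesis using bform_transpose[OF assms] by metis
qed

lemma skew_form_iff:
  assumes "B \<in> carrier_mat n n"
  shows "(\<forall>x\<in>carrier_vec n. \<forall>y\<in>carrier_vec n. bform B x y = - bform B y x) \<longleftrightarrow> transpose_mat B = - B"
proof -
  have "transpose_mat B = - B"
    if *: "\<forall>x\<in>carrier_vec n. \<forall>y\<in>carrier_vec n. bform B x y = - bform B y x"
  proof (rule bform_eqI[of _ n])
    fix x y :: "real vec" assume xy: "x \<in> carrier_vec n" "y \<in> carrier_vec n"
    show "bform (transpose_mat B) x y = bform (- B) x y"
      unfolding bform_transpose[OF assms xy] bform_mat_uminus[OF assms xy] using * xy by blast
  qed (use assms in auto)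
  then show ?thesis
    using bform_transpose[OF assms] bform_mat_uminus[OF assms] by (metis minus_minus)
qed

text \<open>Linear combinations are written entry by entry, which keeps them apart from the finite sums of the
  module structure on matrices; in particular the coefficients enter visibly linearly.\<close>

definition mat_comb :: "nat \<Rightarrow> nat \<Rightarrow> (nat \<Rightarrow> real mat) \<Rightarrow> (nat \<Rightarrow> real) \<Rightarrow> real mat" where
  "mat_comb n r F c = mat n n (\<lambda>(i, j). \<Sum>k<r. c k * F k $$ (i, j))"

lemma mat_comb_carrier [simp]: "mat_comb n r F c \<in> carrier_mat n n"
  by (simp add: mat_comb_def)

text \<open>Independence makes the map sending a coefficient vector to its combination a linear isomorphism from
  \<open>\<real>\<^sup>r\<close> onto the span, and dimension is invariant under isomorphism.\<close>

lemma dim_mats_mat_comb: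
  assumes ind: "\<And>c. mat_comb n r F c = 0\<^sub>m n n \<Longrightarrow> \<forall>k<r. c k = 0"
  shows "dim_mats n {mat_comb n r F c | c. True} = r"
proof -
  let ?W = "{mat_comb n r F c | c. True}"
  let ?M = "module_mat TYPE(real) n n"
  let ?T = "\<lambda>v. mat_comb n r F (\<lambda>k. v $ k)"
  interpret M: matrix_vs n n "TYPE(real)" .
  interpret r: vec_space "TYPE(real)" r .
  have add: "mat_comb n r F c + mat_comb n r F c' = mat_comb n r F (\<lambda>k. c k + c' k)" for c c'
    by (intro eq_matI) (auto simp: mat_comb_def sum.distrib algebra_simps)
  have smult: "a \<cdot>\<^sub>m mat_comb n r F c = mat_comb n r F (\<lambda>k. a * c k)" for a c
    by (intro eq_matI) (auto simp: mat_comb_def sum_distrib_left algebra_simps)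
  have zero: "0\<^sub>m n n = mat_comb n r F (\<lambda>k. 0)"
    by (intro eq_matI) (auto simp: mat_comb_def)
  have cong: "mat_comb n r F c = mat_comb n r F c'" if "\<And>k. k < r \<Longrightarrow> c k = c' k" for c c'
    using that by (intro eq_matI) (auto simp: mat_comb_def intro!: sum.cong)
  have "submodule class_ring ?W ?M"
    apply unfold_locales
    apply (auto simp: module_mat_simps class_ring_simps)
    using add apply auto[1]
    using zero apply auto[1]
    using smult by auto
  then have sub: "VectorSpace.subspace class_ring ?W ?M"
    using matrix_vs[where ?'a = real] by (intro VectorSpace.subspace.intro)
  have vsW: "vectorspace class_ring (?M\<lparr>carrier := ?W\<rparr>)"
    by (rule M.subspace_is_vs[OF sub])
  have "linear_map class_ring (module_vec TYPE(real) r) (?M\<lparr>carrier := ?W\<rparr>) ?T"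
    unfolding linear_map_def mod_hom_def mod_hom_axioms_def LinearCombinations.module_hom_def
    using vsW vec_vs[where ?'a = real, of r]
    apply (auto simp: vectorspace_def module_mat_simps module_vec_simps add smult intro!: cong)
    done
  then interpret L: linear_map class_ring "module_vec TYPE(real) r" "?M\<lparr>carrier := ?W\<rparr>" ?T .
  have "r.dim = vectorspace.dim class_ring (?M\<lparr>carrier := ?W\<rparr>)"
  proof (rule L.dim_eq)
    show "r.fin_dim" by simp
    show "inj_on ?T (carrier (module_vec TYPE(real) r))"
    proof (rule inj_onI)
      fix x y assume *: "x \<in> carrier (module_vec TYPE(real) r)" "y \<in> carrier (module_vec TYPE(real) r)"
        "?T x = ?T y"
      have "mat_comb n r F (\<lambda>k. x $ k + -1 * y $ k) = ?T x + (-1) \<cdot>\<^sub>m ?T y"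
        unfolding smult add by simp
      also have "\<dots> = 0\<^sub>m n n" unfolding *(3) by (intro eq_matI) (auto simp: mat_comb_def)
      finally have "mat_comb n r F (\<lambda>k. x $ k + -1 * y $ k) = 0\<^sub>m n n" .
      from ind[OF this] show "x = y" using * by (intro eq_vecI) (auto simp: module_vec_simps)
    qed
    show "?T ` carrier (module_vec TYPE(real) r) = carrier (?M\<lparr>carrier := ?W\<rparr>)"
    proof -
      have "mat_comb n r F c \<in> ?T ` carrier_vec r" for c
        by (rule image_eqI[of _ _ "vec r c"]) (auto intro: cong)
      then show ?thesis by (auto simp: module_vec_simps)
    qed
  qed
  then show ?thesis unfolding dim_mats_def using r.dim_is_n by simp
qed

lemma mat_comb_0: "mat_comb n 0 F c = 0\<^sub>m n n"
  by (intro eq_matI) (auto simp: mat_comb_def)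

lemma mat_comb_Suc:
  assumes "F r \<in> carrier_mat n n"
  shows "mat_comb n (Suc r) F c = mat_comb n r F c + c r \<cdot>\<^sub>m F r"
  using assms by (intro eq_matI) (auto simp: mat_comb_def)

lemma mat_comb_mult_left:
  assumes "B \<in> carrier_mat n n" "\<And>k. k < r \<Longrightarrow> F k \<in> carrier_mat n n"
  shows "B * mat_comb n r F c = mat_comb n r (\<lambda>k. B * F k) c"
  using assms(2)
proof (induction r)
  case 0
  then show ?case using assms(1) by (simp add: mat_comb_0)
next
  case (Suc r)
  have F: "F r \<in> carrier_mat n n" "B * F r \<in> carrier_mat n n" using Suc.prems assms(1) by auto
  show ?case
    using Suc F assms(1)
    by (simp add: mat_comb_Suc mult_add_distrib_mat[of _ n n _ n] mult_smult_distrib[of _ n n _ n])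
qed

lemma mat_comb_add: "mat_comb n r F c + mat_comb n r F c' = mat_comb n r F (\<lambda>k. c k + c' k)"
  by (intro eq_matI) (auto simp: mat_comb_def sum.distrib algebra_simps)

lemma mat_comb_smult: "a \<cdot>\<^sub>m mat_comb n r F c = mat_comb n r F (\<lambda>k. a * c k)"
  by (intro eq_matI) (auto simp: mat_comb_def sum_distrib_left algebra_simps)

lemma mat_comb_transpose:
  assumes "\<And>k. k < r \<Longrightarrow> F k \<in> carrier_mat n n" "\<And>k. k < r \<Longrightarrow> transpose_mat (F k) = \<tau> k \<cdot>\<^sub>m F k"
  shows "transpose_mat (mat_comb n r F c) = mat_comb n r F (\<lambda>k. \<tau> k * c k)"
proof (rule eq_matI)
  fix i j assume "i < dim_row (mat_comb n r F (\<lambda>k. \<tau> k * c k))" "j < dim_col (mat_comb n r F (\<lambda>k. \<tau> k * c k))"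
  then have ij: "i < n" "j < n" by (auto simp: mat_comb_def)
  have "F k $$ (j, i) = \<tau> k * F k $$ (i, j)" if "k < r" for k
  proof -
    have "F k $$ (j, i) = transpose_mat (F k) $$ (i, j)" using assms(1)[OF that] ij by simp
    then show ?thesis unfolding assms(2)[OF that] using assms(1)[OF that] ij by simp
  qed
  then show "transpose_mat (mat_comb n r F c) $$ (i, j) = mat_comb n r F (\<lambda>k. \<tau> k * c k) $$ (i, j)"
    using ij by (auto simp: mat_comb_def intro!: sum.cong)
qed (auto simp: mat_comb_def)

text \<open>Transposition multiplies the \<open>k\<close>-th coefficient by \<open>\<tau> k\<close>. By independence a combination lies in the
  \<open>\<sigma>\<close>-eigenspace iff it only involves those \<open>k\<close> with \<open>\<tau> k = \<sigma>\<close>. With \<open>\<sigma> = 1\<close> and \<open>\<sigma> = -1\<close> this counts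
  symmetric and skew-symmetric forms.\<close>

lemma dim_mats_eigenforms:
  fixes \<tau> :: "nat \<Rightarrow> real"
  assumes F: "\<And>k. k < d \<Longrightarrow> F k \<in> carrier_mat n n" "\<And>k. k < d \<Longrightarrow> transpose_mat (F k) = \<tau> k \<cdot>\<^sub>m F k"
    and ind: "\<And>c. mat_comb n d F c = 0\<^sub>m n n \<Longrightarrow> \<forall>k<d. c k = 0"
  shows "dim_mats n {B. (\<exists>c. B = mat_comb n d F c) \<and> transpose_mat B = \<sigma> \<cdot>\<^sub>m B} = card {k. k < d \<and> \<tau> k = \<sigma>}"
    (is "dim_mats n ?W = card ?S")
proof -
  \<comment> \<open>The surviving indices are renumbered so that the previous lemma applies.\<close>
  obtain \<pi> where \<pi>: "bij_betw \<pi> {..<card ?S} ?S"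
    using ex_bij_betw_nat_finite[of ?S] by (auto simp: atLeast0LessThan)
  let ?r = "card ?S" and ?c = "\<lambda>c k. if k \<in> ?S then c (the_inv_into {..<card ?S} \<pi> k) else 0"
  have inj: "inj_on \<pi> {..<?r}" using \<pi> by (rule bij_betw_imp_inj_on)
  have mem: "\<pi> k \<in> ?S" if "k < ?r" for k using bij_betwE[OF \<pi>] that by auto
  have restrict: "mat_comb n d F c = mat_comb n ?r (F \<circ> \<pi>) (c \<circ> \<pi>)"
    if "\<And>k. k < d \<Longrightarrow> \<tau> k \<noteq> \<sigma> \<Longrightarrow> c k = 0" for c
  proof (rule eq_matI)
    fix i j assume "i < dim_row (mat_comb n ?r (F \<circ> \<pi>) (c \<circ> \<pi>))" "j < dim_col (mat_comb n ?r (F \<circ> \<pi>) (c \<circ> \<pi>))"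
    then have ij: "i < n" "j < n" by (auto simp: mat_comb_def)
    have "(\<Sum>k<d. c k * F k $$ (i, j)) = (\<Sum>k\<in>?S. c k * F k $$ (i, j))"
      by (rule sum.mono_neutral_right) (use that in auto)
    also have "\<dots> = (\<Sum>k<?r. c (\<pi> k) * F (\<pi> k) $$ (i, j))"
      by (rule sum.reindex_bij_betw[OF \<pi>, symmetric])
    finally show "mat_comb n d F c $$ (i, j) = mat_comb n ?r (F \<circ> \<pi>) (c \<circ> \<pi>) $$ (i, j)"
      using ij by (simp add: mat_comb_def)
  qed (auto simp: mat_comb_def)
  have extend: "mat_comb n ?r (F \<circ> \<pi>) c = mat_comb n d F (?c c)" for c
  proof -
    have "mat_comb n d F (?c c) = mat_comb n ?r (F \<circ> \<pi>) (?c c \<circ> \<pi>)" by (rule restrict) auto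
    also have "\<dots> = mat_comb n ?r (F \<circ> \<pi>) c"
      using mem by (intro eq_matI) (auto simp: mat_comb_def the_inv_into_f_f[OF inj] intro!: sum.cong)
    finally show ?thesis ..
  qed
  have "?W = {mat_comb n ?r (F \<circ> \<pi>) c | c. True}"
  proof (intro equalityI subsetI)
    fix B assume "B \<in> ?W"
    then obtain c where c: "B = mat_comb n d F c" "transpose_mat B = \<sigma> \<cdot>\<^sub>m B" by auto
    have "mat_comb n d F (\<lambda>k. \<tau> k * c k + (-1) * (\<sigma> * c k)) = transpose_mat B + (-1) \<cdot>\<^sub>m (\<sigma> \<cdot>\<^sub>m B)"
    proof -
      have "transpose_mat B = mat_comb n d F (\<lambda>k. \<tau> k * c k)"
        unfolding c(1) by (rule mat_comb_transpose[OF F])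
      then show ?thesis by (simp only: c(1) mat_comb_smult mat_comb_add)
    qed
    also have "\<dots> = 0\<^sub>m n n" unfolding c(2) unfolding c(1) by (intro eq_matI) (auto simp: mat_comb_def)
    finally have "\<forall>k<d. \<tau> k * c k + (-1) * (\<sigma> * c k) = 0" by (rule ind)
    then have "\<And>k. k < d \<Longrightarrow> \<tau> k \<noteq> \<sigma> \<Longrightarrow> c k = 0" by (auto simp: algebra_simps)
    from restrict[OF this] show "B \<in> {mat_comb n ?r (F \<circ> \<pi>) c | c. True}" using c(1) by auto
  next
    fix B assume "B \<in> {mat_comb n ?r (F \<circ> \<pi>) c | c. True}"
    then obtain c where c: "B = mat_comb n d F (?c c)" using extend by auto
    have "transpose_mat B = mat_comb n d F (\<lambda>k. \<tau> k * ?c c k)"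
      unfolding c by (rule mat_comb_transpose[OF F])
    also have "\<dots> = \<sigma> \<cdot>\<^sub>m B" unfolding c mat_comb_smult
      by (intro eq_matI) (auto simp: mat_comb_def intro!: sum.cong)
    finally show "B \<in> ?W" using c by auto
  qed
  moreover have "dim_mats n {mat_comb n ?r (F \<circ> \<pi>) c | c. True} = ?r"
  proof (rule dim_mats_mat_comb)
    fix c assume "mat_comb n ?r (F \<circ> \<pi>) c = 0\<^sub>m n n"
    then have "\<forall>k<d. ?c c k = 0" unfolding extend by (rule ind)
    then have "?c c (\<pi> k) = 0" if "k < ?r" for k using mem[OF that] by blast
    moreover have "?c c (\<pi> k) = c k" if "k < ?r" for k
      using mem[OF that] the_inv_into_f_f[OF inj, of k] that by simp
    ultimately show "\<forall>k<?r. c k = 0" by simp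
  qed
  ultimately show ?thesis by simp
qed

section \<open>Schur's lemma\<close>

lemma GL_iff:
  "A \<in> carrier (GL TYPE('a::semiring_1) n) \<longleftrightarrow>
     A \<in> carrier_mat n n \<and> (\<exists>B\<in>carrier_mat n n. B * A = 1\<^sub>m n \<and> A * B = 1\<^sub>m n)"
  by (auto simp: GL_def units_of_def Units_def ring_mat_def)

lemma GL_group: "group (GL TYPE(real) k)"
  unfolding GL_def by (rule monoid.units_group[OF ring.is_monoid[OF ring_mat]])

lemma zero_mat_mult_vec [simp]: "v \<in> carrier_vec n \<Longrightarrow> 0\<^sub>m m n *\<^sub>v v = (0\<^sub>v m :: real vec)"
  by (intro eq_vecI) auto

lemma mat_mult_zero_vec [simp]: "A \<in> carrier_mat m n \<Longrightarrow> A *\<^sub>v 0\<^sub>v n = (0\<^sub>v m :: real vec)"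
  by (intro eq_vecI) auto

lemma smult_zero_vec' [simp]: "c \<cdot>\<^sub>v 0\<^sub>v n = (0\<^sub>v n :: real vec)"
  by (intro eq_vecI) auto

lemma mat_mult_zero_vecI:
  assumes "A \<in> carrier_mat n n" "\<And>v. v \<in> carrier_vec n \<Longrightarrow> A *\<^sub>v v = 0\<^sub>v n"
  shows "A = (0\<^sub>m n n :: real mat)"
proof (rule bform_eqI[of _ n])
  fix x y :: "real vec" assume "x \<in> carrier_vec n" "y \<in> carrier_vec n"
  then show "bform A x y = bform (0\<^sub>m n n) x y" 
    unfolding bform_def using assms(2)[of y] by simp
qed (use assms in auto)

lemma square_mult_carrier [simp]:
  "A \<in> carrier_mat n n \<Longrightarrow> B \<in> carrier_mat n n \<Longrightarrow> A * B \<in> carrier_mat n n"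
  by simp

lemma smult_smult_mat [simp]: "a \<cdot>\<^sub>m (b \<cdot>\<^sub>m A) = (a * b :: real) \<cdot>\<^sub>m A"
  by (intro eq_matI) auto

lemma one_smult_mat [simp]: "1 \<cdot>\<^sub>m A = (A :: real mat)"
  by (intro eq_matI) auto

text \<open>Irreducibility is stated through closure properties of an invariant subset \<open>W\<close>, so that a kernel can be
  substituted for \<open>W\<close> directly.\<close>

locale irreducible_group =
  fixes n :: nat and H :: "real mat set"
  assumes H_GL: "H \<subseteq> carrier (GL TYPE(real) n)" and n: "0 < n"
    and irr: "\<And>W. W \<subseteq> carrier_vec n \<Longrightarrow> 0\<^sub>v n \<in> W \<Longrightarrow> (\<And>x y. x \<in> W \<Longrightarrow> y \<in> W \<Longrightarrow> x + y \<in> W)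
       \<Longrightarrow> (\<And>c x. x \<in> W \<Longrightarrow> c \<cdot>\<^sub>v x \<in> W) \<Longrightarrow> (\<And>h w. h \<in> H \<Longrightarrow> w \<in> W \<Longrightarrow> h *\<^sub>v w \<in> W)
       \<Longrightarrow> W = {0\<^sub>v n} \<or> W = carrier_vec n"
begin

abbreviation "E \<equiv> End_alg n H"

lemma H_carrier: "h \<in> H \<Longrightarrow> h \<in> carrier_mat n n"
  using H_GL by (auto simp: GL_iff)

text \<open>Schur's lemma in the form used below: an invariant kernel is zero or everything.\<close>

lemma kernel_invariant_imp_zero:
  assumes A: "A \<in> carrier_mat n n" and inv: "\<And>h v. h \<in> H \<Longrightarrow> v \<in> carrier_vec n \<Longrightarrow> A *\<^sub>v v = 0\<^sub>v n \<Longrightarrow> A *\<^sub>v (h *\<^sub>v v) = 0\<^sub>v n"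
    and v: "v \<in> carrier_vec n" "v \<noteq> 0\<^sub>v n" "A *\<^sub>v v = 0\<^sub>v n"
  shows "A = 0\<^sub>m n n"
proof -
  let ?W = "{w \<in> carrier_vec n. A *\<^sub>v w = 0\<^sub>v n}"
  have "?W = {0\<^sub>v n} \<or> ?W = carrier_vec n"
  proof (rule irr)
    show "x + y \<in> ?W" if "x \<in> ?W" "y \<in> ?W" for x y
      using that A by (auto simp: mult_add_distrib_mat_vec[of _ n n])
    show "c \<cdot>\<^sub>v x \<in> ?W" if "x \<in> ?W" for c x
      using that A by (auto simp: mult_mat_vec[of _ n n])
    show "h *\<^sub>v w \<in> ?W" if "h \<in> H" "w \<in> ?W" for h w
      using inv[OF that(1)] H_carrier[OF that(1)] that(2) by simp
  qed (use A in auto)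
  then have "?W = carrier_vec n" using v by auto
  then show ?thesis using A by (intro mat_mult_zero_vecI) auto
qed

lemma End_carrier [simp]: "A \<in> E \<Longrightarrow> A \<in> carrier_mat n n"
  by (simp add: End_alg_def)

lemma End_commute: "A \<in> E \<Longrightarrow> h \<in> H \<Longrightarrow> A * h = h * A"
  unfolding End_alg_def by blast

lemma End_kernel:
  assumes A: "A \<in> E" and v: "v \<in> carrier_vec n" "v \<noteq> 0\<^sub>v n" "A *\<^sub>v v = 0\<^sub>v n"
  shows "A = 0\<^sub>m n n"
proof (rule kernel_invariant_imp_zero[OF _ _ v])
  fix h w assume h: "h \<in> H" and w: "w \<in> carrier_vec n" "A *\<^sub>v w = 0\<^sub>v n"
  have "A *\<^sub>v (h *\<^sub>v w) = (A * h) *\<^sub>v w"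
    using End_carrier[OF A] H_carrier[OF h] w by simp
  also have "\<dots> = h *\<^sub>v (A *\<^sub>v w)"
    unfolding End_commute[OF A h] using End_carrier[OF A] H_carrier[OF h] w(1) by simp
  finally show "A *\<^sub>v (h *\<^sub>v w) = 0\<^sub>v n" using w H_carrier[OF h] by simp
qed (use A in simp)

text \<open>The kernel of an invariant form is invariant: pairing \<open>B (h w)\<close> with \<open>x = h (g x)\<close>, where \<open>g\<close> is inverse to \<open>h\<close>, gives the pairing of
  \<open>B w\<close> with \<open>g x\<close>.\<close>

lemma invariant_form_kernel:
  assumes B: "B \<in> carrier_mat n n" "invariant_form n H B"
    and v: "v \<in> carrier_vec n" "v \<noteq> 0\<^sub>v n" "B *\<^sub>v v = 0\<^sub>v n"
  shows "B = 0\<^sub>m n n"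
proof (rule kernel_invariant_imp_zero[OF B(1) _ v])
  fix h w assume h: "h \<in> H" and w: "w \<in> carrier_vec n" "B *\<^sub>v w = 0\<^sub>v n"
  have hc: "h \<in> carrier_mat n n" using H_carrier[OF h] .
  have "h \<in> carrier (GL TYPE(real) n)" using h H_GL by blast
  then obtain g where g: "g \<in> carrier_mat n n" "h * g = 1\<^sub>m n"
    unfolding GL_iff by blast
  have hw: "h *\<^sub>v w \<in> carrier_vec n" using hc w by simp
  have "x \<bullet> (B *\<^sub>v (h *\<^sub>v w)) = 0" if x: "x \<in> carrier_vec n" for x
  proof -
    have gx: "g *\<^sub>v x \<in> carrier_vec n" using g x by simp
    have "x = h *\<^sub>v (g *\<^sub>v x)"
      using x g hc by (metis assoc_mult_mat_vec one_mult_mat_vec)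
    then have "x \<bullet> (B *\<^sub>v (h *\<^sub>v w)) = bform B (h *\<^sub>v (g *\<^sub>v x)) (h *\<^sub>v w)"
      by (simp add: bform_def)
    also have "\<dots> = bform B (g *\<^sub>v x) w"
      using B(2) h gx w by (simp add: invariant_form_def)
    also have "\<dots> = 0" using w gx by (simp add: bform_def)
    finally show ?thesis .
  qed
  then show "B *\<^sub>v (h *\<^sub>v w) = 0\<^sub>v n"
    using B(1) hw scalar_prod_left_unit[of "B *\<^sub>v (h *\<^sub>v w)" n]
    by (intro eq_vecI) (metis index_zero_vec(1) mult_mat_vec_carrier unit_vec_carrier index_zero_vec(2), auto)
qed

lemma EndI: "A \<in> carrier_mat n n \<Longrightarrow> (\<And>h. h \<in> H \<Longrightarrow> A * h = h * A) \<Longrightarrow> A \<in> E"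
  unfolding End_alg_def by blast

lemma End_one: "1\<^sub>m n \<in> E"
  by (rule EndI) (simp_all add: left_mult_one_mat[OF H_carrier] right_mult_one_mat[OF H_carrier])

lemmas mat_ring_simps = assoc_mult_mat[of _ n n _ n _ n] add_mult_distrib_mat[of _ n n _ _ n]
  mult_add_distrib_mat[of _ n n _ n] mult_smult_assoc_mat[of _ n n _ n] mult_smult_distrib[of _ n n _ n]
  left_mult_one_mat[of _ n n] right_mult_one_mat[of _ n n]

lemma mat_lin_eqI:
  assumes "A \<in> carrier_mat n n" "B \<in> carrier_mat n n"
    "\<And>i j. i < n \<Longrightarrow> j < n \<Longrightarrow> A $$ (i, j) = B $$ (i, j)"
  shows "A = B"
  using assms by (intro eq_matI) auto

lemma index_add_square:
  "A \<in> carrier_mat n n \<Longrightarrow> B \<in> carrier_mat n n \<Longrightarrow> i < n \<Longrightarrow> j < n \<Longrightarrow> (A + B) $$ (i, j) = A $$ (i, j) + B $$ (i, j)"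
  by simp

lemma index_smult_square:
  "A \<in> carrier_mat n n \<Longrightarrow> i < n \<Longrightarrow> j < n \<Longrightarrow> (c \<cdot>\<^sub>m A) $$ (i, j) = c * A $$ (i, j)"
  by simp

lemmas mat_index_simps = index_add_square index_smult_square

lemma End_add: assumes "A \<in> E" "B \<in> E" shows "A + B \<in> E"
proof (rule EndI)
  fix h assume "h \<in> H"
  from End_commute[OF assms(1) this] End_commute[OF assms(2) this] H_carrier[OF this]
  show "(A + B) * h = h * (A + B)" using assms[THEN End_carrier] by (simp add: mat_ring_simps)
qed (use assms[THEN End_carrier] in simp)

lemma End_smult: assumes "A \<in> E" shows "c \<cdot>\<^sub>m A \<in> E"
proof (rule EndI)
  fix h assume "h \<in> H"
  from End_commute[OF assms(1) this] H_carrier[OF this]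
  show "(c \<cdot>\<^sub>m A) * h = h * (c \<cdot>\<^sub>m A)" using assms[THEN End_carrier] by (simp add: mat_ring_simps)
qed (use assms[THEN End_carrier] in simp)

lemma End_mult: assumes "A \<in> E" "B \<in> E" shows "A * B \<in> E"
proof (rule EndI)
  fix h assume h: "h \<in> H"
  note [simp] = H_carrier[OF h] assms[THEN End_carrier]
  have "A * B * h = A * (h * B)" using End_commute[OF assms(2) h] by (simp add: mat_ring_simps)
  also have "\<dots> = (h * A) * B" by (simp add: mat_ring_simps(1)[symmetric] End_commute[OF assms(1) h] del: assoc_mult_mat)
  finally show "A * B * h = h * (A * B)" by (simp add: mat_ring_simps)
qed (use assms[THEN End_carrier] in simp)

lemma mult_eq_0:
  assumes "A \<in> E" "B \<in> carrier_mat n n" "A * B = 0\<^sub>m n n"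
  shows "A = 0\<^sub>m n n \<or> B = 0\<^sub>m n n"
proof (rule ccontr)
  assume *: "\<not> ?thesis"
  then obtain v where v: "v \<in> carrier_vec n" "B *\<^sub>v v \<noteq> 0\<^sub>v n"
    using mat_mult_zero_vecI[OF assms(2)] by blast
  have "A *\<^sub>v (B *\<^sub>v v) = (A * B) *\<^sub>v v" using End_carrier[OF assms(1)] assms(2) v by simp
  also have "\<dots> = 0\<^sub>v n" unfolding assms(3) using v by simp
  finally show False using End_kernel[OF assms(1), of "B *\<^sub>v v"] * assms(2) v by auto
qed

text \<open>A complex eigenvector \<open>x + i y\<close> of \<open>A\<close> with eigenvalue \<open>a + i b\<close> satisfies \<open>(A - a) x = - b y\<close> and
  \<open>(A - a) y = b x\<close>, so \<open>(A - a)\<^sup>2 + b\<^sup>2\<close> kills both real vectors. It lies in \<open>E\<close> and is singular, hence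
  vanishes.\<close>

lemma End_square:
  assumes A: "A \<in> E"
  obtains a b where "(A + (-a) \<cdot>\<^sub>m 1\<^sub>m n) * (A + (-a) \<cdot>\<^sub>m 1\<^sub>m n) = (-(b^2)) \<cdot>\<^sub>m 1\<^sub>m n"
proof -
  note Ac [simp] = End_carrier[OF A]
  let ?C = "map_mat complex_of_real A"
  have C: "?C \<in> carrier_mat n n" by simp
  obtain k v where "eigenvector ?C v k"
    using spectrum_non_empty[OF C n] unfolding spectrum_def eigenvalue_def by auto
  then have v: "v \<in> carrier_vec n" "v \<noteq> 0\<^sub>v n" "?C *\<^sub>v v = k \<cdot>\<^sub>v v"
    using carrier_matD(1)[OF Ac] unfolding eigenvector_def by auto
  define x y where "x = map_vec Re v" and "y = map_vec Im v"
  have xy [simp]: "x \<in> carrier_vec n" "y \<in> carrier_vec n" using v by (auto simp: x_def y_def)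
  define T where "T = A + (- Re k) \<cdot>\<^sub>m 1\<^sub>m n"
  have T: "T \<in> E" unfolding T_def by (intro End_add End_smult A End_one)
  note Tc [simp] = End_carrier[OF T]
  have Re_C: "map_vec Re (?C *\<^sub>v v) = A *\<^sub>v x" "map_vec Im (?C *\<^sub>v v) = A *\<^sub>v y"
    using v(1) carrier_matD[OF Ac] by (auto simp: x_def y_def scalar_prod_def)
  have Ax: "A *\<^sub>v x = Re k \<cdot>\<^sub>v x + (- Im k) \<cdot>\<^sub>v y" "A *\<^sub>v y = Im k \<cdot>\<^sub>v x + Re k \<cdot>\<^sub>v y"
    unfolding Re_C[symmetric] v(3) using v(1) by (auto simp: x_def y_def)
  have one: "(c \<cdot>\<^sub>m 1\<^sub>m n) *\<^sub>v w = c \<cdot>\<^sub>v w" if "w \<in> carrier_vec n" for c and w :: "real vec"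
    using that by (intro eq_vecI) (auto simp: carrier_vecD row_smult smult_scalar_prod_distrib[of _ n])
  have Tx: "T *\<^sub>v x = (- Im k) \<cdot>\<^sub>v y" "T *\<^sub>v y = Im k \<cdot>\<^sub>v x"
    unfolding T_def by (simp_all add: add_mult_distrib_mat_vec[of _ n n] one Ax)
      (auto intro!: eq_vecI simp: carrier_vecD[OF xy(1)] carrier_vecD[OF xy(2)])
  define S where "S = T * T + (Im k)^2 \<cdot>\<^sub>m 1\<^sub>m n"
  have S: "S \<in> E" unfolding S_def by (intro End_add End_smult End_mult T End_one)
  have TTc: "T * T \<in> carrier_mat n n" by simp
  have Sw: "S *\<^sub>v w = T *\<^sub>v (T *\<^sub>v w) + (Im k)^2 \<cdot>\<^sub>v w" if "w \<in> carrier_vec n" for w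
    unfolding S_def using that add_mult_distrib_mat_vec[OF TTc _ that, of "(Im k)^2 \<cdot>\<^sub>m 1\<^sub>m n"]
    by (simp add: one assoc_mult_mat_vec[OF Tc Tc])
  have "S *\<^sub>v x = 0\<^sub>v n" "S *\<^sub>v y = 0\<^sub>v n"
    by (auto simp: Sw Tx mult_mat_vec[OF Tc] power2_eq_square carrier_vecD[OF xy(1)] carrier_vecD[OF xy(2)]
      intro!: eq_vecI)
  moreover have "x \<noteq> 0\<^sub>v n \<or> y \<noteq> 0\<^sub>v n"
  proof (rule ccontr)
    assume "\<not> ?thesis"
    then have "x = 0\<^sub>v n" "y = 0\<^sub>v n" by auto
    then have "v $ i = 0" if "i < n" for i
      using that v(1) by (metis complex_eqI carrier_vecD index_map_vec(1) index_zero_vec(1) x_def y_def zero_complex.sel)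
    then show False using v(1,2) by auto
  qed
  ultimately have S0: "S = 0\<^sub>m n n" using End_kernel[OF S xy(1)] End_kernel[OF S xy(2)] by blast
  have "T * T = S + (-((Im k)^2)) \<cdot>\<^sub>m 1\<^sub>m n"
    unfolding S_def by (intro eq_matI) (auto simp: carrier_matD[OF Tc])
  then have "T * T = (-((Im k)^2)) \<cdot>\<^sub>m 1\<^sub>m n" unfolding S0 by simp
  then show ?thesis using that unfolding T_def by blast
qed

lemma End_cases:
  assumes A: "A \<in> E"
  obtains (real) a where "A = a \<cdot>\<^sub>m 1\<^sub>m n"
  | (complex) a b I where "b \<noteq> 0" "I \<in> E" "I * I = (-1) \<cdot>\<^sub>m 1\<^sub>m n" "A = a \<cdot>\<^sub>m 1\<^sub>m n + b \<cdot>\<^sub>m I" 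
      "I = (1/b) \<cdot>\<^sub>m (A + (-a) \<cdot>\<^sub>m 1\<^sub>m n)"
proof -
  note Ac [simp] = End_carrier[OF A]
  obtain a b where ab: "(A + (-a) \<cdot>\<^sub>m 1\<^sub>m n) * (A + (-a) \<cdot>\<^sub>m 1\<^sub>m n) = (-(b^2)) \<cdot>\<^sub>m 1\<^sub>m n"
    using End_square[OF A] by blast
  define T where "T = A + (-a) \<cdot>\<^sub>m 1\<^sub>m n"
  have T: "T \<in> E" unfolding T_def by (intro End_add End_smult A End_one)
  note Tc [simp] = End_carrier[OF T]
  have TT: "T * T = (-(b^2)) \<cdot>\<^sub>m 1\<^sub>m n" using ab unfolding T_def .
  have AT: "A = a \<cdot>\<^sub>m 1\<^sub>m n + T" unfolding T_def using carrier_matD[OF Ac] by (intro eq_matI) auto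
  show ?thesis
  proof (cases "b = 0")
    case True
    then have "T * T = 0\<^sub>m n n" unfolding TT by (intro eq_matI) auto
    then have "T = 0\<^sub>m n n" using mult_eq_0[OF T Tc] by auto
    then show ?thesis using real[of a] AT by simp
  next
    case False
    show ?thesis
    proof (rule complex[of b "(1/b) \<cdot>\<^sub>m T" a])
      show "(1/b) \<cdot>\<^sub>m T * ((1/b) \<cdot>\<^sub>m T) = (-1) \<cdot>\<^sub>m 1\<^sub>m n"
        by (simp add: mat_ring_simps TT) (use False in \<open>auto intro!: eq_matI simp: power2_eq_square\<close>)
      show "A = a \<cdot>\<^sub>m 1\<^sub>m n + b \<cdot>\<^sub>m ((1/b) \<cdot>\<^sub>m T)"
        unfolding AT using False carrier_matD[OF Tc] by (intro eq_matI) auto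
    qed (use False T End_smult T_def in auto)
  qed
qed

abbreviation sc :: "real \<Rightarrow> real mat" where "sc a \<equiv> a \<cdot>\<^sub>m 1\<^sub>m n"

text \<open>Write \<open>A = a + b K\<close> with \<open>K\<^sup>2 = -1\<close>. As \<open>K\<close> commutes with \<open>I\<close>, \<open>(K - I) (K + I) = 0\<close>, and \<open>E\<close> has no zero
  divisors.\<close>

lemma complex_unit_centralizer:
  assumes I: "I \<in> E" "I * I = sc (-1)" and A: "A \<in> E" and c: "A * I = I * A"
  shows "\<exists>a b. A = sc a + b \<cdot>\<^sub>m I"
  using A
proof (cases rule: End_cases)
  case (real a)
  then have "A = sc a + 0 \<cdot>\<^sub>m I" using carrier_matD[OF End_carrier[OF I(1)]] by (intro eq_matI) auto
  then show ?thesis by blast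
next
  case (complex a b K)
  note [simp] = I(1)[THEN End_carrier] A[THEN End_carrier] complex(2)[THEN End_carrier]
  have KI: "K * I = I * K"
    unfolding complex(5) by (simp add: mat_ring_simps c)
  have "(K + (-1) \<cdot>\<^sub>m I) * (K + I) = K * K + (K * I + (-1) \<cdot>\<^sub>m (I * K)) + (-1) \<cdot>\<^sub>m (I * I)"
    by (simp add: mat_ring_simps) (rule mat_lin_eqI; simp add: mat_index_simps algebra_simps del: index_mult_mat(1))
  also have "\<dots> = 0\<^sub>m n n" unfolding KI I(2) complex(3) by (rule mat_lin_eqI) (simp_all add: mat_index_simps algebra_simps del: index_mult_mat(1))
  finally have "K + (-1) \<cdot>\<^sub>m I = 0\<^sub>m n n \<or> K + I = 0\<^sub>m n n"
    using mult_eq_0[of "K + (-1) \<cdot>\<^sub>m I" "K + I"] I complex(2) by (auto intro!: End_add End_smult)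
  then obtain s where s: "K = s \<cdot>\<^sub>m I"
  proof
    assume 0: "K + (-1) \<cdot>\<^sub>m I = 0\<^sub>m n n"
    have "K = (K + (-1) \<cdot>\<^sub>m I) + I" by (rule mat_lin_eqI) (simp_all add: mat_index_simps algebra_simps del: index_mult_mat(1))
    then have "K = 1 \<cdot>\<^sub>m I" unfolding 0 by simp
    then show ?thesis using that by blast
  next
    assume 0: "K + I = 0\<^sub>m n n"
    have "K = (K + I) + (-1) \<cdot>\<^sub>m I" by (rule mat_lin_eqI) (simp_all add: mat_index_simps algebra_simps del: index_mult_mat(1))
    then have "K = (-1) \<cdot>\<^sub>m I" unfolding 0 by simp
    then show ?thesis using that by blast
  qed
  have "A = sc a + (b * s) \<cdot>\<^sub>m I" unfolding complex(4) s by (rule mat_lin_eqI) (simp_all add: mat_index_simps algebra_simps del: index_mult_mat(1))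
  then show ?thesis by blast
qed

text \<open>Frobenius' theorem. If \<open>E\<close> is not the centralizer of a square root \<open>I\<close> of \<open>-1\<close>, some \<open>L \<noteq> 0\<close> anticommutes
  with \<open>I\<close>. Its square commutes with \<open>I\<close> and with \<open>L\<close>, which forces it to be a negative scalar, and
  \<open>J\<close> is \<open>L\<close> normalised. Every \<open>B \<in> E\<close> is a sum of a part commuting with \<open>I\<close> and a part anticommuting with
  \<open>I\<close>; the latter becomes commuting after multiplication by \<open>J\<close>.\<close>

lemma End_trichotomy:
  obtains (real) "E = range sc"
  | (complex) I where "I \<in> E" "I * I = sc (-1)" "E = {sc a + b \<cdot>\<^sub>m I | a b. True}"
  | (quaternion) I J where "I \<in> E" "J \<in> E" "I * I = sc (-1)" "J * J = sc (-1)" "J * I = (-1) \<cdot>\<^sub>m (I * J)"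
      "E = {sc a + b \<cdot>\<^sub>m I + c \<cdot>\<^sub>m J + d \<cdot>\<^sub>m (I * J) | a b c d. True}"
proof (cases "\<exists>I\<in>E. I * I = sc (-1)")
  case False
  have "A \<in> range sc" if "A \<in> E" for A
    using that
  proof (cases rule: End_cases)
    case (complex a b I)
    then show ?thesis using False by blast
  qed blast
  then have "E = range sc" using End_smult[OF End_one] by blast
  then show ?thesis by (rule real)
next
  case True
  then obtain I where I: "I \<in> E" "I * I = sc (-1)" by auto
  note Ic [simp] = End_carrier[OF I(1)]
  have IIX: "I * (I * X) = (-1) \<cdot>\<^sub>m X" if "X \<in> carrier_mat n n" for X
    using that I(2) Ic by (simp add: mat_ring_simps(1)[symmetric] del: assoc_mult_mat) (simp add: mat_ring_simps)
  show ?thesis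
  proof (cases "\<forall>A\<in>E. A * I = I * A")
    case True
    have "E = {sc a + b \<cdot>\<^sub>m I | a b. True}"
    proof (intro equalityI subsetI)
      fix A assume "A \<in> E"
      then show "A \<in> {sc a + b \<cdot>\<^sub>m I | a b. True}"
        using complex_unit_centralizer[OF I, of A] True by blast
    next
      fix A assume "A \<in> {sc a + b \<cdot>\<^sub>m I | a b. True}"
      then obtain a b where "A = sc a + b \<cdot>\<^sub>m I" by blast
      then show "A \<in> E" by (simp add: End_add End_smult End_one I(1))
    qed
    then show ?thesis using complex I by blast
  next
    case False
    then obtain A where A: "A \<in> E" "A * I \<noteq> I * A" by auto
    note Ac [simp] = End_carrier[OF A(1)]
    \<comment> \<open>The part of \<open>2 A\<close> that anticommutes with \<open>I\<close>; it vanishes only if \<open>A\<close> commutes with \<open>I\<close>.\<close>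
    define L where "L = A + I * A * I"
    have L: "L \<in> E" unfolding L_def by (intro End_add End_mult A I)
    note Lc [simp] = End_carrier[OF L]
    have LI: "L * I = (-1) \<cdot>\<^sub>m (I * L)"
      unfolding L_def by (simp add: mat_ring_simps I(2) IIX) (rule mat_lin_eqI; simp add: mat_index_simps algebra_simps del: index_mult_mat(1))
    have L0: "L \<noteq> 0\<^sub>m n n"
    proof
      assume "L = 0\<^sub>m n n"
      then have "L * I = 0\<^sub>m n n" using left_mult_zero_mat[OF Ic] by simp
      moreover have "L * I = A * I + (-1) \<cdot>\<^sub>m (I * A)"
        unfolding L_def by (simp add: mat_ring_simps I(2) IIX)
      ultimately have "A * I + (-1) \<cdot>\<^sub>m (I * A) + I * A = I * A" by simp
      moreover have "A * I + (-1) \<cdot>\<^sub>m (I * A) + I * A = A * I"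
        by (rule mat_lin_eqI) (simp_all add: mat_index_simps algebra_simps del: index_mult_mat(1))
      ultimately show False using A(2) by simp
    qed
    have LLI: "L * L * I = I * (L * L)"
    proof -
      have "L * L * I = L * (L * I)" by (simp add: mat_ring_simps)
      also have "\<dots> = (-1) \<cdot>\<^sub>m ((L * I) * L)" by (subst LI) (simp add: mat_ring_simps)
      also have "\<dots> = I * (L * L)" unfolding LI by (simp add: mat_ring_simps)
      finally show ?thesis .
    qed
    obtain x y where xy: "L * L = sc x + y \<cdot>\<^sub>m I"
      using complex_unit_centralizer[OF I End_mult[OF L L] LLI] by blast
    \<comment> \<open>\<open>L * L\<close> commutes with \<open>L\<close>, while \<open>I\<close> anticommutes with it.\<close>
    have y0: "y = 0"
    proof (rule ccontr)
      assume "y \<noteq> 0"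
      have "L * (L * L) = (L * L) * L" by (simp add: mat_ring_simps)
      then have "x \<cdot>\<^sub>m L + y \<cdot>\<^sub>m (L * I) = x \<cdot>\<^sub>m L + y \<cdot>\<^sub>m (I * L)"
        unfolding xy by (simp add: mat_ring_simps)
      then have "\<And>i j. i < n \<Longrightarrow> j < n \<Longrightarrow> (x \<cdot>\<^sub>m L + y \<cdot>\<^sub>m (L * I)) $$ (i,j) = (x \<cdot>\<^sub>m L + y \<cdot>\<^sub>m (I * L)) $$ (i,j)"
        by simp
      then have e: "\<And>i j. i < n \<Longrightarrow> j < n \<Longrightarrow> (I * L) $$ (i,j) = 0"
        unfolding LI using \<open>y \<noteq> 0\<close> by (simp add: mat_index_simps algebra_simps del: index_mult_mat(1))
      have "I * L = 0\<^sub>m n n" using e by (intro mat_lin_eqI) (simp_all add: mat_index_simps algebra_simps del: index_mult_mat(1))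
      then have "I = 0\<^sub>m n n" using mult_eq_0[OF I(1) Lc] L0 by auto
      then have "sc (-1) = 0\<^sub>m n n" using I(2) by simp
      then have "sc (-1) $$ (0,0) = 0\<^sub>m n n $$ (0,0)" by simp
      then show False using n by simp
    qed
    have LL: "L * L = sc x" unfolding xy y0 by (rule mat_lin_eqI) (simp_all add: mat_index_simps algebra_simps del: index_mult_mat(1))
    have comm_real: "L \<noteq> sc r" for r
    proof
      assume "L = sc r"
      then have "L * I = I * L" by (simp add: mat_ring_simps)
      then have "2 \<cdot>\<^sub>m (I * L) = (I * L) + (-1) \<cdot>\<^sub>m (I * L)" unfolding LI
        using \<open>L * I = I * L\<close> LI by (intro mat_lin_eqI) (simp_all add: mat_index_simps algebra_simps del: index_mult_mat(1))
      then have "\<And>i j. i < n \<Longrightarrow> j < n \<Longrightarrow> (2 \<cdot>\<^sub>m (I * L)) $$ (i,j) = (I * L + (-1) \<cdot>\<^sub>m (I * L)) $$ (i,j)" by simp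
      then have "\<And>i j. i < n \<Longrightarrow> j < n \<Longrightarrow> (I * L) $$ (i,j) = 0" by (simp add: mat_index_simps algebra_simps del: index_mult_mat(1))
      then have "I * L = 0\<^sub>m n n" by (intro mat_lin_eqI) (simp_all add: mat_index_simps algebra_simps del: index_mult_mat(1))
      then have "I = 0\<^sub>m n n" using mult_eq_0[OF I(1) Lc] L0 by auto
      then have "sc (-1) = 0\<^sub>m n n" using I(2) by simp
      then have "sc (-1) $$ (0,0) = 0\<^sub>m n n $$ (0,0)" by simp
      then show False using n by simp
    qed
    \<comment> \<open>Otherwise \<open>L\<close> would be one of the scalars \<open>\<plusminus> sqrt x\<close>.\<close>
    have x: "x < 0"
    proof (rule ccontr)
      assume "\<not> x < 0"
      then have s: "sqrt x * sqrt x = x" "\<bar>x\<bar> = x" by auto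
      have "(L + sc (- sqrt x)) * (L + sc (sqrt x)) = 0\<^sub>m n n"
        by (simp add: mat_ring_simps LL) (rule mat_lin_eqI; simp add: mat_index_simps algebra_simps s del: index_mult_mat(1))
      then have "L + sc (- sqrt x) = 0\<^sub>m n n \<or> L + sc (sqrt x) = 0\<^sub>m n n"
        by (intro mult_eq_0 End_add End_smult End_one L) simp_all
      moreover have "L = (L + sc c) + sc (-c)" for c by (rule mat_lin_eqI) (simp_all add: mat_index_simps algebra_simps del: index_mult_mat(1))
      ultimately have "L = 0\<^sub>m n n + sc (- (- sqrt x)) \<or> L = 0\<^sub>m n n + sc (- sqrt x)" by metis
      then show False using comm_real by auto
    qed
    define J where "J = (1 / sqrt (-x)) \<cdot>\<^sub>m L"
    have J: "J \<in> E" unfolding J_def by (intro End_smult L)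
    note Jc [simp] = End_carrier[OF J]
    have JJ: "J * J = sc (-1)"
      unfolding J_def by (simp add: mat_ring_simps LL) (rule mat_lin_eqI; use x in \<open>simp add: mat_index_simps field_simps del: index_mult_mat(1)\<close>)
    have JI: "J * I = (-1) \<cdot>\<^sub>m (I * J)"
      unfolding J_def by (simp add: mat_ring_simps LI)
    have "\<exists>a b c d. B = sc a + b \<cdot>\<^sub>m I + c \<cdot>\<^sub>m J + d \<cdot>\<^sub>m (I * J)" if B: "B \<in> E" for B
    proof -
      note Bc [simp] = End_carrier[OF B]
      have BJ: "B = (-1) \<cdot>\<^sub>m (B * J * J)" by (simp add: mat_ring_simps JJ)
      define P Q where "P = (1/2) \<cdot>\<^sub>m (B + (-1) \<cdot>\<^sub>m (I * B * I))"
        and "Q = (1/2) \<cdot>\<^sub>m (B + (I * B * I))"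
      have PQ: "P \<in> E" "Q \<in> E" unfolding P_def Q_def by (intro End_add End_smult End_mult B I)+
      note [simp] = PQ[THEN End_carrier]
      have B_PQ: "B = P + Q" unfolding P_def Q_def
        by (rule mat_lin_eqI) (simp_all add: mat_index_simps algebra_simps del: index_mult_mat(1))
      have P: "P * I = I * P" unfolding P_def
        by (simp add: mat_ring_simps I(2) IIX) (rule mat_lin_eqI; simp add: mat_index_simps algebra_simps del: index_mult_mat(1))
      have Q: "Q * I = (-1) \<cdot>\<^sub>m (I * Q)" unfolding Q_def
        by (simp add: mat_ring_simps I(2) IIX) (rule mat_lin_eqI; simp add: mat_index_simps algebra_simps del: index_mult_mat(1))
      have "Q * J * I = I * (Q * J)"
      proof -
        have "Q * J * I = (-1) \<cdot>\<^sub>m ((Q * I) * J)" by (simp add: mat_ring_simps JI)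
        also have "\<dots> = I * (Q * J)" unfolding Q by (simp add: mat_ring_simps)
        finally show ?thesis .
      qed
      then obtain c d where cd: "Q * J = sc c + d \<cdot>\<^sub>m I"
        using complex_unit_centralizer[OF I End_mult[OF PQ(2) J]] by blast
      obtain a b where ab: "P = sc a + b \<cdot>\<^sub>m I"
        using complex_unit_centralizer[OF I PQ(1) P] by blast
      have "Q = (-1) \<cdot>\<^sub>m ((Q * J) * J)" by (simp add: mat_ring_simps JJ)
      then have "Q = (-1) \<cdot>\<^sub>m (c \<cdot>\<^sub>m J + d \<cdot>\<^sub>m (I * J))" unfolding cd by (simp add: mat_ring_simps)
      then have "B = sc a + b \<cdot>\<^sub>m I + (-c) \<cdot>\<^sub>m J + (-d) \<cdot>\<^sub>m (I * J)"
        unfolding B_PQ ab by simp (rule mat_lin_eqI; simp add: mat_index_simps algebra_simps del: index_mult_mat(1))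
      then show ?thesis by blast
    qed
    moreover have "sc a + b \<cdot>\<^sub>m I + c \<cdot>\<^sub>m J + d \<cdot>\<^sub>m (I * J) \<in> E" for a b c d
      by (intro End_add End_smult End_one End_mult I J)
    ultimately have "E = {sc a + b \<cdot>\<^sub>m I + c \<cdot>\<^sub>m J + d \<cdot>\<^sub>m (I * J) | a b c d. True}"
      by blast
    then show ?thesis using quaternion I J JJ JI by blast
  qed
qed
end

section \<open>Invariant forms\<close>

lemma invertible_if_kernel_trivial:
  assumes A: "(A :: real mat) \<in> carrier_mat n n" and "\<And>v. v \<in> carrier_vec n \<Longrightarrow> A *\<^sub>v v = 0\<^sub>v n \<Longrightarrow> v = 0\<^sub>v n"
  obtains B where "B \<in> carrier_mat n n" "A * B = 1\<^sub>m n" "B * A = 1\<^sub>m n"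
proof -
  have "det A \<noteq> 0" using det_0_iff_vec_prod_zero[OF A] assms(2) by auto
  from det_non_zero_imp_unit[OF A this, of "()"] show ?thesis
    using that by (auto simp: Units_def ring_mat_def)
qed

context irreducible_group begin

abbreviation "Inv \<equiv> {B \<in> carrier_mat n n. invariant_form n H B}"

lemma Inv_carrier: "B \<in> Inv \<Longrightarrow> B \<in> carrier_mat n n" by simp

lemma H_subset: "H \<subseteq> carrier_mat n n"
  by (rule subsetI) (rule H_carrier)

lemma InvI:
  assumes "B \<in> carrier_mat n n" "\<And>h. h \<in> H \<Longrightarrow> transpose_mat h * B * h = B"
  shows "B \<in> Inv"
proof (rule CollectI, rule conjI)
  show "invariant_form n H B"
    by (rule invariant_form_iff[OF assms(1) H_subset, THEN iffD2]) (rule ballI, rule assms(2))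
qed (rule assms(1))

lemma InvD:
  assumes "B \<in> Inv" "h \<in> H"
  shows "transpose_mat h * B * h = B"
proof -
  have B: "B \<in> carrier_mat n n" "invariant_form n H B" using assms(1) by simp_all
  show ?thesis
    by (rule invariant_form_iff[OF B(1) H_subset, THEN iffD1, rule_format]) (rule B(2), rule assms(2))
qed

lemma Inv_add: assumes "A \<in> Inv" "B \<in> Inv" shows "A + B \<in> Inv"
proof (rule InvI)
  fix h assume h: "h \<in> H"
  note [simp] = assms[THEN Inv_carrier] H_carrier[OF h]
  show "transpose_mat h * (A + B) * h = A + B"
    using InvD[OF assms(1) h] InvD[OF assms(2) h] by (simp add: mat_ring_simps)
qed (use assms in simp)

lemma Inv_smult: assumes "A \<in> Inv" shows "c \<cdot>\<^sub>m A \<in> Inv"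
proof (rule InvI)
  fix h assume h: "h \<in> H"
  note [simp] = assms[THEN Inv_carrier] H_carrier[OF h]
  show "transpose_mat h * (c \<cdot>\<^sub>m A) * h = c \<cdot>\<^sub>m A"
    using InvD[OF assms(1) h] by (simp add: mat_ring_simps)
qed (use assms in simp)

lemmas mat_transpose_simps = transpose_mult[of _ n n _ n] transpose_add[of _ n n]

lemma transpose_smult [simp]: "transpose_mat (c \<cdot>\<^sub>m A) = c \<cdot>\<^sub>m transpose_mat A"
  by (intro eq_matI) auto

lemma Inv_transpose: assumes "A \<in> Inv" shows "transpose_mat A \<in> Inv"
proof (rule InvI)
  fix h assume h: "h \<in> H"
  note [simp] = assms[THEN Inv_carrier] H_carrier[OF h]
  have "transpose_mat A = transpose_mat (transpose_mat h * A * h)" unfolding InvD[OF assms h] ..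
  also have "\<dots> = transpose_mat h * transpose_mat A * h" by (simp add: mat_transpose_simps mat_ring_simps)
  finally show "transpose_mat h * transpose_mat A * h = transpose_mat A" ..
qed (use assms in simp)

lemma Inv_mult_End: assumes "B \<in> Inv" "A \<in> E" shows "B * A \<in> Inv"
proof (rule InvI)
  fix h assume h: "h \<in> H"
  note [simp] = assms(1)[THEN Inv_carrier] H_carrier[OF h] assms(2)[THEN End_carrier]
  have "transpose_mat h * (B * A) * h = transpose_mat h * B * (A * h)" by (simp add: mat_ring_simps)
  also have "\<dots> = transpose_mat h * B * h * A" unfolding End_commute[OF assms(2) h] by (simp add: mat_ring_simps)
  finally show "transpose_mat h * (B * A) * h = B * A" unfolding InvD[OF assms(1) h] .
qed (use assms(1)[THEN Inv_carrier] assms(2)[THEN End_carrier] in simp)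

lemma Inv_End_mult: assumes "B \<in> Inv" "A \<in> E" shows "transpose_mat A * B \<in> Inv"
  using Inv_transpose[OF Inv_mult_End[OF Inv_transpose[OF assms(1)] assms(2)]]
    assms(1)[THEN Inv_carrier] assms(2)[THEN End_carrier] by (simp add: mat_transpose_simps)

lemma Inv_invertible:
  assumes "B \<in> Inv" "B \<noteq> 0\<^sub>m n n"
  obtains C where "C \<in> carrier_mat n n" "B * C = 1\<^sub>m n" "C * B = 1\<^sub>m n"
  by (rule invertible_if_kernel_trivial[of B n]) (use assms invariant_form_kernel in auto)

lemma Inv_cancel:
  assumes "B \<in> Inv" "B \<noteq> 0\<^sub>m n n" "X \<in> carrier_mat n n" "Y \<in> carrier_mat n n" "B * X = B * Y"
  shows "X = Y"
proof -
  obtain C where C: "C \<in> carrier_mat n n" "B * C = 1\<^sub>m n" "C * B = 1\<^sub>m n"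
    using Inv_invertible[OF assms(1,2)] .
  have "C * B * X = C * (B * X)" "C * B * Y = C * (B * Y)" using C(1) assms(1,3,4) by (simp_all add: mat_ring_simps)
  then show ?thesis unfolding C(3) assms(5) using assms(3,4) by simp
qed

text \<open>For invariant \<open>F\<close> and invertible invariant \<open>B\<close>, with \<open>C\<close> inverse to \<open>B\<close>, the quotient \<open>C F\<close> commutes with \<open>H\<close>. So the
  choice of one form identifies the space of invariant forms with \<open>E\<close>.\<close>

lemma Inv_as_mult:
  assumes B: "B \<in> Inv" "B \<noteq> 0\<^sub>m n n"
  shows "Inv = {B * A | A. A \<in> E}"
proof (intro equalityI subsetI)
  fix F assume F: "F \<in> Inv"
  obtain C where C: "C \<in> carrier_mat n n" "B * C = 1\<^sub>m n" "C * B = 1\<^sub>m n"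
    using Inv_invertible[OF B] .
  note [simp] = B(1)[THEN Inv_carrier] F[THEN Inv_carrier] C(1)
  have BC: "B * (C * X) = X" "C * (B * X) = X" if "X \<in> carrier_mat n n" for X
    using that C by (simp_all add: mat_ring_simps(1)[symmetric] del: assoc_mult_mat)
  have "C * F \<in> E"
  proof (rule EndI)
    fix h assume h: "h \<in> H"
    note [simp] = H_carrier[OF h]
    have "h \<in> carrier (GL TYPE(real) n)" using h H_GL by blast
    then obtain g where g: "g \<in> carrier_mat n n" "h * g = 1\<^sub>m n" unfolding GL_iff by blast
    have tg: "transpose_mat g * transpose_mat h = 1\<^sub>m n"
      using g by (simp flip: transpose_mult[of _ n n])
    have "transpose_mat h * (B * (h * (C * F))) = (transpose_mat h * B * h) * (C * F)" by (simp add: mat_ring_simps)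
    also have "\<dots> = F" unfolding InvD[OF B(1) h] by (simp add: BC mat_ring_simps)
    also have "\<dots> = transpose_mat h * (F * h)" using InvD[OF F h] by (simp add: mat_ring_simps)
    also have "\<dots> = transpose_mat h * (B * (C * F * h))" by (simp add: BC mat_ring_simps)
    finally have "transpose_mat g * (transpose_mat h * (B * (h * (C * F)))) = transpose_mat g * (transpose_mat h * (B * (C * F * h)))"
      by simp
    moreover have "transpose_mat g * (transpose_mat h * X) = X" if "X \<in> carrier_mat n n" for X
      using g(1) that by (simp add: mat_ring_simps(1)[symmetric] tg del: assoc_mult_mat)
    ultimately have "B * (h * (C * F)) = B * (C * F * h)" by simp
    from Inv_cancel[OF B _ _ this] show "C * F * h = h * (C * F)" by simp
  qed simp
  moreover have "F = B * (C * F)" by (simp add: BC)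
  ultimately show "F \<in> {B * A | A. A \<in> E}" by blast
qed (use Inv_mult_End[OF B(1)] in blast)

text \<open>The symmetric and the skew part of a non-zero form cannot both vanish.\<close>

lemma symmetrize:
  assumes F: "F \<in> carrier_mat n n" "F \<noteq> 0\<^sub>m n n"
  obtains \<epsilon> where "\<epsilon> = 1 \<or> \<epsilon> = (-1::real)" "F + \<epsilon> \<cdot>\<^sub>m transpose_mat F \<noteq> 0\<^sub>m n n"
    "transpose_mat (F + \<epsilon> \<cdot>\<^sub>m transpose_mat F) = \<epsilon> \<cdot>\<^sub>m (F + \<epsilon> \<cdot>\<^sub>m transpose_mat F)"
proof -
  have *: "transpose_mat (F + \<epsilon> \<cdot>\<^sub>m transpose_mat F) = \<epsilon> \<cdot>\<^sub>m (F + \<epsilon> \<cdot>\<^sub>m transpose_mat F)" if "\<epsilon> = 1 \<or> \<epsilon> = -1" for \<epsilon>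
    using that F by (intro mat_lin_eqI) (auto simp: algebra_simps)
  show ?thesis
  proof (cases "F + 1 \<cdot>\<^sub>m transpose_mat F = 0\<^sub>m n n")
    case True
    have "F + (-1) \<cdot>\<^sub>m transpose_mat F \<noteq> 0\<^sub>m n n"
    proof
      assume "F + (-1) \<cdot>\<^sub>m transpose_mat F = 0\<^sub>m n n"
      then have "(1/2) \<cdot>\<^sub>m ((F + 1 \<cdot>\<^sub>m transpose_mat F) + (F + (-1) \<cdot>\<^sub>m transpose_mat F)) = 0\<^sub>m n n" using True by simp
      moreover have "(1/2) \<cdot>\<^sub>m ((F + 1 \<cdot>\<^sub>m transpose_mat F) + (F + (-1) \<cdot>\<^sub>m transpose_mat F)) = F"
        using F by (intro mat_lin_eqI) auto
      ultimately show False using F by simp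
    qed
    then show ?thesis using that[of "-1"] *[of "-1"] by blast
  next
    case False
    then show ?thesis using that[of 1] *[of 1] by blast
  qed
qed

end

section \<open>Dimensions and isomorphism type of the invariants\<close>

lemma real_algebra_isoI:
  fixes \<psi> :: "'b::real_algebra_1 \<Rightarrow> real mat"
  assumes "inj \<psi>" "range \<psi> = E" "\<psi> 1 = 1\<^sub>m n" "\<And>x y. \<psi> (x + y) = \<psi> x + \<psi> y"
    "\<And>x y. \<psi> (x * y) = \<psi> x * \<psi> y" "\<And>c x. \<psi> (c *\<^sub>R x) = c \<cdot>\<^sub>m \<psi> x"
  shows "real_algebra_iso n E TYPE('b)"
proof -
  let ?\<phi> = "inv_into UNIV \<psi>"
  have 1: "?\<phi> (\<psi> x) = x" for x using assms(1) by simp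
  show ?thesis unfolding real_algebra_iso_def
  proof (intro exI[of _ ?\<phi>] conjI ballI allI)
    show "bij_betw ?\<phi> E UNIV"
      using bij_betw_inv_into[of \<psi> UNIV E] assms(1,2) by (simp add: bij_betw_def)
    show "?\<phi> (1\<^sub>m n) = 1" by (metis 1 assms(3))
    fix A B c assume "A \<in> E" "B \<in> E"
    then obtain x y where "A = \<psi> x" "B = \<psi> y" using assms(2) by blast
    then show "?\<phi> (A + B) = ?\<phi> A + ?\<phi> B" "?\<phi> (A * B) = ?\<phi> A * ?\<phi> B"
      by (simp_all add: 1 flip: assms(4,5))
  next
    fix A c assume "A \<in> E"
    then obtain x where "A = \<psi> x" using assms(2) by blast
    then show "?\<phi> (c \<cdot>\<^sub>m A) = c *\<^sub>R ?\<phi> A" by (simp add: 1 flip: assms(6))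
  qed
qed

lemma uminus_mat_smult: "- A = (-1 :: real) \<cdot>\<^sub>m A"
  by (intro eq_matI) auto

context irreducible_group begin

text \<open>Multiplication by \<open>B\<close> carries a basis of \<open>E\<close> to a basis of the invariant forms; when every basis form is
  symmetric or skew, the dimensions are read off from the signs.\<close>

lemma dim_forms:
  fixes U :: "nat \<Rightarrow> real mat" and \<tau> :: "nat \<Rightarrow> real"
  assumes E: "E = {mat_comb n d U c | c. True}" and U: "\<And>k. k < d \<Longrightarrow> U k \<in> carrier_mat n n"
    and ind: "\<And>c. mat_comb n d U c = 0\<^sub>m n n \<Longrightarrow> \<forall>k<d. c k = 0"
    and B: "B \<in> Inv" "B \<noteq> 0\<^sub>m n n"
    and \<tau>: "\<And>k. k < d \<Longrightarrow> transpose_mat (B * U k) = \<tau> k \<cdot>\<^sub>m (B * U k)"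
  shows "dim_mats n (sym_forms n H) = card {k. k < d \<and> \<tau> k = 1}"
    and "dim_mats n (skew_forms n H) = card {k. k < d \<and> \<tau> k = -1}"
proof -
  have Bc: "B \<in> carrier_mat n n" using B(1) by (rule Inv_carrier)
  have Bcomb: "B * mat_comb n d U c = mat_comb n d (\<lambda>k. B * U k) c" for c
    by (rule mat_comb_mult_left[OF Bc U])
  have Inv: "Inv = {mat_comb n d (\<lambda>k. B * U k) c | c. True}"
    unfolding Inv_as_mult[OF B] E Bcomb[symmetric] by blast
  have F: "B * U k \<in> carrier_mat n n" if "k < d" for k using Bc U[OF that] by simp
  have ind': "\<forall>k<d. c k = 0" if "mat_comb n d (\<lambda>k. B * U k) c = 0\<^sub>m n n" for c
  proof (rule ind, rule Inv_cancel[OF B])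
    show "B * mat_comb n d U c = B * 0\<^sub>m n n" unfolding Bcomb that using Bc by simp
  qed simp_all
  have mem: "B' \<in> carrier_mat n n \<and> invariant_form n H B' \<longleftrightarrow> (\<exists>c. B' = mat_comb n d (\<lambda>k. B * U k) c)" for B'
    using Inv by blast
  have "sym_forms n H = {B'. (\<exists>c. B' = mat_comb n d (\<lambda>k. B * U k) c) \<and> transpose_mat B' = 1 \<cdot>\<^sub>m B'}"
    unfolding sym_forms_def mem[symmetric] using sym_form_iff by auto
  then show "dim_mats n (sym_forms n H) = card {k. k < d \<and> \<tau> k = 1}"
    
    using dim_mats_eigenforms[where F = "\<lambda>k. B * U k" and \<tau> = \<tau>, OF F \<tau> ind', of 1] by simp
  have "skew_forms n H = {B'. (\<exists>c. B' = mat_comb n d (\<lambda>k. B * U k) c) \<and> transpose_mat B' = (-1) \<cdot>\<^sub>m B'}"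
    unfolding skew_forms_def mem[symmetric] using skew_form_iff unfolding uminus_mat_smult by auto
  then show "dim_mats n (skew_forms n H) = card {k. k < d \<and> \<tau> k = -1}"
    
    using dim_mats_eigenforms[where F = "\<lambda>k. B * U k" and \<tau> = \<tau>, OF F \<tau> ind', of "-1"] by simp
qed

lemma sc_inj: "sc a = 0\<^sub>m n n \<Longrightarrow> a = 0"
proof -
  assume "sc a = 0\<^sub>m n n"
  then have "sc a $$ (0, 0) = 0\<^sub>m n n $$ (0, 0)" by simp
  then show "a = 0" using n by simp
qed

text \<open>The product with the conjugate element is the scalar \<open>a\<^sup>2 + b\<^sup>2\<close>.\<close>

lemma complex_indep:
  assumes I: "I \<in> E" "I * I = sc (-1)" and z: "sc a + b \<cdot>\<^sub>m I = 0\<^sub>m n n"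
  shows "a = 0 \<and> b = 0"
proof -
  note [simp] = End_carrier[OF I(1)]
  have "sc (a^2 + b^2) = (sc a + (-b) \<cdot>\<^sub>m I) * (sc a + b \<cdot>\<^sub>m I)"
    by (simp add: mat_ring_simps I(2)) (rule mat_lin_eqI; simp add: mat_index_simps algebra_simps power2_eq_square del: index_mult_mat(1))
  also have "\<dots> = 0\<^sub>m n n" unfolding z by (rule right_mult_zero_mat[of _ n n]) simp
  finally have "a^2 + b^2 = 0" by (rule sc_inj)
  then show ?thesis by (simp add: sum_power2_eq_zero_iff)
qed

lemma quaternion_products:
  assumes IJ: "I \<in> E" "J \<in> E" "I * I = sc (-1)" "J * J = sc (-1)" "J * I = (-1) \<cdot>\<^sub>m (I * J)"
    and X: "X \<in> carrier_mat n n"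
  shows "I * (I * X) = (-1) \<cdot>\<^sub>m X" "J * (J * X) = (-1) \<cdot>\<^sub>m X" "J * (I * X) = (-1) \<cdot>\<^sub>m (I * (J * X))"
proof -
  note [simp] = IJ(1,2)[THEN End_carrier] X
  have "I * (I * X) = (I * I) * X" "J * (J * X) = (J * J) * X" "J * (I * X) = (J * I) * X" by (simp_all add: mat_ring_simps)
  then show "I * (I * X) = (-1) \<cdot>\<^sub>m X" "J * (J * X) = (-1) \<cdot>\<^sub>m X" "J * (I * X) = (-1) \<cdot>\<^sub>m (I * (J * X))"
    unfolding IJ(3-5) by (simp_all add: mat_ring_simps)
qed

text \<open>As for complex numbers, multiply by the conjugate quaternion.\<close>

lemma quaternion_indep:
  assumes IJ: "I \<in> E" "J \<in> E" "I * I = sc (-1)" "J * J = sc (-1)" "J * I = (-1) \<cdot>\<^sub>m (I * J)"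
    and z: "sc a + b \<cdot>\<^sub>m I + c \<cdot>\<^sub>m J + d \<cdot>\<^sub>m (I * J) = 0\<^sub>m n n"
  shows "a = 0 \<and> b = 0 \<and> c = 0 \<and> d = 0"
proof -
  note [simp] = IJ(1,2)[THEN End_carrier]
  have "sc (a^2 + b^2 + (c^2 + d^2)) = (sc a + (-b) \<cdot>\<^sub>m I + (-c) \<cdot>\<^sub>m J + (-d) \<cdot>\<^sub>m (I * J)) * (sc a + b \<cdot>\<^sub>m I + c \<cdot>\<^sub>m J + d \<cdot>\<^sub>m (I * J))"
    by (simp add: mat_ring_simps IJ quaternion_products[OF IJ]) (rule mat_lin_eqI; simp add: mat_index_simps algebra_simps power2_eq_square del: index_mult_mat(1))
  also have "\<dots> = 0\<^sub>m n n" unfolding z by (rule right_mult_zero_mat[of _ n n]) simp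
  finally have "a^2 + b^2 + (c^2 + d^2) = 0" by (rule sc_inj)
  then show ?thesis by (metis add_nonneg_eq_0_iff sum_power2_eq_zero_iff sum_power2_ge_zero)
qed

lemma invariants_real:
  assumes E: "E = range sc" and B: "B \<in> Inv" "B \<noteq> 0\<^sub>m n n" and \<epsilon>: "transpose_mat B = \<epsilon> \<cdot>\<^sub>m B"
  shows "\<epsilon> = 1 \<Longrightarrow> has_invariants n H TYPE(real) 1 0" "\<epsilon> = -1 \<Longrightarrow> has_invariants n H TYPE(real) 0 1"
proof -
  have comb: "mat_comb n 1 (\<lambda>_. 1\<^sub>m n) c = sc (c 0)" for c
    by (simp add: mat_comb_Suc mat_comb_0)
  have iso: "real_algebra_iso n E TYPE(real)"
  proof (rule real_algebra_isoI[of sc])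
    show "inj sc"
    proof (rule injI)
      fix a b assume "sc a = sc b"
      then have "sc a $$ (0, 0) = sc b $$ (0, 0)" by simp
      then show "a = b" using n by simp
    qed
    show "sc (a * b) = sc a * sc b" for a b by (simp add: mat_ring_simps ac_simps)
    show "sc (a + b) = sc a + sc b" for a b by (rule mat_lin_eqI) (simp_all add: mat_index_simps algebra_simps)
  qed (use E in simp_all)
  have E': "E = {mat_comb n 1 (\<lambda>_. 1\<^sub>m n) c | c. True}" unfolding E comb 
    by (auto intro!: exI[of _ "\<lambda>_. _"])
  have \<tau>: "transpose_mat (B * 1\<^sub>m n) = \<epsilon> \<cdot>\<^sub>m (B * 1\<^sub>m n)" using Inv_carrier[OF B(1)] \<epsilon> by (simp add: mat_ring_simps)
  have ind: "\<forall>k<1. c k = 0" if "mat_comb n 1 (\<lambda>_. 1\<^sub>m n) c = 0\<^sub>m n n" for c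
    using that unfolding comb using sc_inj by simp
  note d = dim_forms[OF E' _ ind B \<tau>]
  show "\<epsilon> = 1 \<Longrightarrow> has_invariants n H TYPE(real) 1 0" "\<epsilon> = -1 \<Longrightarrow> has_invariants n H TYPE(real) 0 1"
    unfolding has_invariants_def using iso d by auto
qed

lemma card_filter_lessThan: "card {k :: nat. k < d \<and> P k} = (\<Sum>k<d. if P k then 1 else 0 :: nat)"
proof -
  have "{k :: nat. k < d \<and> P k} = {..<d} \<inter> {k. P k}" by auto
  then show ?thesis by (subst sum.If_cases) simp_all
qed

lemma invariants_complex:
  assumes I: "I \<in> E" "I * I = sc (-1)" and E: "E = {sc a + b \<cdot>\<^sub>m I | a b. True}"
    and B: "B \<in> Inv" "B \<noteq> 0\<^sub>m n n"
    and \<epsilon>: "transpose_mat B = \<epsilon> \<cdot>\<^sub>m B" "transpose_mat (B * I) = \<epsilon>' \<cdot>\<^sub>m (B * I)"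
  shows "has_invariants n H TYPE(complex)
     ((if \<epsilon> = 1 then 1 else 0) + (if \<epsilon>' = 1 then 1 else 0))
     ((if \<epsilon> = -1 then 1 else 0) + (if \<epsilon>' = -1 then 1 else 0))"
proof -
  note [simp] = End_carrier[OF I(1)] Inv_carrier[OF B(1)]
  let ?U = "\<lambda>k. if k = 0 then 1\<^sub>m n else I" and ?\<tau> = "\<lambda>k. if k = 0 then \<epsilon> else \<epsilon>'"
  have comb: "mat_comb n 2 ?U c = sc (c 0) + c 1 \<cdot>\<^sub>m I" for c
    unfolding numeral_2_eq_2 by (simp add: mat_comb_Suc mat_comb_0)
  have iso: "real_algebra_iso n E TYPE(complex)"
  proof (rule real_algebra_isoI[of "\<lambda>z. sc (Re z) + Im z \<cdot>\<^sub>m I"])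
    show "inj (\<lambda>z. sc (Re z) + Im z \<cdot>\<^sub>m I)"
    proof (rule injI)
      fix z w assume *: "sc (Re z) + Im z \<cdot>\<^sub>m I = sc (Re w) + Im w \<cdot>\<^sub>m I"
      have "sc (Re z - Re w) + (Im z - Im w) \<cdot>\<^sub>m I = (sc (Re z) + Im z \<cdot>\<^sub>m I) + (-1) \<cdot>\<^sub>m (sc (Re w) + Im w \<cdot>\<^sub>m I)"
        by (rule mat_lin_eqI) (simp_all add: mat_index_simps algebra_simps)
      also have "\<dots> = 0\<^sub>m n n" unfolding * by (rule mat_lin_eqI) (simp_all add: mat_index_simps algebra_simps)
      finally have "sc (Re z - Re w) + (Im z - Im w) \<cdot>\<^sub>m I = 0\<^sub>m n n" .
      from complex_indep[OF I this] show "z = w" by (simp add: complex_eq_iff)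
    qed
    show "range (\<lambda>z. sc (Re z) + Im z \<cdot>\<^sub>m I) = E"
    proof -
      have "sc a + b \<cdot>\<^sub>m I \<in> range (\<lambda>z. sc (Re z) + Im z \<cdot>\<^sub>m I)" for a b
        by (rule image_eqI[of _ _ "Complex a b"]) simp_all
      then show ?thesis unfolding E by blast
    qed
    show "sc (Re (z * w)) + Im (z * w) \<cdot>\<^sub>m I = (sc (Re z) + Im z \<cdot>\<^sub>m I) * (sc (Re w) + Im w \<cdot>\<^sub>m I)" for z w
      by (simp add: mat_ring_simps I(2)) (rule mat_lin_eqI; simp add: mat_index_simps algebra_simps del: index_mult_mat(1))
  qed (rule mat_lin_eqI; simp add: mat_index_simps algebra_simps)+
  have E': "E = {mat_comb n 2 ?U c | c. True}"
  proof -
    have "\<exists>c. sc a + b \<cdot>\<^sub>m I = mat_comb n 2 ?U c" for a b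
      unfolding comb by (rule exI[of _ "\<lambda>k. if k = 0 then a else b"]) simp
    then show ?thesis unfolding E using comb by blast
  qed
  have \<tau>: "transpose_mat (B * ?U k) = ?\<tau> k \<cdot>\<^sub>m (B * ?U k)" for k using \<epsilon> by (simp add: mat_ring_simps)
  have ind: "\<forall>k<2. c k = 0" if "mat_comb n 2 ?U c = 0\<^sub>m n n" for c
    using complex_indep[OF I that[unfolded comb]] by (simp add: less_2_cases_iff)
  note d = dim_forms[OF E' _ ind B \<tau>]
  show ?thesis unfolding has_invariants_def using iso d by (simp add: card_filter_lessThan numeral_2_eq_2)
qed

text \<open>Since \<open>I\<close> and \<open>J\<close> are skew-adjoint and anticommute, so is \<open>I J\<close>, and the three forms \<open>B I\<close>, \<open>B J\<close>, \<open>B I J\<close>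
  have the symmetry opposite to that of \<open>B\<close>.\<close>

lemma invariants_quaternion:
  assumes IJ: "I \<in> E" "J \<in> E" "I * I = sc (-1)" "J * J = sc (-1)" "J * I = (-1) \<cdot>\<^sub>m (I * J)"
    and E: "E = {sc a + b \<cdot>\<^sub>m I + c \<cdot>\<^sub>m J + d \<cdot>\<^sub>m (I * J) | a b c d. True}"
    and B: "B \<in> Inv" "B \<noteq> 0\<^sub>m n n" and \<epsilon>: "transpose_mat B = \<epsilon> \<cdot>\<^sub>m B"
    and BI: "transpose_mat I * B = (-1) \<cdot>\<^sub>m (B * I)" and BJ: "transpose_mat J * B = (-1) \<cdot>\<^sub>m (B * J)"
  shows "\<epsilon> = 1 \<Longrightarrow> has_invariants n H TYPE(quat) 1 3" "\<epsilon> = -1 \<Longrightarrow> has_invariants n H TYPE(quat) 3 1"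
proof -
  note [simp] = IJ(1,2)[THEN End_carrier] Inv_carrier[OF B(1)]
  let ?U = "\<lambda>k::nat. if k = 0 then 1\<^sub>m n else if k = 1 then I else if k = 2 then J else I * J"
  let ?\<tau> = "\<lambda>k::nat. if k = 0 then \<epsilon> else - \<epsilon>"
  let ?\<psi> = "\<lambda>x. sc (qRe x) + qI x \<cdot>\<^sub>m I + qJ x \<cdot>\<^sub>m J + qK x \<cdot>\<^sub>m (I * J)"
  have comb: "mat_comb n 4 ?U c = sc (c 0) + c 1 \<cdot>\<^sub>m I + c 2 \<cdot>\<^sub>m J + c 3 \<cdot>\<^sub>m (I * J)" for c
    by (simp add: mat_comb_Suc mat_comb_0 eval_nat_numeral)
  have iso: "real_algebra_iso n E TYPE(quat)"
  proof (rule real_algebra_isoI[of ?\<psi>])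
    show "inj ?\<psi>"
    proof (rule injI)
      fix z w assume *: "?\<psi> z = ?\<psi> w"
      have "sc (qRe z - qRe w) + (qI z - qI w) \<cdot>\<^sub>m I + (qJ z - qJ w) \<cdot>\<^sub>m J + (qK z - qK w) \<cdot>\<^sub>m (I * J)
          = ?\<psi> z + (-1) \<cdot>\<^sub>m ?\<psi> w"
        by (rule mat_lin_eqI) (simp_all add: mat_index_simps algebra_simps del: index_mult_mat(1))
      also have "\<dots> = 0\<^sub>m n n" unfolding * by (rule mat_lin_eqI) (simp_all add: mat_index_simps algebra_simps del: index_mult_mat(1))
      finally have "sc (qRe z - qRe w) + (qI z - qI w) \<cdot>\<^sub>m I + (qJ z - qJ w) \<cdot>\<^sub>m J
        + (qK z - qK w) \<cdot>\<^sub>m (I * J) = 0\<^sub>m n n" .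
      from quaternion_indep[OF IJ this] show "z = w" by (simp add: quat.expand)
    qed
    show "range ?\<psi> = E"
    proof -
      have "sc a + b \<cdot>\<^sub>m I + c \<cdot>\<^sub>m J + d \<cdot>\<^sub>m (I * J) \<in> range ?\<psi>" for a b c d
        by (rule image_eqI[of _ _ "Quat a b c d"]) simp_all
      then show ?thesis unfolding E by blast
    qed
    show "?\<psi> (z * w) = ?\<psi> z * ?\<psi> w" for z w
      by (simp add: mat_ring_simps IJ quaternion_products[OF IJ] times_quat_def)
        (rule mat_lin_eqI; simp add: mat_index_simps algebra_simps del: index_mult_mat(1))
    show "?\<psi> (z + w) = ?\<psi> z + ?\<psi> w" for z w
      by (rule mat_lin_eqI; simp add: mat_index_simps plus_quat_def algebra_simps del: index_mult_mat(1))
    show "?\<psi> (c *\<^sub>R z) = c \<cdot>\<^sub>m ?\<psi> z" for c z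
      by (rule mat_lin_eqI; simp add: mat_index_simps scaleR_quat_def algebra_simps del: index_mult_mat(1))
    show "?\<psi> 1 = 1\<^sub>m n"
      by (rule mat_lin_eqI; simp add: mat_index_simps one_quat_def algebra_simps del: index_mult_mat(1))
  qed
  have E': "E = {mat_comb n 4 ?U c | c. True}"
  proof -
    have "\<exists>c. sc a + b \<cdot>\<^sub>m I + c' \<cdot>\<^sub>m J + d \<cdot>\<^sub>m (I * J) = mat_comb n 4 ?U c" for a b c' d
      unfolding comb by (rule exI[of _ "\<lambda>k. if k = 0 then a else if k = 1 then b else if k = 2 then c' else d"]) simp
    then show ?thesis unfolding E using comb by blast
  qed
  have tI: "transpose_mat (B * I) = (-\<epsilon>) \<cdot>\<^sub>m (B * I)" by (simp add: mat_transpose_simps \<epsilon> mat_ring_simps BI)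
  have tJ: "transpose_mat (B * J) = (-\<epsilon>) \<cdot>\<^sub>m (B * J)" by (simp add: mat_transpose_simps \<epsilon> mat_ring_simps BJ)
  have "transpose_mat (B * (I * J)) = transpose_mat J * (\<epsilon> \<cdot>\<^sub>m (transpose_mat I * B))"
    by (simp add: mat_transpose_simps mat_ring_simps \<epsilon>)
  also have "\<dots> = (-\<epsilon>) \<cdot>\<^sub>m ((transpose_mat J * B) * I)" unfolding BI by (simp add: mat_ring_simps)
  also have "\<dots> = (-\<epsilon>) \<cdot>\<^sub>m (B * (I * J))" unfolding BJ by (simp add: mat_ring_simps IJ)
  finally have tIJ: "transpose_mat (B * (I * J)) = (-\<epsilon>) \<cdot>\<^sub>m (B * (I * J))" .
  have \<tau>: "transpose_mat (B * ?U k) = ?\<tau> k \<cdot>\<^sub>m (B * ?U k)" for k using \<epsilon> tI tJ tIJ by (simp add: mat_ring_simps)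
  have ind: "\<forall>k<4. c k = 0" if "mat_comb n 4 ?U c = 0\<^sub>m n n" for c
    using quaternion_indep[OF IJ that[unfolded comb]] by (auto simp: less_Suc_eq eval_nat_numeral)
  note d = dim_forms[OF E' _ ind B \<tau>]
  show "\<epsilon> = 1 \<Longrightarrow> has_invariants n H TYPE(quat) 1 3" "\<epsilon> = -1 \<Longrightarrow> has_invariants n H TYPE(quat) 3 1"
    unfolding has_invariants_def using iso d by (auto simp: card_filter_lessThan eval_nat_numeral)
qed

end

section \<open>Invariant forms adapted to the commutant\<close>

context irreducible_group begin

text \<open>Since \<open>I\<close> is the negative of its inverse, \<open>I\<close> is an isometry of \<open>G\<close> iff it is skew-adjoint, and an
  anti-isometry iff it is self-adjoint.\<close>

lemma unit_congruence:
  assumes I: "I \<in> E" "I * I = sc (-1)" and G: "G \<in> carrier_mat n n"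
  shows "transpose_mat I * G * I = G \<longleftrightarrow> transpose_mat I * G = (-1) \<cdot>\<^sub>m (G * I)"
    and "transpose_mat I * G * I = (-1) \<cdot>\<^sub>m G \<longleftrightarrow> transpose_mat I * G = G * I"
proof -
  note [simp] = End_carrier[OF I(1)] G
  have 1: "transpose_mat I * G * I * I = (-1) \<cdot>\<^sub>m (transpose_mat I * G)" by (simp add: mat_ring_simps I(2))
  have 2: "G * I * I = (-1) \<cdot>\<^sub>m G" by (simp add: mat_ring_simps I(2))
  show "transpose_mat I * G * I = G \<longleftrightarrow> transpose_mat I * G = (-1) \<cdot>\<^sub>m (G * I)"
  proof
    assume "transpose_mat I * G * I = G"
    then have "G * I = (-1) \<cdot>\<^sub>m (transpose_mat I * G)" using 1 by simp
    then show "transpose_mat I * G = (-1) \<cdot>\<^sub>m (G * I)" by simp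
  next
    assume "transpose_mat I * G = (-1) \<cdot>\<^sub>m (G * I)"
    then have "transpose_mat I * G * I = (-1) \<cdot>\<^sub>m (G * I * I)" by (simp add: mat_ring_simps del: assoc_mult_mat)
    then show "transpose_mat I * G * I = G" unfolding 2 by simp
  qed
  show "transpose_mat I * G * I = (-1) \<cdot>\<^sub>m G \<longleftrightarrow> transpose_mat I * G = G * I"
  proof
    assume "transpose_mat I * G * I = (-1) \<cdot>\<^sub>m G"
    then have "(-1) \<cdot>\<^sub>m (G * I) = (-1) \<cdot>\<^sub>m (transpose_mat I * G)" using 1 by (simp add: mat_ring_simps)
    then have "(-1) \<cdot>\<^sub>m ((-1) \<cdot>\<^sub>m (G * I)) = (-1) \<cdot>\<^sub>m ((-1) \<cdot>\<^sub>m (transpose_mat I * G))" by (simp only:)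
    then show "transpose_mat I * G = G * I" by simp
  next
    assume "transpose_mat I * G = G * I"
    then show "transpose_mat I * G * I = (-1) \<cdot>\<^sub>m G" using 2 by simp
  qed
qed

text \<open>Congruence by \<open>I\<close> has order two on forms, because \<open>I\<^sup>2 = -1\<close> acts trivially; \<open>F + I\<^sup>T F I\<close> is the sum over
  its orbit.\<close>

lemma average_form:
  assumes I: "I \<in> E" "I * I = sc (-1)" and F: "F \<in> Inv"
  shows "F + transpose_mat I * F * I \<in> Inv"
    "transpose_mat I * (F + transpose_mat I * F * I) * I = F + transpose_mat I * F * I"
proof -
  note [simp] = End_carrier[OF I(1)] Inv_carrier[OF F]
  show "F + transpose_mat I * F * I \<in> Inv"
    by (intro Inv_add F Inv_mult_End Inv_End_mult I)
  have tII: "transpose_mat I * (transpose_mat I * X) = (-1) \<cdot>\<^sub>m X" if "X \<in> carrier_mat n n" for X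
  proof -
    have "transpose_mat I * transpose_mat I = transpose_mat (I * I)" by (simp add: mat_transpose_simps)
    also have "\<dots> = sc (-1)" unfolding I(2) by simp
    finally have "(transpose_mat I * transpose_mat I) * X = (-1) \<cdot>\<^sub>m X" using that by (simp add: mat_ring_simps)
    then show ?thesis using that by (simp add: mat_ring_simps)
  qed
  show "transpose_mat I * (F + transpose_mat I * F * I) * I = F + transpose_mat I * F * I"
    by (simp add: mat_ring_simps tII I(2)) (rule mat_lin_eqI; simp add: mat_index_simps algebra_simps del: index_mult_mat(1))
qed

lemma transpose_congruence:
  fixes A G :: "real mat"
  assumes "A \<in> carrier_mat n n" "G \<in> carrier_mat n n"
  shows "transpose_mat A * transpose_mat G * A = transpose_mat (transpose_mat A * G * A)"
  using assms by (simp add: mat_transpose_simps mat_ring_simps)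

lemma congruence_symmetrize:
  fixes A G :: "real mat"
  assumes "A \<in> carrier_mat n n" "G \<in> carrier_mat n n" "transpose_mat A * G * A = c \<cdot>\<^sub>m G"
  shows "transpose_mat A * (G + \<epsilon> \<cdot>\<^sub>m transpose_mat G) * A = c \<cdot>\<^sub>m (G + \<epsilon> \<cdot>\<^sub>m transpose_mat G)"
proof -
  note [simp] = assms(1,2)
  have "transpose_mat A * (G + \<epsilon> \<cdot>\<^sub>m transpose_mat G) * A
    = transpose_mat A * G * A + \<epsilon> \<cdot>\<^sub>m (transpose_mat A * transpose_mat G * A)"
    by (simp add: mat_ring_simps)
  also have "\<dots> = c \<cdot>\<^sub>m (G + \<epsilon> \<cdot>\<^sub>m transpose_mat G)"
    unfolding transpose_congruence[OF assms(1,2)] assms(3)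
    by (simp) (rule mat_lin_eqI; simp add: mat_index_simps algebra_simps)
  finally show ?thesis .
qed

lemma Inv_symmetrize: "F \<in> Inv \<Longrightarrow> F + \<epsilon> \<cdot>\<^sub>m transpose_mat F \<in> Inv"
  by (intro Inv_add Inv_smult Inv_transpose)

lemma mat_add_eq_zero:
  assumes "A \<in> carrier_mat n n" "B \<in> carrier_mat n n" "A + B = (0\<^sub>m n n :: real mat)"
  shows "B = (-1) \<cdot>\<^sub>m A"
proof (rule mat_lin_eqI)
  fix i j assume ij: "i < n" "j < n"
  have "(A + B) $$ (i, j) = 0" using ij unfolding assms(3) by simp
  then show "B $$ (i, j) = ((-1) \<cdot>\<^sub>m A) $$ (i, j)" using ij assms(1,2) by simp
qed (use assms in simp_all)

text \<open>If some average \<open>F + I\<^sup>T F I\<close> is non-zero, so is its symmetric or its skew part, and \<open>I\<close> is skew-adjoint for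
  this part \<open>B\<close>; if \<open>B\<close> is skew, replacing \<open>B\<close> by \<open>B I\<close> makes it symmetric. If all averages vanish, \<open>I\<close> is self-adjoint
  for every invariant form.\<close>

lemma complex_unit_form:
  assumes I: "I \<in> E" "I * I = sc (-1)" and F0: "F0 \<in> Inv" "F0 \<noteq> 0\<^sub>m n n"
  obtains (hermitian) B where "B \<in> Inv" "B \<noteq> 0\<^sub>m n n" "transpose_mat B = B" "transpose_mat I * B = (-1) \<cdot>\<^sub>m (B * I)"
  | (bilinear) B \<epsilon> where "B \<in> Inv" "B \<noteq> 0\<^sub>m n n" "\<epsilon> = 1 \<or> \<epsilon> = (-1::real)" "transpose_mat B = \<epsilon> \<cdot>\<^sub>m B"
      "transpose_mat I * B = B * I"
proof (cases "\<exists>F\<in>Inv. F + transpose_mat I * F * I \<noteq> 0\<^sub>m n n")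
  case True
  then obtain F where F: "F \<in> Inv" "F + transpose_mat I * F * I \<noteq> 0\<^sub>m n n" by blast
  define G where "G = F + transpose_mat I * F * I"
  have G: "G \<in> Inv" "G \<noteq> 0\<^sub>m n n" "transpose_mat I * G * I = 1 \<cdot>\<^sub>m G"
    using average_form[OF I F(1)] F(2) by (simp_all add: G_def)
  obtain \<epsilon> where e: "\<epsilon> = 1 \<or> \<epsilon> = (-1::real)" "G + \<epsilon> \<cdot>\<^sub>m transpose_mat G \<noteq> 0\<^sub>m n n"
    "transpose_mat (G + \<epsilon> \<cdot>\<^sub>m transpose_mat G) = \<epsilon> \<cdot>\<^sub>m (G + \<epsilon> \<cdot>\<^sub>m transpose_mat G)"
    using symmetrize[OF Inv_carrier[OF G(1)] G(2)] by blast
  define B where "B = G + \<epsilon> \<cdot>\<^sub>m transpose_mat G"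
  have B: "B \<in> Inv" "B \<noteq> 0\<^sub>m n n" "transpose_mat B = \<epsilon> \<cdot>\<^sub>m B" "transpose_mat I * B * I = 1 \<cdot>\<^sub>m B"
    using Inv_symmetrize[OF G(1)] e congruence_symmetrize[OF End_carrier[OF I(1)] Inv_carrier[OF G(1)] G(3)]
    by (simp_all add: B_def)
  note [simp] = End_carrier[OF I(1)] Inv_carrier[OF B(1)]
  have BI: "transpose_mat I * B = (-1) \<cdot>\<^sub>m (B * I)"
    using unit_congruence(1)[OF I, of B] B(4) by simp
  show ?thesis
  proof (cases "\<epsilon> = 1")
    case True
    then show ?thesis using hermitian[OF B(1,2)] B(3) BI by simp
  next
    case False
    then have e1: "\<epsilon> = -1" using e by simp
    have BI1: "B * I \<in> Inv" using Inv_mult_End[OF B(1) I(1)] .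
    have "B = (-1) \<cdot>\<^sub>m (B * I * I)" by (simp add: mat_ring_simps I(2))
    then have BI0: "B * I \<noteq> 0\<^sub>m n n" using B(2) left_mult_zero_mat[of I n n] by auto
    have t: "transpose_mat (B * I) = B * I" using BI by (simp add: mat_transpose_simps mat_ring_simps B(3) e1)
    have "transpose_mat I * (B * I) = (transpose_mat I * B) * I" by (simp add: mat_ring_simps)
    also have "\<dots> = (-1) \<cdot>\<^sub>m ((B * I) * I)" unfolding BI by (simp add: mat_ring_simps)
    finally show ?thesis using hermitian[OF BI1 BI0 t] by simp
  qed
next
  case False
  have neg: "transpose_mat I * F * I = (-1) \<cdot>\<^sub>m F" if "F \<in> Inv" for F
  proof (rule mat_add_eq_zero)
    show "F + transpose_mat I * F * I = 0\<^sub>m n n" using False that by blast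
  qed (use Inv_carrier[OF that] End_carrier[OF I(1)] in simp_all)
  obtain \<epsilon> where e: "\<epsilon> = 1 \<or> \<epsilon> = (-1::real)" "F0 + \<epsilon> \<cdot>\<^sub>m transpose_mat F0 \<noteq> 0\<^sub>m n n"
    "transpose_mat (F0 + \<epsilon> \<cdot>\<^sub>m transpose_mat F0) = \<epsilon> \<cdot>\<^sub>m (F0 + \<epsilon> \<cdot>\<^sub>m transpose_mat F0)"
    using symmetrize[OF Inv_carrier[OF F0(1)] F0(2)] by blast
  have B: "F0 + \<epsilon> \<cdot>\<^sub>m transpose_mat F0 \<in> Inv" using Inv_symmetrize[OF F0(1)] .
  show ?thesis
    using bilinear[OF B e(2,1,3)] unit_congruence(2)[OF I Inv_carrier[OF B]] neg[OF B] by simp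
qed

text \<open>Averages over \<open>I\<close>, then over \<open>J\<close>, cannot all vanish. If every \<open>I\<close>-average vanished, \<open>I\<close> would be
  self-adjoint for \<open>F\<close> as well as for \<open>F J\<close>, and then commute with \<open>J\<close>. If the \<open>J\<close>-averages of an
  \<open>I\<close>-invariant \<open>G\<close> and of \<open>G I\<close> both vanished, \<open>J\<close> would commute with \<open>I\<close> for the same reason.\<close>

lemma quaternion_unit_form:
  assumes IJ: "I \<in> E" "J \<in> E" "I * I = sc (-1)" "J * J = sc (-1)" "J * I = (-1) \<cdot>\<^sub>m (I * J)"
    and F0: "F0 \<in> Inv" "F0 \<noteq> 0\<^sub>m n n"
  obtains B \<epsilon> where "B \<in> Inv" "B \<noteq> 0\<^sub>m n n" "\<epsilon> = 1 \<or> \<epsilon> = (-1::real)" "transpose_mat B = \<epsilon> \<cdot>\<^sub>m B"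
      "transpose_mat I * B = (-1) \<cdot>\<^sub>m (B * I)" "transpose_mat J * B = (-1) \<cdot>\<^sub>m (B * J)"
proof -
  note [simp] = IJ(1,2)[THEN End_carrier]
  note cI = unit_congruence[OF IJ(1,3)] and cJ = unit_congruence[OF IJ(2,4)]
  have ncomm: "J * I \<noteq> I * J"
  proof
    assume "J * I = I * J"
    then have e: "I * J = (-1) \<cdot>\<^sub>m (I * J)" using IJ(5) by simp
    have "sc 0 + 0 \<cdot>\<^sub>m I + 0 \<cdot>\<^sub>m J + 2 \<cdot>\<^sub>m (I * J) = I * J + (-1) \<cdot>\<^sub>m ((-1) \<cdot>\<^sub>m (I * J))"
      by (rule mat_lin_eqI) (simp_all add: mat_index_simps algebra_simps del: index_mult_mat(1))
    also have "\<dots> = I * J + (-1) \<cdot>\<^sub>m (I * J)" unfolding e[symmetric] ..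
    also have "\<dots> = 0\<^sub>m n n" by (rule mat_lin_eqI) (simp_all add: mat_index_simps algebra_simps del: index_mult_mat(1))
    finally show False using quaternion_indep[OF IJ, of 0 0 0 2] by simp
  qed
  have "\<exists>F\<in>Inv. F + transpose_mat I * F * I \<noteq> 0\<^sub>m n n"
  proof (rule ccontr)
    assume "\<not> ?thesis"
    then have 0: "F + transpose_mat I * F * I = 0\<^sub>m n n" if "F \<in> Inv" for F using that by blast
    have "transpose_mat I * F * I = (-1) \<cdot>\<^sub>m F" if "F \<in> Inv" for F
      using mat_add_eq_zero[OF Inv_carrier[OF that] _ 0[OF that]] Inv_carrier[OF that] by simp
    then have comm: "transpose_mat I * F = F * I" if "F \<in> Inv" for F
      using cI(2)[OF Inv_carrier[OF that]] that by blast
    note [simp] = Inv_carrier[OF F0(1)]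
    have "F0 * (J * I) = transpose_mat I * (F0 * J)" using comm[OF Inv_mult_End[OF F0(1) IJ(2)]] by (simp add: mat_ring_simps)
    also have "\<dots> = (transpose_mat I * F0) * J" by (simp add: mat_ring_simps)
    also have "\<dots> = F0 * (I * J)" unfolding comm[OF F0(1)] by (simp add: mat_ring_simps)
    finally have "F0 * (J * I) = F0 * (I * J)" .
    from Inv_cancel[OF F0 _ _ this] have "J * I = I * J" by simp
    then show False using ncomm by blast
  qed
  then obtain F where F: "F \<in> Inv" "F + transpose_mat I * F * I \<noteq> 0\<^sub>m n n" by blast
  define G where "G = F + transpose_mat I * F * I"
  have G: "G \<in> Inv" "G \<noteq> 0\<^sub>m n n" "transpose_mat I * G * I = G"
    using average_form[OF IJ(1,3) F(1)] F(2) by (simp_all add: G_def)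
  note [simp] = Inv_carrier[OF G(1)]
  have GI: "transpose_mat I * G = (-1) \<cdot>\<^sub>m (G * I)" using cI(1) G(3) by simp
  have GI1: "G * I \<in> Inv" using Inv_mult_End[OF G(1) IJ(1)] .
  have GI2: "transpose_mat I * (G * I) * I = G * I"
  proof -
    have "transpose_mat I * (G * I) * I = (transpose_mat I * G * I) * I" by (simp add: mat_ring_simps)
    then show ?thesis unfolding G(3) .
  qed
  have "\<exists>F\<in>{G, G * I}. F + transpose_mat J * F * J \<noteq> 0\<^sub>m n n"
  proof (rule ccontr)
    assume "\<not> ?thesis"
    then have 0: "G + transpose_mat J * G * J = 0\<^sub>m n n" "G * I + transpose_mat J * (G * I) * J = 0\<^sub>m n n" by auto
    have "transpose_mat J * G * J = (-1) \<cdot>\<^sub>m G" "transpose_mat J * (G * I) * J = (-1) \<cdot>\<^sub>m (G * I)"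
      using mat_add_eq_zero[OF _ _ 0(1)] mat_add_eq_zero[OF _ _ 0(2)] by simp_all
    then have 1: "transpose_mat J * G = G * J" "transpose_mat J * (G * I) = G * I * J"
      using cJ(2)[of G] cJ(2)[of "G * I"] by simp_all
    have "G * (J * I) = transpose_mat J * G * I" unfolding 1(1) by (simp add: mat_ring_simps)
    also have "\<dots> = G * (I * J)" using 1(2) by (simp add: mat_ring_simps)
    finally have "G * (J * I) = G * (I * J)" .
    from Inv_cancel[OF G(1,2) _ _ this] have "J * I = I * J" by simp
    then show False using ncomm by blast
  qed
  then consider "G + transpose_mat J * G * J \<noteq> 0\<^sub>m n n" | "G * I + transpose_mat J * (G * I) * J \<noteq> 0\<^sub>m n n"
    by blast
  then obtain F' where F': "F' \<in> Inv" "transpose_mat I * F' * I = F'" "F' + transpose_mat J * F' * J \<noteq> 0\<^sub>m n n"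
  proof cases
    case 1
    show ?thesis by (rule that[OF G(1,3) 1])
  next
    case 2
    show ?thesis by (rule that[OF GI1 GI2 2])
  qed
  define K where "K = F' + transpose_mat J * F' * J"
  have K: "K \<in> Inv" "K \<noteq> 0\<^sub>m n n" "transpose_mat J * K * J = 1 \<cdot>\<^sub>m K"
    using average_form[OF IJ(2,4) F'(1)] F'(3) by (simp_all add: K_def)
  note [simp] = Inv_carrier[OF K(1)] Inv_carrier[OF F'(1)]
  have tJI: "transpose_mat I * (transpose_mat J * X) = (-1) \<cdot>\<^sub>m (transpose_mat J * (transpose_mat I * X))"
    if "X \<in> carrier_mat n n" for X
  proof -
    have "transpose_mat I * transpose_mat J = transpose_mat (J * I)" by (simp add: mat_transpose_simps)
    also have "\<dots> = (-1) \<cdot>\<^sub>m (transpose_mat J * transpose_mat I)" unfolding IJ(5) by (simp add: mat_transpose_simps)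
    finally have "(transpose_mat I * transpose_mat J) * X = (-1) \<cdot>\<^sub>m (transpose_mat J * transpose_mat I) * X" by simp
    then show ?thesis using that by (simp add: mat_ring_simps)
  qed
  \<comment> \<open>Averaging over \<open>J\<close> preserves \<open>I\<close>-invariance, because \<open>I J\<close> and \<open>J I\<close> differ by a sign only.\<close>
  have KI: "transpose_mat I * K * I = 1 \<cdot>\<^sub>m K"
  proof -
    have "transpose_mat I * K * I = transpose_mat I * F' * I + transpose_mat J * (transpose_mat I * F' * I) * J"
      unfolding K_def by (simp add: mat_ring_simps IJ tJI)
    then show ?thesis unfolding F'(2) by (simp add: K_def)
  qed
  obtain \<epsilon> where e: "\<epsilon> = 1 \<or> \<epsilon> = (-1::real)" "K + \<epsilon> \<cdot>\<^sub>m transpose_mat K \<noteq> 0\<^sub>m n n"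
    "transpose_mat (K + \<epsilon> \<cdot>\<^sub>m transpose_mat K) = \<epsilon> \<cdot>\<^sub>m (K + \<epsilon> \<cdot>\<^sub>m transpose_mat K)"
    using symmetrize[OF Inv_carrier[OF K(1)] K(2)] by blast
  have B: "K + \<epsilon> \<cdot>\<^sub>m transpose_mat K \<in> Inv" using Inv_symmetrize[OF K(1)] .
  have Bc: "K + \<epsilon> \<cdot>\<^sub>m transpose_mat K \<in> carrier_mat n n" using B by (rule Inv_carrier)
  show ?thesis
    by (rule that[OF B e(2,1,3)])
      (use cI(1)[OF Bc] cJ(1)[OF Bc] congruence_symmetrize[of I K 1 \<epsilon>] congruence_symmetrize[of J K 1 \<epsilon>] K(3) KI in simp_all)
qed

end

section \<open>Orthogonal decomposition into blocks\<close>

text \<open>Padding with zero rows gives a square matrix of determinant zero.\<close>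

lemma wide_matrix_kernel:
  fixes X :: "real mat"
  assumes X: "X \<in> carrier_mat k n" and "k < n"
  obtains v where "v \<in> carrier_vec n" "v \<noteq> 0\<^sub>v n" "X *\<^sub>v v = 0\<^sub>v k"
proof -
  define Y where "Y = mat n n (\<lambda>(i, j). if i < k then X $$ (i, j) else 0)"
  have Y: "Y \<in> carrier_mat n n" by (simp add: Y_def)
  have "transpose_mat Y *\<^sub>v unit_vec n (n - 1) = 0\<^sub>v n"
    using \<open>k < n\<close> by (intro eq_vecI) (auto simp: Y_def scalar_prod_right_unit)
  moreover have "unit_vec n (n - 1) \<noteq> (0\<^sub>v n :: real vec)" 
  proof
    assume "unit_vec n (n - 1) = (0\<^sub>v n :: real vec)"
    then have "unit_vec n (n - 1) $ (n - 1) = (0\<^sub>v n :: real vec) $ (n - 1)" by simp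
    then show False using \<open>k < n\<close> by simp
  qed
  ultimately have "det (transpose_mat Y) = 0"
    using det_0_iff_vec_prod_zero[of "transpose_mat Y" n] Y unit_vec_carrier[of n "n - 1"]
    by (metis transpose_carrier_mat)
  then have "det Y = 0" using det_transpose[OF Y] by simp
  then obtain v where v: "v \<in> carrier_vec n" "v \<noteq> 0\<^sub>v n" "Y *\<^sub>v v = 0\<^sub>v n"
    using det_0_iff_vec_prod_zero[OF Y] by auto
  have "(X *\<^sub>v v) $ i = 0" if "i < k" for i
  proof -
    have "row X i = row Y i" using X that \<open>k < n\<close> by (intro eq_vecI) (auto simp: Y_def)
    then have "(X *\<^sub>v v) $ i = (Y *\<^sub>v v) $ i" using X that \<open>k < n\<close> by (simp add: Y_def)
    then show ?thesis using v(3) that \<open>k < n\<close> by simp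
  qed
  then have "X *\<^sub>v v = 0\<^sub>v k" using X by (intro eq_vecI) auto
  then show ?thesis using that v by blast
qed

definition stable_subspace :: "nat \<Rightarrow> real mat set \<Rightarrow> real vec set \<Rightarrow> bool" where
  "stable_subspace n Es C \<longleftrightarrow> C \<subseteq> carrier_vec n \<and> 0\<^sub>v n \<in> C \<and> (\<forall>x\<in>C. \<forall>y\<in>C. x + y \<in> C) \<and>
     (\<forall>c. \<forall>x\<in>C. c \<cdot>\<^sub>v x \<in> C) \<and> (\<forall>A\<in>Es. \<forall>x\<in>C. A *\<^sub>v x \<in> C)"

lemma stable_subspaceD:
  assumes "stable_subspace n Es C"
  shows "x \<in> C \<Longrightarrow> x \<in> carrier_vec n" "0\<^sub>v n \<in> C" "x \<in> C \<Longrightarrow> y \<in> C \<Longrightarrow> x + y \<in> C"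
    "x \<in> C \<Longrightarrow> c \<cdot>\<^sub>v x \<in> C" "A \<in> Es \<Longrightarrow> x \<in> C \<Longrightarrow> A *\<^sub>v x \<in> C"
  using assms unfolding stable_subspace_def by blast+

definition nondegenerate_on :: "nat \<Rightarrow> real mat \<Rightarrow> real vec set \<Rightarrow> bool" where
  "nondegenerate_on n B C \<longleftrightarrow> (\<forall>x\<in>C. (\<forall>y\<in>C. bform B x y = 0) \<longrightarrow> x = 0\<^sub>v n)"

text \<open>Column \<open>a * m + i\<close> is the \<open>a\<close>-th vector of block \<open>i\<close>. Grouping by position first makes the coordinates agree
  with those of \<open>complex_to_real_mat\<close> and \<open>quat_to_complex_mat\<close>, where all first components precede
  all second components.\<close>

definition block_columns :: "nat \<Rightarrow> nat \<Rightarrow> nat \<Rightarrow> (nat \<Rightarrow> nat \<Rightarrow> real vec) \<Rightarrow> real mat" where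
  "block_columns n d m u = mat n (d * m) (\<lambda>(r, c). u (c mod m) (c div m) $ r)"

text \<open>The combination is only ever used through its pairings, so it suffices to know that some vector with
  these pairings exists in \<open>C\<close>.\<close>

lemma linear_combination_form:
  fixes v :: "nat \<Rightarrow> real vec"
  assumes B: "B \<in> carrier_mat n n" and C: "stable_subspace n Es C" and v: "\<And>b. b < k \<Longrightarrow> v b \<in> C"
  shows "\<exists>z\<in>C. \<forall>x\<in>carrier_vec n. bform B x z = (\<Sum>b<k. c b * bform B x (v b))"
  using v
proof (induction k)
  case 0
  then show ?case using stable_subspaceD(2)[OF C] bform_zero_right[OF B] by auto
next
  case (Suc k)
  then obtain z where z: "z \<in> C" "\<forall>x\<in>carrier_vec n. bform B x z = (\<Sum>b<k. c b * bform B x (v b))" by auto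
  have vk: "v k \<in> C" using Suc.prems by simp
  show ?case
  proof (intro bexI ballI)
    show "z + c k \<cdot>\<^sub>v v k \<in> C" using stable_subspaceD[OF C] z vk by auto
    fix x :: "real vec" assume x: "x \<in> carrier_vec n"
    have "bform B x (z + c k \<cdot>\<^sub>v v k) = bform B x z + bform B x (c k \<cdot>\<^sub>v v k)"
      using B x stable_subspaceD(1)[OF C] z vk by (intro bform_add_right) auto
    also have "bform B x (c k \<cdot>\<^sub>v v k) = c k * bform B x (v k)"
      using B x stable_subspaceD(1)[OF C] vk by (intro bform_smult_right) auto
    finally show "bform B x (z + c k \<cdot>\<^sub>v v k) = (\<Sum>b<Suc k. c b * bform B x (v b))" using z(2) x by simp
  qed
qed

text \<open>One Gram-Schmidt process covers all seven families. A block is a \<open>d\<close>-tuple of vectors satisfying \<open>Blk\<close>.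
  The assumption \<open>dual\<close> says that column \<open>\<pi> b\<close> of its Gram matrix has exactly one non-zero entry,
  in row \<open>b\<close>, so that the orthogonal projection can be written down; \<open>tied\<close> says that its
  span is stable under the adjoints of \<open>Es\<close>, so that its orthogonal complement is stable under \<open>Es\<close>.\<close>

locale block_form =
  fixes n d :: nat and B :: "real mat" and \<epsilon> :: real and Es :: "real mat set"
    and Blk :: "(nat \<Rightarrow> real vec) \<Rightarrow> bool" and \<pi> :: "nat \<Rightarrow> nat"
  assumes B: "B \<in> carrier_mat n n"
    and nondeg: "nondegenerate_on n B (carrier_vec n)"
    and sym: "transpose_mat B = \<epsilon> \<cdot>\<^sub>m B"
    and Es: "Es \<subseteq> carrier_mat n n"
    and d: "0 < d"
    and blk_carrier: "\<And>u a. Blk u \<Longrightarrow> a < d \<Longrightarrow> u a \<in> carrier_vec n"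
    and \<pi>: "\<And>b. b < d \<Longrightarrow> \<pi> b < d"
    and dual: "\<And>u b c. Blk u \<Longrightarrow> b < d \<Longrightarrow> c < d \<Longrightarrow> bform B (u c) (u (\<pi> b)) = 0 \<longleftrightarrow> c \<noteq> b"
    and tied: "\<And>u A a. Blk u \<Longrightarrow> A \<in> Es \<Longrightarrow> a < d \<Longrightarrow>
       \<exists>t b. b < d \<and> (\<forall>x\<in>carrier_vec n. bform B (u a) (A *\<^sub>v x) = t * bform B (u b) x)"
    and ex: "\<And>C. stable_subspace n Es C \<Longrightarrow> nondegenerate_on n B C \<Longrightarrow> C \<noteq> {0\<^sub>v n} \<Longrightarrow> \<exists>u. Blk u \<and> (\<forall>a<d. u a \<in> C)"
begin

lemma form_swap: "x \<in> carrier_vec n \<Longrightarrow> y \<in> carrier_vec n \<Longrightarrow> bform B y x = \<epsilon> * bform B x y"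
  by (rule bform_swap[OF B sym])

definition perp :: "nat \<Rightarrow> (nat \<Rightarrow> nat \<Rightarrow> real vec) \<Rightarrow> real vec set" where
  "perp m u = {x \<in> carrier_vec n. \<forall>i<m. \<forall>a<d. bform B (u i a) x = 0}"

definition family :: "nat \<Rightarrow> (nat \<Rightarrow> nat \<Rightarrow> real vec) \<Rightarrow> bool" where
  "family m u \<longleftrightarrow> (\<forall>i<m. Blk (u i)) \<and>
     (\<forall>i<m. \<forall>j<m. i \<noteq> j \<longrightarrow> (\<forall>a<d. \<forall>b<d. bform B (u i a) (u j b) = 0)) \<and> nondegenerate_on n B (perp m u)"

lemma stable_perp:
  assumes "\<And>i. i < m \<Longrightarrow> Blk (u i)"
  shows "stable_subspace n Es (perp m u)"
proof -
  have c: "u i a \<in> carrier_vec n" if "i < m" "a < d" for i a using blk_carrier assms that by blast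
  have "A *\<^sub>v x \<in> perp m u" if A: "A \<in> Es" and x: "x \<in> perp m u" for A x
  proof -
    have "bform B (u i a) (A *\<^sub>v x) = 0" if "i < m" "a < d" for i a
      using tied[OF assms[OF that(1)] A that(2)] x that(1) by (auto simp: perp_def)
    moreover have "A *\<^sub>v x \<in> carrier_vec n" using A Es x mult_mat_vec_carrier[of A n n x] by (auto simp: perp_def)
    ultimately show ?thesis by (simp add: perp_def)
  qed
  then show ?thesis
    unfolding stable_subspace_def
    by (auto simp: perp_def bform_zero_right[OF B c] bform_add_right[OF B c] bform_smult_right[OF B c])
qed

text \<open>A block inside the complement is split off. The new complement is again nondegenerate: a vector \<open>x\<close> of it
  that is orthogonal to it is orthogonal to the whole old complement, since every \<open>y\<close> there becomes a vector
  of the new complement after adding a combination of the new block, which is orthogonal to \<open>x\<close>.\<close>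

lemma family_extend:
  assumes fam: "family m u" and ne: "perp m u \<noteq> {0\<^sub>v n}"
  shows "\<exists>u'. family (Suc m) u'"
proof -
  let ?C = "perp m u"
  have blk: "Blk (u i)" if "i < m" for i using fam that by (simp add: family_def)
  have orth: "bform B (u i a) (u j b) = 0" if "i < m" "j < m" "i \<noteq> j" "a < d" "b < d" for i j a b
    using fam that by (simp add: family_def)
  have ndC: "nondegenerate_on n B ?C" using fam by (simp add: family_def)
  have st: "stable_subspace n Es ?C" using stable_perp blk by blast
  obtain w where w: "Blk w" "\<And>a. a < d \<Longrightarrow> w a \<in> ?C" using ex[OF st ndC ne] by blast
  have wc: "w a \<in> carrier_vec n" if "a < d" for a using w(2)[OF that] by (simp add: perp_def)
  let ?u = "u(m := w)"
  have perp': "perp (Suc m) ?u = {x \<in> ?C. \<forall>a<d. bform B (w a) x = 0}"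
    by (auto simp: perp_def less_Suc_eq)
  have "family (Suc m) ?u" unfolding family_def
  proof (intro conjI allI impI)
    fix i assume "i < Suc m" then show "Blk (?u i)" using blk w by (auto simp: less_Suc_eq)
  next
    fix i j a b assume ij: "i < Suc m" "j < Suc m" "i \<noteq> j" "a < d" "b < d"
    have 1: "bform B (u i a) (w b) = 0" if "i < m" "a < d" "b < d" for i a b
      using w(2)[OF that(3)] that by (simp add: perp_def)
    have "bform B (w b) (u i a) = 0" if "i < m" "a < d" "b < d" for i a b
      using form_swap[OF blk_carrier[OF blk] wc, of i a b] 1 that by simp
    then show "bform B (?u i a) (?u j b) = 0" using ij orth 1 by (auto simp: less_Suc_eq)
  next
    show "nondegenerate_on n B (perp (Suc m) ?u)"
      unfolding nondegenerate_on_def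
    proof (intro ballI impI)
      fix x assume x: "x \<in> perp (Suc m) ?u" and x0: "\<forall>y\<in>perp (Suc m) ?u. bform B x y = 0"
      have xC: "x \<in> ?C" and xw: "\<And>a. a < d \<Longrightarrow> bform B (w a) x = 0" using x unfolding perp' by auto
      have xc: "x \<in> carrier_vec n" using xC by (simp add: perp_def)
      have "bform B x y = 0" if y: "y \<in> ?C" for y
      proof -
        have yc: "y \<in> carrier_vec n" using y by (simp add: perp_def)
        let ?c = "\<lambda>b. - bform B (w b) y / bform B (w b) (w (\<pi> b))"
        obtain z where z: "z \<in> ?C" "\<And>x. x \<in> carrier_vec n \<Longrightarrow> bform B x z = (\<Sum>b<d. ?c b * bform B x (w (\<pi> b)))"
          using linear_combination_form[OF B st, of d "\<lambda>b. w (\<pi> b)" ?c] w(2) \<pi> by auto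
        have zc: "z \<in> carrier_vec n" using z(1) by (simp add: perp_def)
        have "bform B (w a) (y + z) = 0" if a: "a < d" for a
        proof -
          have "bform B (w a) z = (\<Sum>b<d. if b = a then - bform B (w a) y else 0)"
            unfolding z(2)[OF wc[OF a]] using dual[OF w(1) _ a] dual[OF w(1) a a] by (intro sum.cong) auto
          then show ?thesis using bform_add_right[OF B wc[OF a] yc zc] a by simp
        qed
        then have "y + z \<in> perp (Suc m) ?u" unfolding perp' using stable_subspaceD(3)[OF st y z(1)] by auto
        then have "bform B x (y + z) = 0" using x0 by blast
        moreover have "bform B x z = 0"
          unfolding z(2)[OF xc] using form_swap[OF wc[OF \<pi>] xc] xw[OF \<pi>] by (intro sum.neutral) auto
        ultimately show ?thesis using bform_add_right[OF B xc yc zc] by simp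
      qed
      then show "x = 0\<^sub>v n" using ndC xC unfolding nondegenerate_on_def by blast
    qed
  qed
  then show ?thesis by blast
qed

text \<open>Pairing a vanishing combination of the columns with the vector matched to column \<open>k\<close> isolates the
  \<open>k\<close>-th coefficient.\<close>

lemma block_columns_kernel:
  assumes blk: "\<And>i. i < m \<Longrightarrow> Blk (u i)"
    and orth: "\<And>i j a b. i < m \<Longrightarrow> j < m \<Longrightarrow> i \<noteq> j \<Longrightarrow> a < d \<Longrightarrow> b < d \<Longrightarrow> bform B (u i a) (u j b) = 0"
    and z: "z \<in> carrier_vec (d * m)" "block_columns n d m u *\<^sub>v z = 0\<^sub>v n"
  shows "z = 0\<^sub>v (d * m)"
proof (rule eq_vecI)
  let ?N = "block_columns n d m u"
  have N: "?N \<in> carrier_mat n (d * m)" by (simp add: block_columns_def)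
  fix k assume "k < dim_vec (0\<^sub>v (d * m))"
  then have k: "k < d * m" by simp
  define i b where "i = k mod m" and "b = k div m"
  have m: "0 < m" using k by (cases m) auto
  have i: "i < m" "b < d" using k m by (auto simp: i_def b_def less_mult_imp_div_less)
  let ?y = "u i (\<pi> b)"
  have y: "?y \<in> carrier_vec n" using blk_carrier[OF blk[OF i(1)] \<pi>[OF i(2)]] .
  have By: "B *\<^sub>v ?y \<in> carrier_vec n" using B y by simp
  have "0 = z \<bullet> (transpose_mat ?N *\<^sub>v (B *\<^sub>v ?y))"
    using transpose_vec_mult_scalar[OF N z(1) By] z By N
    by (metis comm_scalar_prod mult_mat_vec_carrier scalar_prod_right_zero transpose_carrier_mat)
  also have "\<dots> = (\<Sum>c<d * m. z $ c * bform B (u (c mod m) (c div m)) ?y)"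
  proof -
    have "(transpose_mat ?N *\<^sub>v (B *\<^sub>v ?y)) $ c = bform B (u (c mod m) (c div m)) ?y" if c: "c < d * m" for c
    proof -
      have "u (c mod m) (c div m) \<in> carrier_vec n"
        using c m by (intro blk_carrier blk) (auto simp: less_mult_imp_div_less)
      then have "col ?N c = u (c mod m) (c div m)" using c by (intro eq_vecI) (auto simp: block_columns_def)
      then show ?thesis using c N by (simp add: bform_def)
    qed
    then show ?thesis using N by (auto simp: scalar_prod_def atLeast0LessThan intro!: sum.cong)
  qed
  also have "\<dots> = (\<Sum>c<d * m. if c = k then z $ k * bform B (u i b) ?y else 0)"
  proof (rule sum.cong)
    fix c assume "c \<in> {..<d * m}"
    then have c: "c mod m < m" "c div m < d" using m by (auto simp: less_mult_imp_div_less)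
    show "z $ c * bform B (u (c mod m) (c div m)) ?y = (if c = k then z $ k * bform B (u i b) ?y else 0)"
    proof (cases "c = k")
      case False
      then have "c mod m \<noteq> i \<or> c div m \<noteq> b" unfolding i_def b_def by (metis div_mult_mod_eq)
      then have "bform B (u (c mod m) (c div m)) ?y = 0"
      proof
        assume "c mod m \<noteq> i"
        then show ?thesis using orth[OF c(1) i(1) _ c(2) \<pi>[OF i(2)]] by simp
      next
        assume "c div m \<noteq> b"
        show ?thesis
        proof (cases "c mod m = i")
          case True
          then show ?thesis using dual[OF blk[OF i(1)] i(2) c(2)] \<open>c div m \<noteq> b\<close> by simp
        next
          case False
          then show ?thesis using orth[OF c(1) i(1) _ c(2) \<pi>[OF i(2)]] by simp
        qed
      qed
      then show ?thesis using False by simp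
    qed (simp add: i_def b_def)
  qed simp
  also have "\<dots> = z $ k * bform B (u i b) ?y" using k by simp
  finally have "z $ k * bform B (u i b) ?y = 0" by simp
  then show "z $ k = 0\<^sub>v (d * m) $ k" using dual[OF blk[OF i(1)] i(2) i(2)] k by simp
qed (use z in simp)

text \<open>By independence at most \<open>n / d\<close> blocks fit, so a family of maximal size exists; its complement is zero
  because it cannot be extended. If the blocks did not fill the space, a vector orthogonal to all of them would
  exist by counting equations.\<close>

theorem block_decomposition:
  obtains m u where "n = d * m" "\<And>i. i < m \<Longrightarrow> Blk (u i)"
    "\<And>i j a b. i < m \<Longrightarrow> j < m \<Longrightarrow> i \<noteq> j \<Longrightarrow> a < d \<Longrightarrow> b < d \<Longrightarrow> bform B (u i a) (u j b) = 0"
proof -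
  have bound: "d * m \<le> n" if "family m u" for m u
  proof (rule ccontr)
    assume "\<not> d * m \<le> n"
    then obtain v where "v \<in> carrier_vec (d * m)" "v \<noteq> 0\<^sub>v (d * m)" "block_columns n d m u *\<^sub>v v = 0\<^sub>v n"
      using wide_matrix_kernel[of "block_columns n d m u" n "d * m"] by (auto simp: block_columns_def)
    moreover have "Blk (u i)" if "i < m" for i using \<open>family m u\<close> that by (simp add: family_def)
    moreover have "bform B (u i a) (u j b) = 0" if "i < m" "j < m" "i \<noteq> j" "a < d" "b < d" for i j a b
      using \<open>family m u\<close> that by (simp add: family_def)
    ultimately show False using block_columns_kernel[of m u v] by blast
  qed
  have "perp 0 (\<lambda>_ _. 0\<^sub>v n) = carrier_vec n" by (simp add: perp_def)
  then have "family 0 (\<lambda>_ _. 0\<^sub>v n)" using nondeg by (simp add: family_def)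
  then have "\<exists>u. family 0 u" by blast
  moreover have "\<forall>m. (\<exists>u. family m u) \<longrightarrow> m \<le> n"
  proof (intro allI impI)
    fix m assume "\<exists>u. family m u"
    then have "d * m \<le> n" using bound by blast
    moreover have "m \<le> d * m" using d by (cases d) auto
    ultimately show "m \<le> n" by (rule le_trans[rotated])
  qed
  ultimately obtain m where m: "\<exists>u. family m u" "\<And>k. \<exists>u. family k u \<Longrightarrow> k \<le> m"
    using Nat.ex_has_greatest_nat[of "\<lambda>m. \<exists>u. family m u" 0 n] by blast
  then obtain u where fam: "family m u" by blast
  have C: "perp m u = {0\<^sub>v n}" using family_extend[OF fam] m(2)[of "Suc m"] by (metis not_less_eq_eq order_refl)
  have "n \<le> d * m"
  proof (rule ccontr)
    assume "\<not> n \<le> d * m"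
    then have "d * m < n" by simp
    let ?N = "block_columns n d m u"
    have N: "?N \<in> carrier_mat n (d * m)" by (simp add: block_columns_def)
    obtain v where v: "v \<in> carrier_vec n" "v \<noteq> 0\<^sub>v n" "(transpose_mat ?N * B) *\<^sub>v v = 0\<^sub>v (d * m)"
      using wide_matrix_kernel[of "transpose_mat ?N * B" "d * m" n] N B \<open>d * m < n\<close>
      by (metis mult_carrier_mat transpose_carrier_mat)
    have "bform B (u i a) v = 0" if ia: "i < m" "a < d" for i a
    proof -
      let ?c = "a * m + i"
      have "a * m + i < a * m + m" using ia by simp
      also have "\<dots> = Suc a * m" by simp
      also have "\<dots> \<le> d * m" using ia by (intro mult_le_mono1) simp
      finally have c: "?c < d * m" .
      have cm: "?c mod m = i" "?c div m = a" using ia by auto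
      have "u i a \<in> carrier_vec n" using fam ia blk_carrier by (simp add: family_def)
      then have "col ?N ?c = u i a" using c cm by (intro eq_vecI) (auto simp: block_columns_def)
      then have "bform B (u i a) v = (transpose_mat ?N *\<^sub>v (B *\<^sub>v v)) $ ?c"
        using c N by (simp add: bform_def)
      also have "\<dots> = ((transpose_mat ?N * B) *\<^sub>v v) $ ?c"
        using assoc_mult_mat_vec[of "transpose_mat ?N" "d * m" n B n v] N B v(1) by simp
      finally show ?thesis unfolding v(3) using c by simp
    qed
    then have "v \<in> perp m u" using v(1) by (simp add: perp_def)
    then show False using C v(2) by simp
  qed
  then have nm: "n = d * m" using bound[OF fam] by simp
  then show ?thesis
  proof (rule that)
    show "Blk (u i)" if "i < m" for i using fam that unfolding family_def by blast
    show "bform B (u i a) (u j b) = 0" if "i < m" "j < m" "i \<noteq> j" "a < d" "b < d" for i j a b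
      using fam that unfolding family_def by blast
  qed
qed

text \<open>Needed to list the negative blocks first, as in \<open>sig_mat\<close>.\<close>

lemma sort_by_predicate:
  fixes P :: "nat \<Rightarrow> bool"
  obtains r \<sigma> where "r \<le> m" "bij_betw \<sigma> {..<m} {..<m}" "\<And>i. i < m \<Longrightarrow> P (\<sigma> i) \<longleftrightarrow> i < r"
proof -
  let ?xs = "filter P [0..<m]" and ?ys = "filter (\<lambda>i. \<not> P i) [0..<m]"
  let ?zs = "?xs @ ?ys"
  have len: "length ?zs = m" using sum_length_filter_compl[of P "[0..<m]"] by simp
  have "distinct ?zs" by auto
  then have inj: "inj_on ((!) ?zs) {..<m}" by (rule inj_on_nth) (unfold len, simp)
  have "set ?zs = {..<m}" by auto
  then have "(!) ?zs ` {..<m} = {..<m}" using len by (metis atLeast0LessThan atLeast_upt nth_image order_refl set_upt take_all_iff)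
  then have bij: "bij_betw ((!) ?zs) {..<m} {..<m}" using inj by (simp add: bij_betw_def)
  show ?thesis
  proof (rule that[of "length ?xs", OF _ bij])
    show "length ?xs \<le> m" using length_filter_le[of P "[0..<m]"] by simp
    fix i assume i: "i < m"
    show "P (?zs ! i) \<longleftrightarrow> i < length ?xs"
    proof (cases "i < length ?xs")
      case True
      then have "?zs ! i \<in> set ?xs" by (metis nth_append nth_mem)
      then show ?thesis using True by auto
    next
      case False
      then have "i - length ?xs < length ?ys" using i len by simp
      then have "?zs ! i \<in> set ?ys" using False by (metis nth_append nth_mem)
      then show ?thesis using False by auto
    qed
  qed
qed

theorem block_frame:
  obtains m r u where "n = d * m" "r \<le> m" "\<And>i. i < m \<Longrightarrow> Blk (u i)" "\<And>i. i < m \<Longrightarrow> P (u i) \<longleftrightarrow> i < r"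
    "\<And>i j a b. i < m \<Longrightarrow> j < m \<Longrightarrow> i \<noteq> j \<Longrightarrow> a < d \<Longrightarrow> b < d \<Longrightarrow> bform B (u i a) (u j b) = 0"
    "\<And>z. z \<in> carrier_vec n \<Longrightarrow> block_columns n d m u *\<^sub>v z = 0\<^sub>v n \<Longrightarrow> z = 0\<^sub>v n"
proof -
  obtain m u where n: "n = d * m" and blk: "\<And>i. i < m \<Longrightarrow> Blk (u i)"
    and orth: "\<And>i j a b. i < m \<Longrightarrow> j < m \<Longrightarrow> i \<noteq> j \<Longrightarrow> a < d \<Longrightarrow> b < d \<Longrightarrow> bform B (u i a) (u j b) = 0"
    using block_decomposition by blast
  obtain r \<sigma> where r: "r \<le> m" and \<sigma>: "bij_betw \<sigma> {..<m} {..<m}" and P: "\<And>i. i < m \<Longrightarrow> P (u (\<sigma> i)) \<longleftrightarrow> i < r"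
    using sort_by_predicate[of m "\<lambda>i. P (u i)"] by blast
  have \<sigma>m: "\<sigma> i < m" if "i < m" for i using bij_betwE[OF \<sigma>] that by auto
  have \<sigma>i: "\<sigma> i \<noteq> \<sigma> j" if "i < m" "j < m" "i \<noteq> j" for i j
    using bij_betw_imp_inj_on[OF \<sigma>] that by (auto simp: inj_on_def)
  have blk': "Blk (u (\<sigma> i))" if "i < m" for i by (rule blk[OF \<sigma>m[OF that]])
  have orth': "bform B (u (\<sigma> i) a) (u (\<sigma> j) b) = 0" if "i < m" "j < m" "i \<noteq> j" "a < d" "b < d" for i j a b
    by (rule orth[OF \<sigma>m[OF that(1)] \<sigma>m[OF that(2)] \<sigma>i[OF that(1-3)] that(4,5)])
  show ?thesis
  proof (rule that[of m r "\<lambda>i. u (\<sigma> i)", OF n r blk' P orth'])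
    show "z = 0\<^sub>v n" if "z \<in> carrier_vec n" "block_columns n d m (\<lambda>i. u (\<sigma> i)) *\<^sub>v z = 0\<^sub>v n" for z
      using block_columns_kernel[of m "\<lambda>i. u (\<sigma> i)" z, OF blk' orth', folded n] that by blast
  qed
qed

end

section \<open>Complex matrices as real matrices\<close>

lemma mat_cancel_left:
  fixes A :: "'a::semiring_1 mat"
  assumes "L \<in> carrier_mat n n" "A \<in> carrier_mat n n" "L * A = 1\<^sub>m n"
    "X \<in> carrier_mat n k" "Y \<in> carrier_mat n k" "A * X = A * Y"
  shows "X = Y"
proof -
  have "L * A * X = L * A * Y" using assms(1,2,4,5,6) by (simp add: assoc_mult_mat[of L n n A n _ k])
  then show ?thesis unfolding assms(3) using assms(4,5) by simp
qed

lemma complex_to_real_mat_carrier [simp]: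
  "C \<in> carrier_mat m m \<Longrightarrow> complex_to_real_mat C \<in> carrier_mat (m + m) (m + m)"
  unfolding complex_to_real_mat_def by auto

lemma map_mat_mult_complex:
  assumes "C \<in> carrier_mat m k" "D \<in> carrier_mat k l"
  shows "map_mat Re (C * D) = map_mat Re C * map_mat Re D - map_mat Im C * map_mat Im D"
    "map_mat Im (C * D) = map_mat Re C * map_mat Im D + map_mat Im C * map_mat Re D"
  using assms by (auto intro!: eq_matI simp: scalar_prod_def sum_subtractf sum.distrib)

lemma complex_to_real_mat_mult:
  assumes "C \<in> carrier_mat m m" "D \<in> carrier_mat m m"
  shows "complex_to_real_mat (C * D) = complex_to_real_mat C * complex_to_real_mat D"
  unfolding complex_to_real_mat_def map_mat_mult_complex[OF assms]
  by (subst mult_four_block_mat[of _ m m _ m _ m _ _ m _ m])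
    (use assms in \<open>auto intro!: cong_four_block_mat eq_matI\<close>)

lemma complex_to_real_mat_inj:
  assumes "C \<in> carrier_mat m m" "D \<in> carrier_mat m m" "complex_to_real_mat C = complex_to_real_mat D"
  shows "C = D"
proof (rule eq_matI)
  fix i j assume "i < dim_row D" "j < dim_col D"
  then have ij: "i < m" "j < m" using assms(2) by auto
  have "complex_to_real_mat C $$ (i, j) = complex_to_real_mat D $$ (i, j)"
    "complex_to_real_mat C $$ (i + m, j) = complex_to_real_mat D $$ (i + m, j)"
    using assms(3) by simp_all
  then show "C $$ (i, j) = D $$ (i, j)"
    using ij assms(1,2) by (auto simp: complex_to_real_mat_def complex_eq_iff)
qed (use assms in auto)

lemma complex_to_real_mat_one: "complex_to_real_mat (1\<^sub>m m) = 1\<^sub>m (m + m)"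
  by (intro eq_matI) (auto simp: complex_to_real_mat_def)

lemma complex_to_real_mat_adjoint:
  "C \<in> carrier_mat m m \<Longrightarrow> complex_to_real_mat (transpose_mat (map_mat cnj C)) = transpose_mat (complex_to_real_mat C)"
  by (intro eq_matI) (auto simp: complex_to_real_mat_def)

text \<open>This is the real matrix of complex conjugation. It turns a complex bilinear form with matrix \<open>F\<close> into the
  real Gram matrix \<open>conj_sign m * complex_to_real_mat F\<close> of its real part.\<close>

definition conj_sign :: "nat \<Rightarrow> real mat" where
  "conj_sign m = block_diag (1\<^sub>m m) (- 1\<^sub>m m)"

lemma conj_sign_carrier [simp]: "conj_sign m \<in> carrier_mat (m + m) (m + m)"
  by (auto simp: conj_sign_def block_diag_def)

lemma conj_sign_mult:
  assumes "a \<in> carrier_mat m m" "b \<in> carrier_mat m m" "c \<in> carrier_mat m m" "d \<in> carrier_mat m m"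
  shows "conj_sign m * four_block_mat a b c d = four_block_mat a b (- c) (- d)"
    "four_block_mat a b c d * conj_sign m = four_block_mat a (- b) c (- d)"
proof -
  have e: "conj_sign m = four_block_mat (1\<^sub>m m) (0\<^sub>m m m) (0\<^sub>m m m) (- 1\<^sub>m m)"
    by (auto simp: conj_sign_def block_diag_def)
  show "conj_sign m * four_block_mat a b c d = four_block_mat a b (- c) (- d)"
    unfolding e by (subst mult_four_block_mat[of _ m m _ m _ m _ _ m _ m])
      (use assms in \<open>auto intro!: cong_four_block_mat eq_matI\<close>)
  show "four_block_mat a b c d * conj_sign m = four_block_mat a (- b) c (- d)"
    unfolding e by (subst mult_four_block_mat[of _ m m _ m _ m _ _ m _ m])
      (use assms in \<open>auto intro!: cong_four_block_mat eq_matI\<close>)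
qed

lemma conj_sign_square: "conj_sign m * conj_sign m = 1\<^sub>m (m + m)"
proof -
  have e: "conj_sign m = four_block_mat (1\<^sub>m m) (0\<^sub>m m m) (0\<^sub>m m m) (- 1\<^sub>m m)"
    by (auto simp: conj_sign_def block_diag_def)
  have "conj_sign m * conj_sign m = conj_sign m * four_block_mat (1\<^sub>m m) (0\<^sub>m m m) (0\<^sub>m m m) (- 1\<^sub>m m)"
    using e by simp
  also have "\<dots> = 1\<^sub>m (m + m)" by (subst conj_sign_mult) (auto intro!: eq_matI)
  finally show ?thesis .
qed

text \<open>\<open>complex_to_real_mat\<close> turns adjoints into transposes; conjugating by \<open>conj_sign\<close> turns the adjoint into the
  plain transpose.\<close>

lemma conj_sign_transpose:
  assumes "C \<in> carrier_mat m m"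
  shows "conj_sign m * complex_to_real_mat (transpose_mat C) = transpose_mat (complex_to_real_mat C) * conj_sign m"
proof -
  have "transpose_mat (complex_to_real_mat C) = four_block_mat (transpose_mat (map_mat Re C)) (transpose_mat (map_mat Im C))
     (transpose_mat (- map_mat Im C)) (transpose_mat (map_mat Re C))"
    unfolding complex_to_real_mat_def by (rule transpose_four_block_mat[of _ m m _ m _ m]) (use assms in auto)
  moreover have "complex_to_real_mat (transpose_mat C) = four_block_mat (map_mat Re (transpose_mat C)) (- map_mat Im (transpose_mat C))
     (map_mat Im (transpose_mat C)) (map_mat Re (transpose_mat C))"
    by (simp add: complex_to_real_mat_def)
  ultimately show ?thesis
    using assms by (simp add: conj_sign_mult) (auto intro!: cong_four_block_mat eq_matI)
qed

lemma hermitian_isometry_iff: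
  assumes C: "C \<in> carrier_mat m m" and F: "F \<in> carrier_mat m m"
  shows "transpose_mat (complex_to_real_mat C) * complex_to_real_mat F * complex_to_real_mat C = complex_to_real_mat F
     \<longleftrightarrow> transpose_mat (map_mat cnj C) * F * C = F"
proof -
  have H: "transpose_mat (map_mat cnj C) \<in> carrier_mat m m" using C by simp
  have HF: "transpose_mat (map_mat cnj C) * F \<in> carrier_mat m m" using H F by simp
  have "complex_to_real_mat (transpose_mat (map_mat cnj C) * F * C)
     = transpose_mat (complex_to_real_mat C) * complex_to_real_mat F * complex_to_real_mat C"
    unfolding complex_to_real_mat_mult[OF HF C] complex_to_real_mat_mult[OF H F] complex_to_real_mat_adjoint[OF C] ..
  moreover have "transpose_mat (map_mat cnj C) * F * C \<in> carrier_mat m m" using HF C by simp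
  ultimately show ?thesis using complex_to_real_mat_inj[OF _ F] by metis
qed

lemma bilinear_isometry_iff:
  assumes C: "C \<in> carrier_mat m m" and F: "F \<in> carrier_mat m m"
  shows "transpose_mat (complex_to_real_mat C) * (conj_sign m * complex_to_real_mat F) * complex_to_real_mat C
       = conj_sign m * complex_to_real_mat F \<longleftrightarrow> transpose_mat C * F * C = F"
proof -
  let ?K = "conj_sign m" and ?c = complex_to_real_mat
  note [simp] = C F complex_to_real_mat_carrier[OF C] complex_to_real_mat_carrier[OF F]
  have Tc: "transpose_mat C \<in> carrier_mat m m" by simp
  have TF: "transpose_mat C * F \<in> carrier_mat m m" using mult_carrier_mat[OF Tc F] .
  have TFC: "transpose_mat C * F * C \<in> carrier_mat m m" using mult_carrier_mat[OF TF C] .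
  note [simp] = complex_to_real_mat_carrier[OF Tc] complex_to_real_mat_carrier[OF TFC]
  have "transpose_mat (?c C) * (?K * ?c F) * ?c C = (transpose_mat (?c C) * ?K) * ?c F * ?c C"
    by (simp add: assoc_mult_mat[of _ "m + m" "m + m" _ "m + m" _ "m + m"])
  also have "\<dots> = ?K * ?c (transpose_mat C * F * C)"
    unfolding conj_sign_transpose[OF C, symmetric] complex_to_real_mat_mult[OF TF C] complex_to_real_mat_mult[OF Tc F]
    by (simp add: assoc_mult_mat[of _ "m + m" "m + m" _ "m + m" _ "m + m"])
  finally have *: "transpose_mat (?c C) * (?K * ?c F) * ?c C = ?K * ?c (transpose_mat C * F * C)" .
  show ?thesis
  proof
    assume "transpose_mat (?c C) * (?K * ?c F) * ?c C = ?K * ?c F"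
    then have "?K * ?c (transpose_mat C * F * C) = ?K * ?c F" unfolding * .
    from mat_cancel_left[OF conj_sign_carrier conj_sign_carrier conj_sign_square _ _ this, of "m + m"] have "?c (transpose_mat C * F * C) = ?c F" by simp
    then show "transpose_mat C * F * C = F" using complex_to_real_mat_inj[OF TFC F] by simp
  qed (use * in simp)
qed

definition real_i :: "nat \<Rightarrow> real mat" where
  "real_i m = four_block_mat (0\<^sub>m m m) (- 1\<^sub>m m) (1\<^sub>m m) (0\<^sub>m m m)"

lemma real_i_carrier [simp]: "real_i m \<in> carrier_mat (m + m) (m + m)"
  by (auto simp: real_i_def)

lemma four_block_mat_eqD:
  assumes "four_block_mat a b c d = four_block_mat a' b' c' d'"
    "a \<in> carrier_mat m m" "b \<in> carrier_mat m m" "c \<in> carrier_mat m m" "d \<in> carrier_mat m m"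
    "a' \<in> carrier_mat m m" "b' \<in> carrier_mat m m" "c' \<in> carrier_mat m m" "d' \<in> carrier_mat m m"
  shows "a = a'" "b = b'" "c = c'" "d = d'"
proof -
  have e: "four_block_mat a b c d $$ (i, j) = four_block_mat a' b' c' d' $$ (i, j)" for i j using assms(1) by simp
  show "a = a'" using e assms(2-) by (intro eq_matI) (auto, metis add.commute carrier_matD index_mat_four_block(1) trans_less_add1)
  show "b = b'"
  proof (rule eq_matI)
    fix i j assume "i < dim_row b'" "j < dim_col b'"
    then show "b $$ (i, j) = b' $$ (i, j)" using e[of i "j + m"] assms(2-) by auto
  qed (use assms(2-) in auto)
  show "c = c'"
  proof (rule eq_matI)
    fix i j assume "i < dim_row c'" "j < dim_col c'"
    then show "c $$ (i, j) = c' $$ (i, j)" using e[of "i + m" j] assms(2-) by auto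
  qed (use assms(2-) in auto)
  show "d = d'"
  proof (rule eq_matI)
    fix i j assume "i < dim_row d'" "j < dim_col d'"
    then show "d $$ (i, j) = d' $$ (i, j)" using e[of "i + m" "j + m"] assms(2-) by auto
  qed (use assms(2-) in auto)
qed

lemma square_four_blocks:
  assumes "A \<in> carrier_mat (m + m) (m + m)"
  obtains a b c d where "A = four_block_mat a b c d"
    "a \<in> carrier_mat m m" "b \<in> carrier_mat m m" "c \<in> carrier_mat m m" "d \<in> carrier_mat m m"
proof -
  obtain a b c d where s: "split_block A m m = (a, b, c, d)" by (metis prod_cases4)
  from split_block[OF s, of m m] assms that show ?thesis by auto
qed

lemma commutes_real_i_imp_complex:
  assumes A: "A \<in> carrier_mat (m + m) (m + m)" and comm: "A * real_i m = real_i m * A"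
  obtains C where "C \<in> carrier_mat m m" "A = complex_to_real_mat C"
proof -
  obtain a b c d where A4: "A = four_block_mat a b c d"
    and abcd: "a \<in> carrier_mat m m" "b \<in> carrier_mat m m" "c \<in> carrier_mat m m" "d \<in> carrier_mat m m"
    using square_four_blocks[OF A] .
  have "A * real_i m = four_block_mat b (- a) d (- c)"
    unfolding A4 real_i_def by (subst mult_four_block_mat[of _ m m _ m _ m _ _ m _ m])
      (use abcd in \<open>auto intro!: cong_four_block_mat eq_matI\<close>)
  moreover have "real_i m * A = four_block_mat (- c) (- d) a b"
    unfolding A4 real_i_def by (subst mult_four_block_mat[of _ m m _ m _ m _ _ m _ m])
      (use abcd in \<open>auto intro!: cong_four_block_mat eq_matI\<close>)
  ultimately have "four_block_mat b (- a) d (- c) = four_block_mat (- c) (- d) a b" using comm by simp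
  from four_block_mat_eqD[OF this, of m] have bd: "b = - c" "d = a" using abcd by simp_all
  let ?C = "mat m m (\<lambda>ij. Complex (a $$ ij) (c $$ ij))"
  have "map_mat Re ?C = a" "map_mat Im ?C = c" using abcd by (auto intro!: eq_matI)
  then have "A = complex_to_real_mat ?C" unfolding A4 bd complex_to_real_mat_def by simp
  then show ?thesis using that[of ?C] by simp
qed

lemma complex_to_real_mat_commutes:
  assumes C: "C \<in> carrier_mat m m"
  shows "complex_to_real_mat C * real_i m = real_i m * complex_to_real_mat C"
  unfolding complex_to_real_mat_def real_i_def
  by (subst (1 2) mult_four_block_mat[of _ m m _ m _ m _ _ m _ m])
    (use C in \<open>auto intro!: cong_four_block_mat eq_matI\<close>)

text \<open>The inverse of a real matrix commuting with \<open>i\<close> commutes with \<open>i\<close> too, hence is complex.\<close>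

lemma GL_complex_to_real_iff:
  assumes C: "C \<in> carrier_mat m m"
  shows "complex_to_real_mat C \<in> carrier (GL TYPE(real) (m + m)) \<longleftrightarrow> C \<in> carrier (GL TYPE(complex) m)"
proof
  assume "C \<in> carrier (GL TYPE(complex) m)"
  then obtain D where "D \<in> carrier_mat m m" "D * C = 1\<^sub>m m" "C * D = 1\<^sub>m m" unfolding GL_iff by blast
  then show "complex_to_real_mat C \<in> carrier (GL TYPE(real) (m + m))"
    unfolding GL_iff using C complex_to_real_mat_mult complex_to_real_mat_one complex_to_real_mat_carrier by metis
next
  let ?A = "complex_to_real_mat C"
  have A: "?A \<in> carrier_mat (m + m) (m + m)" using C by simp
  assume "?A \<in> carrier (GL TYPE(real) (m + m))"
  then obtain B where B: "B \<in> carrier_mat (m + m) (m + m)" "B * ?A = 1\<^sub>m (m + m)" "?A * B = 1\<^sub>m (m + m)"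
    unfolding GL_iff by blast
  note ass = assoc_mult_mat[of _ "m + m" "m + m" _ "m + m" _ "m + m"]
  have "?A * (B * real_i m) = (?A * B) * real_i m" using A B(1) by (simp add: ass)
  also have "\<dots> = real_i m * (?A * B)"
    unfolding B(3) using left_mult_one_mat[OF real_i_carrier] right_mult_one_mat[OF real_i_carrier] by simp
  also have "\<dots> = (real_i m * ?A) * B" using A B(1) by (simp add: ass)
  also have "\<dots> = ?A * (real_i m * B)" unfolding complex_to_real_mat_commutes[OF C, symmetric] using A B(1) by (simp add: ass)
  finally have "B * real_i m = real_i m * B"
    using mat_cancel_left[OF B(1) A B(2) mult_carrier_mat[OF B(1) real_i_carrier]
      mult_carrier_mat[OF real_i_carrier B(1)]] by simp
  then obtain D where D: "D \<in> carrier_mat m m" "B = complex_to_real_mat D"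
    using commutes_real_i_imp_complex[OF B(1)] by blast
  have "complex_to_real_mat (D * C) = complex_to_real_mat (1\<^sub>m m)" "complex_to_real_mat (C * D) = complex_to_real_mat (1\<^sub>m m)"
    using B(2,3) unfolding D(2) complex_to_real_mat_one complex_to_real_mat_mult[OF C D(1)] complex_to_real_mat_mult[OF D(1) C] by simp_all
  then have "D * C = 1\<^sub>m m" "C * D = 1\<^sub>m m"
    using complex_to_real_mat_inj[of "D * C" m "1\<^sub>m m"] complex_to_real_mat_inj[of "C * D" m "1\<^sub>m m"] C D(1) by simp_all
  then show "C \<in> carrier (GL TYPE(complex) m)" unfolding GL_iff using C D(1) by blast
qed

section \<open>Quaternionic matrices as complex matrices\<close>

definition quat_fst :: "quat mat \<Rightarrow> complex mat" where
  "quat_fst = map_mat (\<lambda>x. Complex (qRe x) (qI x))"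

definition quat_snd :: "quat mat \<Rightarrow> complex mat" where
  "quat_snd = map_mat (\<lambda>x. Complex (qJ x) (qK x))"

lemma quat_fst_snd_carrier:
  "Q \<in> carrier_mat m k \<Longrightarrow> quat_fst Q \<in> carrier_mat m k" "Q \<in> carrier_mat m k \<Longrightarrow> quat_snd Q \<in> carrier_mat m k"
  by (simp_all add: quat_fst_def quat_snd_def)

lemma quat_to_complex_mat_blocks:
  "quat_to_complex_mat Q = four_block_mat (quat_fst Q) (- quat_snd Q) (map_mat cnj (quat_snd Q)) (map_mat cnj (quat_fst Q))"
  by (simp add: quat_to_complex_mat_def quat_fst_def quat_snd_def Let_def)

lemma quat_to_complex_mat_carrier:
  "Q \<in> carrier_mat m m \<Longrightarrow> quat_to_complex_mat Q \<in> carrier_mat (m + m) (m + m)"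
  unfolding quat_to_complex_mat_blocks by (auto simp: quat_fst_def)

lemma quat_sum:
  "qRe (sum f A) = (\<Sum>x\<in>A. qRe (f x))" "qI (sum f A) = (\<Sum>x\<in>A. qI (f x))"
  "qJ (sum f A) = (\<Sum>x\<in>A. qJ (f x))" "qK (sum f A) = (\<Sum>x\<in>A. qK (f x))"
  by (induction A rule: infinite_finite_induct) (auto simp: zero_quat_def plus_quat_def)

lemma quat_mat_mult:
  assumes "Q \<in> carrier_mat m k" "R \<in> carrier_mat k l"
  shows "quat_fst (Q * R) = quat_fst Q * quat_fst R - quat_snd Q * map_mat cnj (quat_snd R)"
    "quat_snd (Q * R) = quat_fst Q * quat_snd R + quat_snd Q * map_mat cnj (quat_fst R)"
  using assms by (auto intro!: eq_matI simp: quat_fst_def quat_snd_def scalar_prod_def quat_sum times_quat_def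
    complex_eq_iff sum_subtractf sum.distrib algebra_simps)

lemma map_mat_cnj_mult:
  assumes "C \<in> carrier_mat m k" "D \<in> carrier_mat k l"
  shows "map_mat cnj (C * D) = map_mat cnj C * map_mat cnj D"
  using assms by (auto intro!: eq_matI simp: scalar_prod_def)

lemma map_mat_cnj_cnj [simp]: "map_mat cnj (map_mat cnj C) = C"
  by (auto intro!: eq_matI)

lemma quat_to_complex_mat_mult:
  assumes "Q \<in> carrier_mat m m" "R \<in> carrier_mat m m"
  shows "quat_to_complex_mat (Q * R) = quat_to_complex_mat Q * quat_to_complex_mat R"
proof -
  note c = quat_fst_snd_carrier[OF assms(1)] quat_fst_snd_carrier[OF assms(2)]
  let ?U = "quat_fst Q" and ?V = "quat_snd Q" and ?U' = "quat_fst R" and ?V' = "quat_snd R"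
  have cc: "map_mat cnj ?U \<in> carrier_mat m m" "map_mat cnj ?V \<in> carrier_mat m m" 
    "map_mat cnj ?U' \<in> carrier_mat m m" "map_mat cnj ?V' \<in> carrier_mat m m" using c by simp_all
  have 1: "map_mat cnj (quat_fst (Q * R)) = map_mat cnj ?U * map_mat cnj ?U' - map_mat cnj ?V * ?V'"
    unfolding quat_mat_mult[OF assms] using map_mat_cnj_mult[OF c(1,3)] map_mat_cnj_mult[OF c(2) cc(4)] c
    by (auto intro!: eq_matI simp del: index_mult_mat(1) simp flip: map_mat_cnj_mult) (auto simp: scalar_prod_def)
  have 2: "map_mat cnj (quat_snd (Q * R)) = map_mat cnj ?U * map_mat cnj ?V' + map_mat cnj ?V * ?U'"
    unfolding quat_mat_mult[OF assms] using map_mat_cnj_mult[OF c(1,4)] map_mat_cnj_mult[OF c(2) cc(3)] c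
    by (auto intro!: eq_matI simp del: index_mult_mat(1) simp flip: map_mat_cnj_mult) (auto simp: scalar_prod_def)
  show ?thesis
    unfolding quat_to_complex_mat_blocks 1 2 unfolding quat_mat_mult[OF assms]
    by (subst mult_four_block_mat[of _ m m _ m _ m _ _ m _ m])
      (use c cc in \<open>auto intro!: cong_four_block_mat eq_matI\<close>)
qed

lemma quat_to_complex_mat_inj:
  assumes "Q \<in> carrier_mat m m" "R \<in> carrier_mat m m" "quat_to_complex_mat Q = quat_to_complex_mat R"
  shows "Q = R"
proof (rule eq_matI)
  fix i j assume "i < dim_row R" "j < dim_col R"
  then have ij: "i < m" "j < m" using assms(2) by auto
  have "quat_to_complex_mat Q $$ (i, j) = quat_to_complex_mat R $$ (i, j)"
    "quat_to_complex_mat Q $$ (i, j + m) = quat_to_complex_mat R $$ (i, j + m)"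
    using assms(3) by simp_all
  then show "Q $$ (i, j) = R $$ (i, j)"
    using ij assms(1,2) by (auto simp: quat_to_complex_mat_blocks quat_fst_def quat_snd_def quat.expand)
qed (use assms in auto)

lemma quat_to_complex_mat_one: "quat_to_complex_mat (1\<^sub>m m) = 1\<^sub>m (m + m)"
  by (intro eq_matI) (auto simp: quat_to_complex_mat_blocks quat_fst_def quat_snd_def one_quat_def zero_quat_def complex_eq_iff)

lemma quat_to_complex_mat_adjoint:
  "Q \<in> carrier_mat m m \<Longrightarrow> quat_to_complex_mat (transpose_mat (map_mat qcnj Q))
     = transpose_mat (map_mat cnj (quat_to_complex_mat Q))"
  by (intro eq_matI) (auto simp: quat_to_complex_mat_blocks quat_fst_def quat_snd_def qcnj_def complex_eq_iff)

abbreviation J_c :: "nat \<Rightarrow> complex mat" where "J_c m \<equiv> J_mat m"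

lemma J_mat_blocks: "(J_mat m :: 'a::ring_1 mat) = four_block_mat (0\<^sub>m m m) (- 1\<^sub>m m) (1\<^sub>m m) (0\<^sub>m m m)"
  by (simp add: J_mat_def block_antidiag_def)

lemma J_mat_carrier: "J_mat m \<in> carrier_mat (m + m) (m + m)"
  unfolding J_mat_blocks by auto

text \<open>The conjugate-linear map \<open>z \<mapsto> J (cnj z)\<close> is multiplication by the quaternion unit \<open>j\<close> up to the choice of side and
  sign; commuting with it relates the two block columns as in \<open>quat_to_complex_mat\<close>.\<close>

lemma quat_iff_conj_commutes:
  assumes A: "A \<in> carrier_mat (m + m) (m + m)"
  shows "map_mat cnj A * J_c m = J_c m * A \<longleftrightarrow> (\<exists>Q\<in>carrier_mat m m. A = quat_to_complex_mat Q)"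
proof -
  obtain a b c d where A4: "A = four_block_mat a b c d"
    and abcd: "a \<in> carrier_mat m m" "b \<in> carrier_mat m m" "c \<in> carrier_mat m m" "d \<in> carrier_mat m m"
    using square_four_blocks[OF A] .
  have 0: "map_mat cnj A = four_block_mat (map_mat cnj a) (map_mat cnj b) (map_mat cnj c) (map_mat cnj d)"
    unfolding A4 by (rule map_four_block_mat[OF abcd])
  have 1: "map_mat cnj A * J_c m = four_block_mat (map_mat cnj b) (- map_mat cnj a) (map_mat cnj d) (- map_mat cnj c)"
    unfolding 0 J_mat_blocks by (subst mult_four_block_mat[of _ m m _ m _ m _ _ m _ m])
      (use abcd in \<open>auto intro!: cong_four_block_mat eq_matI\<close>)
  have 2: "J_c m * A = four_block_mat (- c) (- d) a b"
    unfolding A4 J_mat_blocks by (subst mult_four_block_mat[of _ m m _ m _ m _ _ m _ m])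
      (use abcd in \<open>auto intro!: cong_four_block_mat eq_matI\<close>)
  show ?thesis
  proof
    assume "map_mat cnj A * J_c m = J_c m * A"
    then have "four_block_mat (map_mat cnj b) (- map_mat cnj a) (map_mat cnj d) (- map_mat cnj c) = four_block_mat (- c) (- d) a b"
      unfolding 1 2 .
    from four_block_mat_eqD[OF this, of m] abcd have "map_mat cnj b = - c" "- map_mat cnj a = - d" by simp_all
    then have bd: "c = - map_mat cnj b" "d = map_mat cnj a" by simp_all
    let ?Q = "mat m m (\<lambda>ij. Quat (Re (a $$ ij)) (Im (a $$ ij)) (- Re (b $$ ij)) (- Im (b $$ ij)))"
    have "quat_fst ?Q = a" "quat_snd ?Q = - b"
      using abcd by (auto intro!: eq_matI simp: quat_fst_def quat_snd_def complex_eq_iff)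
    then have "A = quat_to_complex_mat ?Q"
      unfolding A4 quat_to_complex_mat_blocks bd using abcd by (auto intro!: cong_four_block_mat eq_matI)
    then show "\<exists>Q\<in>carrier_mat m m. A = quat_to_complex_mat Q" by (intro bexI[of _ ?Q]) auto
  next
    assume "\<exists>Q\<in>carrier_mat m m. A = quat_to_complex_mat Q"
    then obtain Q where Q: "Q \<in> carrier_mat m m" "A = quat_to_complex_mat Q" by blast
    note c = quat_fst_snd_carrier[OF Q(1)]
    have "four_block_mat a b c d = four_block_mat (quat_fst Q) (- quat_snd Q) (map_mat cnj (quat_snd Q)) (map_mat cnj (quat_fst Q))"
      using Q(2) unfolding A4 quat_to_complex_mat_blocks .
    from four_block_mat_eqD[OF this, of m] abcd c
    have "a = quat_fst Q" "b = - quat_snd Q" "c = map_mat cnj (quat_snd Q)" "d = map_mat cnj (quat_fst Q)" by simp_all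
    then show "map_mat cnj A * J_c m = J_c m * A" unfolding 1 2 using c by (auto intro!: cong_four_block_mat eq_matI)
  qed
qed

lemma GL_quat_to_complex_iff:
  assumes Q: "Q \<in> carrier_mat m m"
  shows "quat_to_complex_mat Q \<in> carrier (GL TYPE(complex) (m + m)) \<longleftrightarrow> Q \<in> carrier (GL TYPE(quat) m)"
proof
  assume "Q \<in> carrier (GL TYPE(quat) m)"
  then obtain R where "R \<in> carrier_mat m m" "R * Q = 1\<^sub>m m" "Q * R = 1\<^sub>m m" unfolding GL_iff by blast
  then show "quat_to_complex_mat Q \<in> carrier (GL TYPE(complex) (m + m))"
    unfolding GL_iff using Q quat_to_complex_mat_mult quat_to_complex_mat_one quat_to_complex_mat_carrier by metis
next
  let ?A = "quat_to_complex_mat Q"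
  have A: "?A \<in> carrier_mat (m + m) (m + m)" using quat_to_complex_mat_carrier[OF Q] .
  assume "?A \<in> carrier (GL TYPE(complex) (m + m))"
  then obtain B where B: "B \<in> carrier_mat (m + m) (m + m)" "B * ?A = 1\<^sub>m (m + m)" "?A * B = 1\<^sub>m (m + m)"
    unfolding GL_iff by blast
  let ?A' = "map_mat cnj ?A" and ?B' = "map_mat cnj B"
  have A': "?A' \<in> carrier_mat (m + m) (m + m)" and B': "?B' \<in> carrier_mat (m + m) (m + m)" using A B by simp_all
  have J: "J_c m \<in> carrier_mat (m + m) (m + m)" by (rule J_mat_carrier)
  have one: "map_mat cnj (1\<^sub>m (m + m)) = 1\<^sub>m (m + m)" by (auto intro!: eq_matI)
  have A'B': "?B' * ?A' = 1\<^sub>m (m + m)" "?A' * ?B' = 1\<^sub>m (m + m)"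
    unfolding map_mat_cnj_mult[OF A B(1), symmetric] map_mat_cnj_mult[OF B(1) A, symmetric] B(2,3) one by simp_all
  have comm: "?A' * J_c m = J_c m * ?A" using quat_iff_conj_commutes[OF A] Q by blast
  note ass = assoc_mult_mat[of _ "m + m" "m + m" _ "m + m" _ "m + m"]
  have "?A' * (?B' * J_c m) = (?A' * ?B') * J_c m" using A' B' J by (simp add: ass)
  also have "\<dots> = J_c m * (?A * B)" unfolding A'B' B(3) using J by (simp add: left_mult_one_mat[OF J] right_mult_one_mat[OF J])
  also have "\<dots> = (J_c m * ?A) * B" using A B(1) J by (simp add: ass)
  also have "\<dots> = ?A' * (J_c m * B)" unfolding comm[symmetric] using A' B(1) J by (simp add: ass)
  finally have "?B' * J_c m = J_c m * B"
    using mat_cancel_left[OF B' A' A'B'(1) mult_carrier_mat[OF B' J] mult_carrier_mat[OF J B(1)]] by simp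
  then obtain R where R: "R \<in> carrier_mat m m" "B = quat_to_complex_mat R"
    using quat_iff_conj_commutes[OF B(1)] by blast
  have "quat_to_complex_mat (R * Q) = quat_to_complex_mat (1\<^sub>m m)" "quat_to_complex_mat (Q * R) = quat_to_complex_mat (1\<^sub>m m)"
    using B(2,3) unfolding R(2) quat_to_complex_mat_one quat_to_complex_mat_mult[OF Q R(1)] quat_to_complex_mat_mult[OF R(1) Q] by simp_all
  then have "R * Q = 1\<^sub>m m" "Q * R = 1\<^sub>m m"
    using quat_to_complex_mat_inj[OF mult_carrier_mat[OF R(1) Q] one_carrier_mat]
      quat_to_complex_mat_inj[OF mult_carrier_mat[OF Q R(1)] one_carrier_mat] by simp_all
  then show "Q \<in> carrier (GL TYPE(quat) m)" unfolding GL_iff using Q R(1) by blast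
qed

lemma quat_isometry_iff:
  assumes Q: "Q \<in> carrier_mat m m" and F: "F \<in> carrier_mat m m"
  shows "transpose_mat (map_mat cnj (quat_to_complex_mat Q)) * quat_to_complex_mat F * quat_to_complex_mat Q = quat_to_complex_mat F
     \<longleftrightarrow> transpose_mat (map_mat qcnj Q) * F * Q = F"
proof -
  have H: "transpose_mat (map_mat qcnj Q) \<in> carrier_mat m m" using Q by simp
  have HF: "transpose_mat (map_mat qcnj Q) * F \<in> carrier_mat m m" using mult_carrier_mat[OF H F] .
  have "quat_to_complex_mat (transpose_mat (map_mat qcnj Q) * F * Q)
     = transpose_mat (map_mat cnj (quat_to_complex_mat Q)) * quat_to_complex_mat F * quat_to_complex_mat Q"
    unfolding quat_to_complex_mat_mult[OF HF Q] quat_to_complex_mat_mult[OF H F] quat_to_complex_mat_adjoint[OF Q] ..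
  moreover have "transpose_mat (map_mat qcnj Q) * F * Q \<in> carrier_mat m m" using mult_carrier_mat[OF HF Q] .
  ultimately show ?thesis using quat_to_complex_mat_inj[OF _ F] by metis
qed

text \<open>Taking transposes, \<open>A\<close> commutes with the conjugate-linear map given by \<open>J\<close> iff \<open>A\<^sup>T J = J A\<^sup>*\<close>. Multiplying by the
  invertible \<open>H A\<close> on the right and using \<open>A\<^sup>* H A = H\<close> turns this into \<open>A\<^sup>T (J H) A = J H\<close>.\<close>

lemma conj_commutes_iff_bilinear:
  assumes A: "A \<in> carrier_mat (m + m) (m + m)" and H: "H \<in> carrier_mat (m + m) (m + m)"
    and R: "R \<in> carrier_mat (m + m) (m + m)" "(H * A) * R = 1\<^sub>m (m + m)"
    and iso: "transpose_mat (map_mat cnj A) * H * A = H"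
  shows "map_mat cnj A * J_c m = J_c m * A \<longleftrightarrow> transpose_mat A * (J_c m * H) * A = J_c m * H"
proof -
  let ?A' = "map_mat cnj A" and ?J = "J_c m"
  have J: "?J \<in> carrier_mat (m + m) (m + m)" by (rule J_mat_carrier)
  have A': "?A' \<in> carrier_mat (m + m) (m + m)" using A by simp
  have tA: "transpose_mat A \<in> carrier_mat (m + m) (m + m)" "transpose_mat ?A' \<in> carrier_mat (m + m) (m + m)" using A by simp_all
  have HA: "H * A \<in> carrier_mat (m + m) (m + m)" using mult_carrier_mat[OF H A] .
  have AJ: "transpose_mat A * ?J \<in> carrier_mat (m + m) (m + m)" "?J * transpose_mat ?A' \<in> carrier_mat (m + m) (m + m)"
    using mult_carrier_mat[OF tA(1) J] mult_carrier_mat[OF J tA(2)] .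
  note ass = assoc_mult_mat[of _ "m + m" "m + m" _ "m + m" _ "m + m"]
  have tJ: "transpose_mat ?J = - ?J"
    unfolding J_mat_blocks by (auto intro!: eq_matI)
  have t: "transpose_mat (?A' * ?J) = - (?J * transpose_mat ?A')" "transpose_mat (?J * A) = - (transpose_mat A * ?J)"
    unfolding transpose_mult[OF A' J] transpose_mult[OF J A] tJ
    using tA J by (simp_all add: carrier_matD)
  have "?A' * ?J = ?J * A \<longleftrightarrow> transpose_mat A * ?J = ?J * transpose_mat ?A'"
    using t transpose_mat_eq[of "?A' * ?J" "?J * A"] uminus_eq_mat by metis
  also have "\<dots> \<longleftrightarrow> transpose_mat A * ?J * (H * A) = ?J * transpose_mat ?A' * (H * A)"
  proof
    assume "transpose_mat A * ?J * (H * A) = ?J * transpose_mat ?A' * (H * A)"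
    then have "transpose_mat A * ?J * (H * A) * R = ?J * transpose_mat ?A' * (H * A) * R" by simp
    then have "transpose_mat A * ?J * ((H * A) * R) = ?J * transpose_mat ?A' * ((H * A) * R)"
      using assoc_mult_mat[OF AJ(1) HA R(1)] assoc_mult_mat[OF AJ(2) HA R(1)] by simp
    then show "transpose_mat A * ?J = ?J * transpose_mat ?A'"
      unfolding R(2) using right_mult_one_mat[OF AJ(1)] right_mult_one_mat[OF AJ(2)] by simp
  qed simp
  also have "transpose_mat A * ?J * (H * A) = transpose_mat A * (?J * H) * A"
    using tA J H A by (simp add: ass)
  also have "?J * transpose_mat ?A' * (H * A) = ?J * (transpose_mat ?A' * H * A)"
    using tA J H A by (simp add: ass)
  also have "\<dots> = ?J * H" unfolding iso ..
  finally show ?thesis .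
qed

section \<open>Intersections of isometry groups\<close>

text \<open>\<open>A\<^sup>T F (X A) = F X = (A\<^sup>T F A) X = A\<^sup>T F (A X)\<close>, and \<open>A\<^sup>T F\<close> can be cancelled.\<close>

lemma isometry_commutes:
  fixes A F X :: "'a::comm_ring_1 mat"
  assumes A: "A \<in> carrier (GL TYPE('a) n)" and F: "F \<in> carrier_mat n n" and X: "X \<in> carrier_mat n n"
    and L: "L \<in> carrier_mat n n" "L * F = 1\<^sub>m n"
    and iso: "transpose_mat A * F * A = F" "transpose_mat A * (F * X) * A = F * X"
  shows "A * X = X * A"
proof -
  obtain B where Ac: "A \<in> carrier_mat n n" and B: "B \<in> carrier_mat n n" "A * B = 1\<^sub>m n"
    using A unfolding GL_iff by blast
  have tB: "transpose_mat B \<in> carrier_mat n n" and tA: "transpose_mat A \<in> carrier_mat n n" using Ac B by simp_all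
  have BA: "transpose_mat B * transpose_mat A = 1\<^sub>m n"
    unfolding transpose_mult[OF Ac B(1), symmetric] B(2) by simp
  have FXA: "F * (X * A) \<in> carrier_mat n n" "F * (A * X) \<in> carrier_mat n n"
    using mult_carrier_mat[OF F mult_carrier_mat[OF X Ac]] mult_carrier_mat[OF F mult_carrier_mat[OF Ac X]] .
  note ass = assoc_mult_mat[of _ n n _ n _ n]
  have "transpose_mat A * (F * (X * A)) = transpose_mat A * (F * X) * A" using tA F X Ac by (simp add: ass)
  also have "\<dots> = (transpose_mat A * F * A) * X" unfolding iso ..
  also have "\<dots> = transpose_mat A * (F * (A * X))" using tA F X Ac by (simp add: ass)
  finally have "F * (X * A) = F * (A * X)" by (rule mat_cancel_left[OF tB tA BA FXA])
  then have "X * A = A * X" by (rule mat_cancel_left[OF L(1) F L(2) mult_carrier_mat[OF X Ac] mult_carrier_mat[OF Ac X]])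
  then show ?thesis ..
qed

lemma bilinear_isometries_iff:
  "A \<in> bilinear_isometries m F \<longleftrightarrow> A \<in> carrier (GL TYPE('a::comm_ring_1) m) \<and> transpose_mat A * F * A = F"
  by (simp add: bilinear_isometries_def)

lemma sesquilinear_isometries_iff:
  "A \<in> sesquilinear_isometries \<sigma> m F \<longleftrightarrow> A \<in> carrier (GL TYPE('a::ring_1) m) \<and> transpose_mat (map_mat \<sigma> A) * F * A = F"
  by (simp add: sesquilinear_isometries_def)

lemma bilinear_isometries_smult:
  fixes F :: "'a::field mat"
  assumes F: "F \<in> carrier_mat m m" and c: "c \<noteq> 0"
  shows "bilinear_isometries m (c \<cdot>\<^sub>m F) = bilinear_isometries m F"
proof -
  have "transpose_mat A * (c \<cdot>\<^sub>m F) * A = c \<cdot>\<^sub>m F \<longleftrightarrow> transpose_mat A * F * A = F"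
    if A: "A \<in> carrier_mat m m" for A
  proof -
    have tA: "transpose_mat A \<in> carrier_mat m m" using A by simp
    have "transpose_mat A * (c \<cdot>\<^sub>m F) * A = c \<cdot>\<^sub>m (transpose_mat A * F * A)"
      unfolding mult_smult_distrib[OF tA F] mult_smult_assoc_mat[OF mult_carrier_mat[OF tA F] A] ..
    moreover have "X = Y" if "c \<cdot>\<^sub>m X = c \<cdot>\<^sub>m Y" "X \<in> carrier_mat m m" "Y \<in> carrier_mat m m" for X Y :: "'a mat"
    proof (rule eq_matI)
      fix i j assume "i < dim_row Y" "j < dim_col Y"
      then have "(c \<cdot>\<^sub>m X) $$ (i, j) = c * X $$ (i, j)" "(c \<cdot>\<^sub>m Y) $$ (i, j) = c * Y $$ (i, j)" using that(2,3) by auto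
      then show "X $$ (i, j) = Y $$ (i, j)" unfolding that(1) using c by simp
    qed (use that(2,3) in auto)
    ultimately show ?thesis using F mult_carrier_mat[OF mult_carrier_mat[OF tA F] A] by metis
  qed
  then show ?thesis unfolding bilinear_isometries_def GL_iff by blast
qed

lemma complex_bilinear_isometries:
  assumes F: "F \<in> carrier_mat m m"
  shows "complex_to_real_mat ` bilinear_isometries m F
     = bilinear_isometries (m + m) (conj_sign m * complex_to_real_mat F) \<inter> GL_complex_in_real m"
proof (intro equalityI subsetI)
  fix A assume "A \<in> complex_to_real_mat ` bilinear_isometries m F"
  then obtain C where C: "A = complex_to_real_mat C" "C \<in> carrier (GL TYPE(complex) m)" "transpose_mat C * F * C = F"
    by (auto simp: bilinear_isometries_iff)
  have Cc: "C \<in> carrier_mat m m" using C(2) unfolding GL_iff by blast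
  show "A \<in> bilinear_isometries (m + m) (conj_sign m * complex_to_real_mat F) \<inter> GL_complex_in_real m"
    using C GL_complex_to_real_iff[OF Cc] bilinear_isometry_iff[OF Cc F]
    by (auto simp: bilinear_isometries_iff GL_complex_in_real_def)
next
  fix A assume A: "A \<in> bilinear_isometries (m + m) (conj_sign m * complex_to_real_mat F) \<inter> GL_complex_in_real m"
  then obtain C where C: "A = complex_to_real_mat C" "C \<in> carrier (GL TYPE(complex) m)"
    by (auto simp: GL_complex_in_real_def)
  have Cc: "C \<in> carrier_mat m m" using C(2) unfolding GL_iff by blast
  have "C \<in> bilinear_isometries m F"
    using A C(2) bilinear_isometry_iff[OF Cc F] unfolding C(1) by (simp add: bilinear_isometries_iff)
  then show "A \<in> complex_to_real_mat ` bilinear_isometries m F" using C(1) by blast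
qed

lemma commutes_real_i_GL:
  assumes "A \<in> carrier (GL TYPE(real) (m + m))" "A * real_i m = real_i m * A"
  shows "A \<in> GL_complex_in_real m"
proof -
  have A: "A \<in> carrier_mat (m + m) (m + m)" using assms(1) unfolding GL_iff by blast
  obtain C where C: "C \<in> carrier_mat m m" "A = complex_to_real_mat C"
    using commutes_real_i_imp_complex[OF A assms(2)] .
  then show ?thesis using GL_complex_to_real_iff[OF C(1)] assms(1) unfolding GL_complex_in_real_def by blast
qed

text \<open>The two real forms are the real and imaginary part of the Hermitian form up to sign. Together they
  force an isometry to commute with \<open>i\<close>.\<close>

lemma hermitian_isometries:
  assumes F: "F \<in> carrier_mat m m" and L: "L \<in> carrier_mat m m" "L * F = 1\<^sub>m m"
  shows "complex_to_real_mat ` sesquilinear_isometries cnj m F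
     = bilinear_isometries (m + m) (complex_to_real_mat F) \<inter> bilinear_isometries (m + m) (complex_to_real_mat F * real_i m)"
proof (intro equalityI subsetI)
  note cF = complex_to_real_mat_carrier[OF F]
  fix A assume "A \<in> complex_to_real_mat ` sesquilinear_isometries cnj m F"
  then obtain C where C: "A = complex_to_real_mat C" "C \<in> carrier (GL TYPE(complex) m)" "transpose_mat (map_mat cnj C) * F * C = F"
    by (auto simp: sesquilinear_isometries_iff)
  have Cc: "C \<in> carrier_mat m m" using C(2) unfolding GL_iff by blast
  have A: "A \<in> carrier_mat (m + m) (m + m)" and tA: "transpose_mat A \<in> carrier_mat (m + m) (m + m)"
    using complex_to_real_mat_carrier[OF Cc] unfolding C(1) by simp_all
  have 1: "A \<in> carrier (GL TYPE(real) (m + m))" "transpose_mat A * complex_to_real_mat F * A = complex_to_real_mat F"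
    using GL_complex_to_real_iff[OF Cc] hermitian_isometry_iff[OF Cc F] C by simp_all
  have "transpose_mat A * (complex_to_real_mat F * real_i m) * A = transpose_mat A * complex_to_real_mat F * (real_i m * A)"
    using tA A cF by (simp add: assoc_mult_mat[of _ "m + m" "m + m" _ "m + m" _ "m + m"])
  also have "\<dots> = (transpose_mat A * complex_to_real_mat F * A) * real_i m"
    unfolding C(1) complex_to_real_mat_commutes[OF Cc, symmetric] unfolding C(1)[symmetric]
    using tA A cF by (simp add: assoc_mult_mat[of _ "m + m" "m + m" _ "m + m" _ "m + m"])
  finally show "A \<in> bilinear_isometries (m + m) (complex_to_real_mat F) \<inter> bilinear_isometries (m + m) (complex_to_real_mat F * real_i m)"
    using 1 by (simp add: bilinear_isometries_iff)
next
  fix A assume A: "A \<in> bilinear_isometries (m + m) (complex_to_real_mat F) \<inter> bilinear_isometries (m + m) (complex_to_real_mat F * real_i m)"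
  then have A1: "A \<in> carrier (GL TYPE(real) (m + m))" "transpose_mat A * complex_to_real_mat F * A = complex_to_real_mat F"
    "transpose_mat A * (complex_to_real_mat F * real_i m) * A = complex_to_real_mat F * real_i m"
    by (simp_all add: bilinear_isometries_iff)
  have "A * real_i m = real_i m * A"
  proof (rule isometry_commutes[OF A1(1) _ _ _ _ A1(2,3)])
    show "complex_to_real_mat L * complex_to_real_mat F = 1\<^sub>m (m + m)"
      unfolding complex_to_real_mat_mult[OF L(1) F, symmetric] L(2) complex_to_real_mat_one ..
  qed (use F L in simp_all)
  then obtain C where C: "A = complex_to_real_mat C" "C \<in> carrier (GL TYPE(complex) m)"
    using commutes_real_i_GL[OF A1(1)] by (auto simp: GL_complex_in_real_def)
  have Cc: "C \<in> carrier_mat m m" using C(2) unfolding GL_iff by blast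
  have "C \<in> sesquilinear_isometries cnj m F"
    using C(2) A1(2) hermitian_isometry_iff[OF Cc F] unfolding C(1) by (simp add: sesquilinear_isometries_iff)
  then show "A \<in> complex_to_real_mat ` sesquilinear_isometries cnj m F" using C(1) by blast
qed

lemma quaternion_isometries:
  assumes F: "F \<in> carrier_mat m m" and L: "L \<in> carrier_mat m m" "F * L = 1\<^sub>m m"
  shows "quat_to_complex_mat ` sesquilinear_isometries qcnj m F
     = sesquilinear_isometries cnj (m + m) (quat_to_complex_mat F)
       \<inter> bilinear_isometries (m + m) (J_c m * quat_to_complex_mat F)"
proof -
  note cF = quat_to_complex_mat_carrier[OF F] and cL = quat_to_complex_mat_carrier[OF L(1)]
  have FL: "quat_to_complex_mat F * quat_to_complex_mat L = 1\<^sub>m (m + m)"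
    unfolding quat_to_complex_mat_mult[OF F L(1), symmetric] L(2) quat_to_complex_mat_one ..
  have key: "(\<exists>Q\<in>carrier_mat m m. A = quat_to_complex_mat Q) \<longleftrightarrow>
     transpose_mat A * (J_c m * quat_to_complex_mat F) * A = J_c m * quat_to_complex_mat F"
    if A: "A \<in> carrier (GL TYPE(complex) (m + m))"
      and iso: "transpose_mat (map_mat cnj A) * quat_to_complex_mat F * A = quat_to_complex_mat F" for A
  proof -
    obtain B where Ac: "A \<in> carrier_mat (m + m) (m + m)" and B: "B \<in> carrier_mat (m + m) (m + m)" "A * B = 1\<^sub>m (m + m)"
      using A unfolding GL_iff by blast
    have "(quat_to_complex_mat F * A) * (B * quat_to_complex_mat L) = quat_to_complex_mat F * ((A * B) * quat_to_complex_mat L)"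
      using cF Ac B(1) cL by (simp add: assoc_mult_mat[of _ "m + m" "m + m" _ "m + m" _ "m + m"])
    also have "\<dots> = 1\<^sub>m (m + m)" unfolding B(2) left_mult_one_mat[OF cL] FL ..
    finally show ?thesis
      using conj_commutes_iff_bilinear[OF Ac cF mult_carrier_mat[OF B(1) cL] _ iso] quat_iff_conj_commutes[OF Ac] by simp
  qed
  show ?thesis
  proof (intro equalityI subsetI)
    fix A assume "A \<in> quat_to_complex_mat ` sesquilinear_isometries qcnj m F"
    then obtain Q where Q: "A = quat_to_complex_mat Q" "Q \<in> carrier (GL TYPE(quat) m)" "transpose_mat (map_mat qcnj Q) * F * Q = F"
      by (auto simp: sesquilinear_isometries_iff)
    have Qc: "Q \<in> carrier_mat m m" using Q(2) unfolding GL_iff by blast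
    have A: "A \<in> carrier (GL TYPE(complex) (m + m))" "transpose_mat (map_mat cnj A) * quat_to_complex_mat F * A = quat_to_complex_mat F"
      using GL_quat_to_complex_iff[OF Qc] quat_isometry_iff[OF Qc F] Q by simp_all
    have "\<exists>Q\<in>carrier_mat m m. A = quat_to_complex_mat Q" using Q(1) Qc by blast
    then show "A \<in> sesquilinear_isometries cnj (m + m) (quat_to_complex_mat F)
       \<inter> bilinear_isometries (m + m) (J_c m * quat_to_complex_mat F)"
      using A key[OF A] by (simp add: sesquilinear_isometries_iff bilinear_isometries_iff)
  next
    fix A assume "A \<in> sesquilinear_isometries cnj (m + m) (quat_to_complex_mat F)
       \<inter> bilinear_isometries (m + m) (J_c m * quat_to_complex_mat F)"
    then have A: "A \<in> carrier (GL TYPE(complex) (m + m))" "transpose_mat (map_mat cnj A) * quat_to_complex_mat F * A = quat_to_complex_mat F"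
      "transpose_mat A * (J_c m * quat_to_complex_mat F) * A = J_c m * quat_to_complex_mat F"
      by (simp_all add: sesquilinear_isometries_iff bilinear_isometries_iff)
    obtain Q where Q: "Q \<in> carrier_mat m m" "A = quat_to_complex_mat Q" using key[OF A(1,2)] A(3) by blast
    have "Q \<in> sesquilinear_isometries qcnj m F"
      using A(1,2) GL_quat_to_complex_iff[OF Q(1)] quat_isometry_iff[OF Q(1) F] unfolding Q(2)
      by (simp add: sesquilinear_isometries_iff)
    then show "A \<in> quat_to_complex_mat ` sesquilinear_isometries qcnj m F" using Q(2) by blast
  qed
qed

lemma sig_mat_carrier [simp]: "sig_mat r s \<in> carrier_mat (r + s) (r + s)"
  by (auto simp: sig_mat_def block_diag_def)

lemma sig_mat_index:
  "i < r + s \<Longrightarrow> j < r + s \<Longrightarrow> sig_mat r s $$ (i, j) = (if i = j then if i < r then - 1 else 1 else 0)"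
  by (auto simp: sig_mat_def block_diag_def)

lemma sig_mat_dim [simp]: "dim_row (sig_mat r s) = r + s" "dim_col (sig_mat r s) = r + s"
  by (auto simp: sig_mat_def block_diag_def)

lemma sig_mat_square: "sig_mat r s * sig_mat r s = (1\<^sub>m (r + s) :: 'a::ring_1 mat)"
proof -
  have e: "sig_mat r s = four_block_mat (- 1\<^sub>m r) (0\<^sub>m r s) (0\<^sub>m s r) (1\<^sub>m s :: 'a mat)"
    by (auto simp: sig_mat_def block_diag_def)
  have "- 1\<^sub>m r * - 1\<^sub>m r = (1\<^sub>m r :: 'a mat)" by simp
  then show ?thesis
    unfolding e by (subst mult_four_block_mat[of _ r r _ s _ s _ _ r _ s]) (auto intro!: eq_matI)
qed

lemma conj_sign_complex_one: "conj_sign m * complex_to_real_mat (1\<^sub>m m) = block_diag (1\<^sub>m m) (- 1\<^sub>m m)"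
  unfolding complex_to_real_mat_one right_mult_one_mat[OF conj_sign_carrier] by (simp add: conj_sign_def)

lemma conj_sign_complex_J:
  "conj_sign (m + m) * complex_to_real_mat (J_mat m) = block_diag (J_mat m) (- J_mat m)"
proof -
  have "map_mat Re (J_c m) = J_mat m" "map_mat Im (J_c m) = 0\<^sub>m (m + m) (m + m)"
    by (auto intro!: eq_matI simp: J_mat_blocks)
  then show ?thesis
    unfolding complex_to_real_mat_def using J_mat_carrier[of m, where ?'a = real]
    by (subst conj_sign_mult) (auto simp: block_diag_def intro!: cong_four_block_mat eq_matI)
qed

lemma complex_sig_mat: "complex_to_real_mat (sig_mat r s) = block_diag (sig_mat r s) (sig_mat r s)"
proof -
  have "map_mat Re (sig_mat r s) = sig_mat r s" "map_mat Im (sig_mat r s) = 0\<^sub>m (r + s) (r + s)"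
    by (rule eq_matI; simp add: sig_mat_index)+
  moreover have "- 0\<^sub>m (r + s) (r + s) = (0\<^sub>m (r + s) (r + s) :: real mat)" by auto
  ultimately show ?thesis unfolding complex_to_real_mat_def block_diag_def by simp
qed

lemma complex_sig_mat_i: 
  "block_antidiag (sig_mat r s) (- sig_mat r s) = (-1) \<cdot>\<^sub>m (complex_to_real_mat (sig_mat r s) * real_i (r + s))"
proof -
  have "complex_to_real_mat (sig_mat r s) * real_i (r + s)
      = four_block_mat (0\<^sub>m (r + s) (r + s)) (- sig_mat r s) (sig_mat r s) (0\<^sub>m (r + s) (r + s))"
    unfolding complex_sig_mat block_diag_def real_i_def
    by (subst mult_four_block_mat[of _ "r + s" "r + s" _ "r + s" _ "r + s" _ _ "r + s" _ "r + s"]) (auto intro!: cong_four_block_mat eq_matI)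
  then show ?thesis by (auto simp: block_antidiag_def intro!: eq_matI)
qed

lemma quat_sig_mat: "quat_to_complex_mat (sig_mat r s) = block_diag (sig_mat r s) (sig_mat r s)"
proof -
  have "quat_fst (sig_mat r s) = sig_mat r s" "quat_snd (sig_mat r s) = 0\<^sub>m (r + s) (r + s)"
    unfolding quat_fst_def quat_snd_def
    by (rule eq_matI; simp add: sig_mat_index one_quat_def zero_quat_def uminus_quat_def complex_eq_iff)+
  moreover have "map_mat cnj (sig_mat r s) = sig_mat r s"
    "map_mat cnj (0\<^sub>m (r + s) (r + s)) = 0\<^sub>m (r + s) (r + s)"
    "- 0\<^sub>m (r + s) (r + s) = (0\<^sub>m (r + s) (r + s) :: complex mat)"
    by (rule eq_matI; simp add: sig_mat_index)+
  ultimately show ?thesis unfolding quat_to_complex_mat_blocks block_diag_def by simp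
qed

lemma J_quat_sig_mat:
  "J_c (r + s) * quat_to_complex_mat (sig_mat r s) = block_antidiag (- sig_mat r s) (sig_mat r s)"
  unfolding quat_sig_mat block_diag_def J_mat_blocks
  by (subst mult_four_block_mat[of _ "r + s" "r + s" _ "r + s" _ "r + s" _ _ "r + s" _ "r + s"])
    (auto simp: block_antidiag_def intro!: cong_four_block_mat eq_matI)

lemma quat_i_mat: "quat_to_complex_mat (quat_i \<cdot>\<^sub>m 1\<^sub>m m) = block_diag (\<i> \<cdot>\<^sub>m 1\<^sub>m m) (- (\<i> \<cdot>\<^sub>m 1\<^sub>m m))"
  by (intro eq_matI) (auto simp: quat_to_complex_mat_blocks quat_fst_def quat_snd_def block_diag_def
     one_quat_def zero_quat_def quat_i_def times_quat_def complex_eq_iff)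

lemma J_quat_i_mat:
  "J_c m * quat_to_complex_mat (quat_i \<cdot>\<^sub>m 1\<^sub>m m) = \<i> \<cdot>\<^sub>m block_antidiag (1\<^sub>m m) (1\<^sub>m m)"
  unfolding quat_i_mat block_diag_def J_mat_blocks
  by (subst mult_four_block_mat[of _ m m _ m _ m _ _ m _ m])
    (auto simp: block_antidiag_def intro!: cong_four_block_mat eq_matI)

lemma O_complex_image:
  "complex_to_real_mat ` O_complex m = O_split_realized (2 * m) \<inter> GL_complex_in_real m"
  unfolding O_complex_def O_split_realized_def complex_bilinear_isometries[OF one_carrier_mat] conj_sign_complex_one
  by (simp add: mult_2)

lemma Sp_complex_image:
  "complex_to_real_mat ` Sp_complex m = Sp_real_realized (4 * m) \<inter> GL_complex_in_real (2 * m)"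
proof -
  have e: "4 * m = m + m + (m + m)" "2 * m = m + m" by simp_all
  have "4 * m div 4 = m" by simp
  then show ?thesis
    unfolding Sp_complex_def Sp_real_realized_def
    using complex_bilinear_isometries[OF J_mat_carrier[of m]] unfolding conj_sign_complex_J e by simp
qed

lemma U_complex_image:
  "complex_to_real_mat ` U_complex r s = O_real_part r s \<inter> Sp_imaginary_part r s"
proof -
  have c: "complex_to_real_mat (sig_mat r s) * real_i (r + s) \<in> carrier_mat (r + s + (r + s)) (r + s + (r + s))"
    by (rule mult_carrier_mat[OF complex_to_real_mat_carrier[OF sig_mat_carrier] real_i_carrier])
  show ?thesis
    unfolding U_complex_def O_real_part_def Sp_imaginary_part_def mult_2
      hermitian_isometries[OF sig_mat_carrier sig_mat_carrier sig_mat_square]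
      complex_sig_mat[symmetric] complex_sig_mat_i
    by (subst bilinear_isometries_smult[OF c]) simp_all
qed

lemma Sp_quat_image:
  "quat_to_complex_mat ` Sp_quat r s = U_realized r s \<inter> Sp_complex_realized r s"
  unfolding Sp_quat_def U_realized_def Sp_complex_realized_def mult_2
    quaternion_isometries[OF sig_mat_carrier sig_mat_carrier sig_mat_square] quat_sig_mat[symmetric] J_quat_sig_mat ..

lemma quat_i_mat_inverse:
  "(quat_i \<cdot>\<^sub>m 1\<^sub>m m) * ((- quat_i) \<cdot>\<^sub>m 1\<^sub>m m) = 1\<^sub>m m" "((- quat_i) \<cdot>\<^sub>m 1\<^sub>m m) * (quat_i \<cdot>\<^sub>m 1\<^sub>m m) = 1\<^sub>m m"
proof -
  have *: "(x \<cdot>\<^sub>m 1\<^sub>m m) * (y \<cdot>\<^sub>m 1\<^sub>m m) = 1\<^sub>m m" if xy: "x * y = 1" for x y :: quat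
  proof (rule eq_matI)
    fix i j assume "i < dim_row (1\<^sub>m m :: quat mat)" "j < dim_col (1\<^sub>m m :: quat mat)"
    then have ij: "i < m" "j < m" by auto
    have "((x \<cdot>\<^sub>m 1\<^sub>m m) * (y \<cdot>\<^sub>m 1\<^sub>m m)) $$ (i, j)
       = (\<Sum>k<m. (x * (if k = i then 1 else 0)) * (y * (if k = j then 1 else 0)))"
      using ij by (simp add: scalar_prod_def atLeast0LessThan)
    also have "\<dots> = (\<Sum>k<m. if k = i then (if i = j then x * y else 0) else 0)"
      by (rule sum.cong) auto
    also have "\<dots> = 1\<^sub>m m $$ (i, j)" using ij xy by simp
    finally show "((x \<cdot>\<^sub>m 1\<^sub>m m) * (y \<cdot>\<^sub>m 1\<^sub>m m)) $$ (i, j) = 1\<^sub>m m $$ (i, j)" .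
  qed auto
  show "(quat_i \<cdot>\<^sub>m 1\<^sub>m m) * ((- quat_i) \<cdot>\<^sub>m 1\<^sub>m m) = 1\<^sub>m m" "((- quat_i) \<cdot>\<^sub>m 1\<^sub>m m) * (quat_i \<cdot>\<^sub>m 1\<^sub>m m) = 1\<^sub>m m"
    by (rule *; simp add: quat_i_def times_quat_def uminus_quat_def one_quat_def)+
qed

text \<open>Here \<open>J\<close> times the matrix of the skew-Hermitian form is \<open>i\<close> times the symmetric bilinear form, and a
  non-zero scalar factor does not affect isometries.\<close>

lemma O_star_image:
  "quat_to_complex_mat ` O_star m = U_skew_realized m \<inter> O_complex_realized m"
proof -
  note i = quaternion_isometries[OF _ _ quat_i_mat_inverse(1)]
  have c: "block_antidiag (1\<^sub>m m) (1\<^sub>m m) \<in> carrier_mat (m + m) (m + m :: nat)"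
    by (auto simp: block_antidiag_def)
  have "quat_to_complex_mat ` O_star m = sesquilinear_isometries cnj (m + m) (quat_to_complex_mat (quat_i \<cdot>\<^sub>m 1\<^sub>m m))
       \<inter> bilinear_isometries (m + m) (J_c m * quat_to_complex_mat (quat_i \<cdot>\<^sub>m 1\<^sub>m m))"
    unfolding O_star_def by (rule i) simp_all
  also have "\<dots> = U_skew_realized m \<inter> O_complex_realized m"
    unfolding J_quat_i_mat unfolding quat_i_mat U_skew_realized_def O_complex_realized_def mult_2
    by (subst bilinear_isometries_smult[OF c]) simp_all
  finally show ?thesis .
qed

lemma subgrp_iso:
  assumes "f ` S = T" "inj_on f S" "\<And>x y. x \<in> S \<Longrightarrow> y \<in> S \<Longrightarrow> f (x * y) = f x * f y"
  shows "subgrp S m \<cong> subgrp T k"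
proof -
  have "f \<in> iso (subgrp S m) (subgrp T k)"
    using assms by (auto simp: iso_def hom_def bij_betw_def GL_def units_of_def ring_mat_def)
  then show ?thesis by (auto simp: is_iso_def)
qed

lemma complex_subgrp_iso:
  assumes "S \<subseteq> carrier (GL TYPE(complex) m)"
  shows "subgrp S m \<cong> subgrp (complex_to_real_mat ` S) k"
proof (rule subgrp_iso[OF refl])
  have c: "C \<in> carrier_mat m m" if "C \<in> S" for C using assms that unfolding GL_iff[abs_def] GL_iff subset_iff by blast
  show "inj_on complex_to_real_mat S" by (rule inj_onI) (use complex_to_real_mat_inj c in blast)
  show "complex_to_real_mat (C * D) = complex_to_real_mat C * complex_to_real_mat D" if "C \<in> S" "D \<in> S" for C D
    using complex_to_real_mat_mult[OF c[OF that(1)] c[OF that(2)]] .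
qed

lemma quat_subgrp_iso:
  assumes "S \<subseteq> carrier (GL TYPE(quat) m)"
  shows "subgrp S m \<cong> subgrp (quat_to_complex_mat ` S) k"
proof (rule subgrp_iso[OF refl])
  have c: "C \<in> carrier_mat m m" if "C \<in> S" for C using assms that unfolding GL_iff subset_iff by blast
  show "inj_on quat_to_complex_mat S" by (rule inj_onI) (use quat_to_complex_mat_inj c in blast)
  show "quat_to_complex_mat (C * D) = quat_to_complex_mat C * quat_to_complex_mat D" if "C \<in> S" "D \<in> S" for C D
    using quat_to_complex_mat_mult[OF c[OF that(1)] c[OF that(2)]] .
qed

lemma group_isomorphisms:
  shows "2 dvd n \<Longrightarrow> subgrp (O_complex (n div 2)) (n div 2)
          \<cong> subgrp (O_split_realized n \<inter> GL_complex_in_real (n div 2)) n"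
    and "4 dvd n \<Longrightarrow> subgrp (Sp_complex (n div 4)) (n div 2)
          \<cong> subgrp (Sp_real_realized n \<inter> GL_complex_in_real (n div 2)) n"
    and "p + q = n \<and> 2 dvd p \<and> 2 dvd q \<Longrightarrow> subgrp (U_complex (p div 2) (q div 2)) (n div 2)
          \<cong> subgrp (O_real_part (p div 2) (q div 2) \<inter> Sp_imaginary_part (p div 2) (q div 2)) n"
    and "p + q = n \<and> 4 dvd p \<and> 4 dvd q \<Longrightarrow> subgrp (Sp_quat (p div 4) (q div 4)) (n div 4)
          \<cong> subgrp (U_realized (p div 4) (q div 4) \<inter> Sp_complex_realized (p div 4) (q div 4)) (n div 2)"
    and "4 dvd n \<Longrightarrow> subgrp (O_star (n div 4)) (n div 4)
          \<cong> subgrp (U_skew_realized (n div 4) \<inter> O_complex_realized (n div 4)) (n div 2)"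
proof -
  show "subgrp (O_complex (n div 2)) (n div 2) \<cong> subgrp (O_split_realized n \<inter> GL_complex_in_real (n div 2)) n" if "2 dvd n"
  proof -
    have "subgrp (O_complex (n div 2)) (n div 2) \<cong> subgrp (complex_to_real_mat ` O_complex (n div 2)) n"
      by (rule complex_subgrp_iso) (auto simp: O_complex_def bilinear_isometries_def)
    then show ?thesis unfolding O_complex_image using that by simp
  qed
  show "subgrp (Sp_complex (n div 4)) (n div 2) \<cong> subgrp (Sp_real_realized n \<inter> GL_complex_in_real (n div 2)) n" if "4 dvd n"
  proof -
    have 2: "2 * (n div 4) = n div 2" using that by auto
    have "subgrp (Sp_complex (n div 4)) (n div 2) \<cong> subgrp (complex_to_real_mat ` Sp_complex (n div 4)) n"
      by (rule complex_subgrp_iso) (auto simp: Sp_complex_def bilinear_isometries_def 2)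
    then show ?thesis unfolding Sp_complex_image 2 using that by simp
  qed
  show "subgrp (U_complex (p div 2) (q div 2)) (n div 2)
          \<cong> subgrp (O_real_part (p div 2) (q div 2) \<inter> Sp_imaginary_part (p div 2) (q div 2)) n" if "p + q = n \<and> 2 dvd p \<and> 2 dvd q"
  proof -
    have "p div 2 + q div 2 = n div 2" using that by auto
    then show ?thesis unfolding U_complex_image[symmetric]
      by (intro complex_subgrp_iso) (auto simp: U_complex_def sesquilinear_isometries_def)
  qed
  show "subgrp (Sp_quat (p div 4) (q div 4)) (n div 4)
          \<cong> subgrp (U_realized (p div 4) (q div 4) \<inter> Sp_complex_realized (p div 4) (q div 4)) (n div 2)" if "p + q = n \<and> 4 dvd p \<and> 4 dvd q"
  proof -
    have "p div 4 + q div 4 = n div 4" using that by auto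
    then show ?thesis unfolding Sp_quat_image[symmetric]
      by (intro quat_subgrp_iso) (auto simp: Sp_quat_def sesquilinear_isometries_def)
  qed
  show "subgrp (O_star (n div 4)) (n div 4) \<cong> subgrp (U_skew_realized (n div 4) \<inter> O_complex_realized (n div 4)) (n div 2)"
    unfolding O_star_image[symmetric] by (rule quat_subgrp_iso) (auto simp: O_star_def sesquilinear_isometries_def)
qed

section \<open>Standard Gram matrices in block coordinates\<close>

text \<open>The Gram matrix, in the coordinates of \<open>block_columns\<close>, of mutually orthogonal blocks of which block \<open>i\<close> has Gram
  matrix \<open>g i\<close>.\<close>

definition gram_mat :: "nat \<Rightarrow> nat \<Rightarrow> (nat \<Rightarrow> nat \<Rightarrow> nat \<Rightarrow> real) \<Rightarrow> real mat" where
  "gram_mat d m g = mat (d * m) (d * m) (\<lambda>(k, l). if k mod m = l mod m then g (k mod m) (k div m) (l div m) else 0)"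

lemma block_gram:
  assumes n: "n = d * m" and F: "F \<in> carrier_mat n n"
    and u: "\<And>i a. i < m \<Longrightarrow> a < d \<Longrightarrow> u i a \<in> carrier_vec n"
    and orth: "\<And>i j a b. i < m \<Longrightarrow> j < m \<Longrightarrow> i \<noteq> j \<Longrightarrow> a < d \<Longrightarrow> b < d \<Longrightarrow> bform F (u i a) (u j b) = 0"
    and g: "\<And>i a b. i < m \<Longrightarrow> a < d \<Longrightarrow> b < d \<Longrightarrow> bform F (u i a) (u i b) = g i a b"
  shows "transpose_mat (block_columns n d m u) * F * block_columns n d m u = gram_mat d m g"
proof (rule eq_matI)
  let ?M = "block_columns n d m u"
  have M: "?M \<in> carrier_mat n n" unfolding block_columns_def n by simp
  have tM: "transpose_mat ?M \<in> carrier_mat n n" using M by simp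
  fix k l assume "k < dim_row (gram_mat d m g)" "l < dim_col (gram_mat d m g)"
  then have kl: "k < d * m" "l < d * m" by (simp_all add: gram_mat_def)
  have m: "0 < m" using kl by (cases m) auto
  have c: "col ?M k = u (k mod m) (k div m)" if "k < d * m" for k
  proof -
    have "u (k mod m) (k div m) \<in> carrier_vec n" using that m by (intro u) (auto simp: less_mult_imp_div_less)
    then show ?thesis using that by (intro eq_vecI) (auto simp: block_columns_def)
  qed
  have FM: "F * ?M \<in> carrier_mat n n" using F M by simp
  have "(transpose_mat ?M * F * ?M) $$ (k, l) = (transpose_mat ?M * (F * ?M)) $$ (k, l)"
    using assoc_mult_mat[OF tM F M] by simp
  also have "\<dots> = col ?M k \<bullet> col (F * ?M) l"
    using kl FM M n by (subst index_mult_mat(1)) auto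
  also have "col (F * ?M) l = F *\<^sub>v col ?M l" using kl F M n by (intro col_mult2) auto
  finally have "(transpose_mat ?M * F * ?M) $$ (k, l) = bform F (u (k mod m) (k div m)) (u (l mod m) (l div m))"
    unfolding c[OF kl(1)] c[OF kl(2)] bform_def .
  also have "\<dots> = gram_mat d m g $$ (k, l)"
    using kl m orth[of "k mod m" "l mod m" "k div m" "l div m"] g[of "k mod m" "k div m" "l div m"]
    by (auto simp: gram_mat_def less_mult_imp_div_less)
  finally show "(transpose_mat ?M * F * ?M) $$ (k, l) = gram_mat d m g $$ (k, l)" .
qed (auto simp: gram_mat_def block_columns_def)

lemma block_index: "k < d * m \<Longrightarrow> \<exists>a i. k = a * m + i \<and> a < d \<and> i < (m::nat)"
  by (metis div_mult_mod_eq less_mult_imp_div_less mod_less_divisor mult_is_0 neq0_conv not_less_zero)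

lemma gram_mat_eqI:
  assumes X: "X \<in> carrier_mat (d * m) (d * m)"
    and e: "\<And>a b i j. a < d \<Longrightarrow> b < d \<Longrightarrow> i < m \<Longrightarrow> j < m \<Longrightarrow>
      X $$ (a * m + i, b * m + j) = (if i = j then g i a b else 0)"
  shows "gram_mat d m g = X"
proof (rule eq_matI)
  fix k l assume "k < dim_row X" "l < dim_col X"
  then have kl: "k < d * m" "l < d * m" using X by auto
  obtain a i where k: "k = a * m + i" "a < d" "i < m" using block_index[OF kl(1)] by blast
  obtain b j where l: "l = b * m + j" "b < d" "j < m" using block_index[OF kl(2)] by blast
  have "gram_mat d m g $$ (k, l) = (if k mod m = l mod m then g (k mod m) (k div m) (l div m) else 0)"
    using kl by (simp add: gram_mat_def)
  also have "\<dots> = (if i = j then g i a b else 0)" using k l by simp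
  also have "\<dots> = X $$ (k, l)" unfolding k l using e k l by simp
  finally show "gram_mat d m g $$ (k, l) = X $$ (k, l)" .
qed (use X in \<open>auto simp: gram_mat_def\<close>)

lemma less_numeral_cases:
  "(a::nat) < 1 \<longleftrightarrow> a = 0" "a < 2 \<longleftrightarrow> a = 0 \<or> a = 1" "a < 4 \<longleftrightarrow> a = 0 \<or> a = 1 \<or> a = 2 \<or> a = 3"
  by arith+

lemma gram_sig_mat:
  assumes "r \<le> m"
  shows "gram_mat 1 m (\<lambda>i a b. if i < r then -1 else 1) = sig_mat r (m - r)"
  by (rule gram_mat_eqI) (use assms in \<open>auto simp: sig_mat_index intro: carrier_matI\<close>)

definition table2 :: "real \<Rightarrow> real \<Rightarrow> real \<Rightarrow> real \<Rightarrow> nat \<Rightarrow> nat \<Rightarrow> real" where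
  "table2 x00 x01 x10 x11 a b = (if a = 0 then if b = 0 then x00 else x01 else if b = 0 then x10 else x11)"

lemma gram_four_block:
  assumes "\<And>i j. i < m \<Longrightarrow> j < m \<Longrightarrow> A $$ (i, j) = (if i = j then g i 0 0 else 0)" "A \<in> carrier_mat m m"
    "\<And>i j. i < m \<Longrightarrow> j < m \<Longrightarrow> B $$ (i, j) = (if i = j then g i 0 1 else 0)" "B \<in> carrier_mat m m"
    "\<And>i j. i < m \<Longrightarrow> j < m \<Longrightarrow> C $$ (i, j) = (if i = j then g i 1 0 else 0)" "C \<in> carrier_mat m m"
    "\<And>i j. i < m \<Longrightarrow> j < m \<Longrightarrow> D $$ (i, j) = (if i = j then g i 1 1 else 0)" "D \<in> carrier_mat m m"
  shows "gram_mat 2 m g = four_block_mat A B C D"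
proof (rule gram_mat_eqI)
  show "four_block_mat A B C D \<in> carrier_mat (2 * m) (2 * m)" unfolding mult_2 using assms(2,8) by (rule four_block_carrier_mat)
  fix a b i j :: nat assume *: "a < 2" "b < 2" "i < m" "j < m"
  then show "four_block_mat A B C D $$ (a * m + i, b * m + j) = (if i = j then g i a b else 0)"
    using assms unfolding less_numeral_cases(2) by (auto simp: carrier_matD)
qed

text \<open>Tuples of four are handled as pairs of pairs, matching the nesting of the two embeddings.\<close>

lemma gram_mat_split: "gram_mat 4 m g = four_block_mat
   (gram_mat 2 m (\<lambda>i a b. g i a b)) (gram_mat 2 m (\<lambda>i a b. g i a (b + 2)))
   (gram_mat 2 m (\<lambda>i a b. g i (a + 2) b)) (gram_mat 2 m (\<lambda>i a b. g i (a + 2) (b + 2)))"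
    (is "_ = four_block_mat ?A ?B ?C ?D")
proof (rule gram_mat_eqI)
  have c: "gram_mat 2 m g \<in> carrier_mat (2 * m) (2 * m)" for g by (simp add: gram_mat_def)
  show "four_block_mat ?A ?B ?C ?D \<in> carrier_mat (4 * m) (4 * m)"
    using four_block_carrier_mat[OF c c, of _ ?B ?C] by (simp add: algebra_simps)
  have ix: "gram_mat 2 m g $$ (a * m + i, b * m + j) = (if i = j then g i a b else 0)"
    if "a < 2" "b < 2" "i < m" "j < m" for g a b i j
  proof -
    have "a * m + i < 2 * m" "b * m + j < 2 * m" using that unfolding less_numeral_cases(2) by auto
    then show ?thesis using that by (simp add: gram_mat_def)
  qed
  have d: "dim_row (gram_mat 2 m g) = 2 * m" "dim_col (gram_mat 2 m g) = 2 * m" for g by (simp_all add: gram_mat_def)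
  fix a b i j :: nat assume ab: "a < 4" "b < 4" and ij: "i < m" "j < m"
  have lo: "a * m + i < 2 * m" if "a < 2" "i < m" for a i using that unfolding less_numeral_cases(2) by auto
  have hi: "\<not> (a + 2) * m + i < 2 * m" "(a + 2) * m + i - 2 * m = a * m + i" for a i by (auto simp: algebra_simps)
  have hi2: "(a + 2) * m + i < 2 * m + 2 * m" "a * m + i < 2 * m + 2 * m" if "a < 2" "i < m" for a i using lo[OF that] by (auto simp: algebra_simps)
  obtain a' where a': "a' < 2" "a = a' \<or> a = a' + 2" using ab(1) by (metis add_diff_inverse_nat less_diff_conv2 not_less numeral_Bit0 add.commute)
  obtain b' where b': "b' < 2" "b = b' \<or> b = b' + 2" using ab(2) by (metis add_diff_inverse_nat less_diff_conv2 not_less numeral_Bit0 add.commute)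
  show "four_block_mat ?A ?B ?C ?D $$ (a * m + i, b * m + j) = (if i = j then g i a b else 0)"
    using a'(2) b'(2)
    by (elim disjE) (simp_all only: index_mat_four_block d lo hi hi2 ix a' b' ij if_True if_False not_False_eq_True)
qed

lemma gram_block_diag_one:
  "gram_mat 2 m (\<lambda>i. table2 1 0 0 (-1)) = block_diag (1\<^sub>m m) (- 1\<^sub>m m)"
  unfolding block_diag_def by (rule gram_four_block) (auto simp: table2_def)

lemma gram_J:
  "gram_mat 2 m (\<lambda>i. table2 0 (-1) 1 0) = J_mat m"
  unfolding J_mat_blocks by (rule gram_four_block) (auto simp: table2_def)

lemma gram_real_i_forms:
  "gram_mat 2 m (\<lambda>i. table2 0 (-1) (-1) 0) = block_diag (1\<^sub>m m) (- 1\<^sub>m m) * real_i m"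
proof -
  have "block_diag (1\<^sub>m m) (- 1\<^sub>m m) * real_i m = four_block_mat (0\<^sub>m m m) (- 1\<^sub>m m) (- 1\<^sub>m m) (0\<^sub>m m m)"
    unfolding conj_sign_def[symmetric] real_i_def by (subst conj_sign_mult) (auto intro!: cong_four_block_mat eq_matI)
  then show ?thesis by (simp only:) (rule gram_four_block; auto simp: table2_def)
qed

abbreviation (input) sgn_at :: "nat \<Rightarrow> nat \<Rightarrow> real" where "sgn_at r i \<equiv> if i < r then -1 else 1"

lemma gram_sig_diag:
  assumes "r \<le> m"
  shows "gram_mat 2 m (\<lambda>i. table2 (sgn_at r i) 0 0 (sgn_at r i)) = complex_to_real_mat (sig_mat r (m - r))"
  unfolding complex_sig_mat block_diag_def
  by (rule gram_four_block) (use assms in \<open>auto simp: table2_def sig_mat_index intro: carrier_matI\<close>)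

lemma gram_sig_i:
  assumes "r \<le> m"
  shows "gram_mat 2 m (\<lambda>i. table2 0 (- sgn_at r i) (sgn_at r i) 0) = complex_to_real_mat (sig_mat r (m - r)) * real_i m"
proof -
  have S: "sig_mat r (m - r) \<in> carrier_mat m m" using sig_mat_carrier[of r "m - r"] assms by simp
  have "complex_to_real_mat (sig_mat r (m - r)) * real_i m
      = four_block_mat (0\<^sub>m m m) (- sig_mat r (m - r)) (sig_mat r (m - r)) (0\<^sub>m m m)"
    unfolding complex_sig_mat block_diag_def real_i_def using assms
    by (subst mult_four_block_mat[of _ m m _ m _ m _ _ m _ m]) (use S in \<open>auto intro!: cong_four_block_mat eq_matI\<close>)
  then show ?thesis by (simp only:) (rule gram_four_block; use assms S in \<open>auto simp: table2_def sig_mat_index\<close>)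
qed

lemma four_block_real_i:
  assumes "a \<in> carrier_mat m m" "b \<in> carrier_mat m m" "c \<in> carrier_mat m m" "d \<in> carrier_mat m m"
  shows "four_block_mat a b c d * real_i m = four_block_mat b (- a) d (- c)"
  unfolding real_i_def by (subst mult_four_block_mat[of _ m m _ m _ m _ _ m _ m])
    (use assms in \<open>auto intro!: cong_four_block_mat eq_matI\<close>)

definition table4 :: "real list list \<Rightarrow> nat \<Rightarrow> nat \<Rightarrow> real" where
  "table4 t a b = t ! a ! b"

lemma gram4_block:
  assumes "gram_mat 2 m (\<lambda>i a b. g i a b) = A" "gram_mat 2 m (\<lambda>i a b. g i a (b + 2)) = B"
   "gram_mat 2 m (\<lambda>i a b. g i (a + 2) b) = C" "gram_mat 2 m (\<lambda>i a b. g i (a + 2) (b + 2)) = D"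
  shows "gram_mat 4 m g = four_block_mat A B C D"
  unfolding gram_mat_split assms ..

lemma gram2_eqI:
  assumes X: "X \<in> carrier_mat (m + m) (m + m)"
    and "\<And>i j. i < m \<Longrightarrow> j < m \<Longrightarrow> X $$ (i, j) = (if i = j then g i 0 0 else 0)"
    "\<And>i j. i < m \<Longrightarrow> j < m \<Longrightarrow> X $$ (i, m + j) = (if i = j then g i 0 1 else 0)"
    "\<And>i j. i < m \<Longrightarrow> j < m \<Longrightarrow> X $$ (m + i, j) = (if i = j then g i 1 0 else 0)"
    "\<And>i j. i < m \<Longrightarrow> j < m \<Longrightarrow> X $$ (m + i, m + j) = (if i = j then g i 1 1 else 0)"
  shows "gram_mat 2 m g = X"
proof (rule gram_mat_eqI)
  show "X \<in> carrier_mat (2 * m) (2 * m)" using X by (simp add: mult_2)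
  fix a b i j :: nat assume *: "a < 2" "b < 2" "i < m" "j < m"
  then show "X $$ (a * m + i, b * m + j) = (if i = j then g i a b else 0)"
    using assms unfolding less_numeral_cases(2) by auto
qed

lemma complex_to_real_mat_forms:
  assumes Z: "Z \<in> carrier_mat m m"
  shows "complex_to_real_mat Z * real_i m = four_block_mat (- map_mat Im Z) (- map_mat Re Z) (map_mat Re Z) (- map_mat Im Z)"
    "conj_sign m * complex_to_real_mat Z = four_block_mat (map_mat Re Z) (- map_mat Im Z) (- map_mat Im Z) (- map_mat Re Z)"
  unfolding complex_to_real_mat_def using Z by (simp_all add: four_block_real_i conj_sign_mult)

lemma gram_sp_complex:
  "gram_mat 4 m (\<lambda>i. table4 [[0,-1,0,0],[1,0,0,0],[0,0,0,1],[0,0,-1,0]]) = conj_sign (m + m) * complex_to_real_mat (J_c m)"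
  "gram_mat 4 m (\<lambda>i. table4 [[0,0,0,1],[0,0,-1,0],[0,1,0,0],[-1,0,0,0]]) = (conj_sign (m + m) * complex_to_real_mat (J_c m)) * real_i (m + m)"
proof -
  have c: "map_mat Re (J_c m) \<in> carrier_mat (m + m) (m + m)" "map_mat Im (J_c m) \<in> carrier_mat (m + m) (m + m)"
    using J_mat_carrier by simp_all
  show "gram_mat 4 m (\<lambda>i. table4 [[0,-1,0,0],[1,0,0,0],[0,0,0,1],[0,0,-1,0]]) = conj_sign (m + m) * complex_to_real_mat (J_c m)"
    unfolding complex_to_real_mat_forms[OF J_mat_carrier] using c
    by (intro gram4_block gram2_eqI) (auto simp: table4_def J_mat_blocks)
  show "gram_mat 4 m (\<lambda>i. table4 [[0,0,0,1],[0,0,-1,0],[0,1,0,0],[-1,0,0,0]]) = (conj_sign (m + m) * complex_to_real_mat (J_c m)) * real_i (m + m)"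
    unfolding complex_to_real_mat_forms[OF J_mat_carrier] using c
    by (subst four_block_real_i[of _ "m + m"]) (auto intro!: gram4_block gram2_eqI simp: table4_def J_mat_blocks)
qed

lemma gram_quat_sig:
  assumes r: "r \<le> m"
  shows "gram_mat 4 m (\<lambda>i. table4 [[sgn_at r i,0,0,0],[0,sgn_at r i,0,0],[0,0,sgn_at r i,0],[0,0,0,sgn_at r i]])
      = complex_to_real_mat (quat_to_complex_mat (sig_mat r (m - r)))" (is ?A)
    "gram_mat 4 m (\<lambda>i. table4 [[0,0,-sgn_at r i,0],[0,0,0,-sgn_at r i],[sgn_at r i,0,0,0],[0,sgn_at r i,0,0]])
      = complex_to_real_mat (quat_to_complex_mat (sig_mat r (m - r))) * real_i (m + m)" (is ?B)
    "gram_mat 4 m (\<lambda>i. table4 [[0,-sgn_at r i,0,0],[sgn_at r i,0,0,0],[0,0,0,sgn_at r i],[0,0,-sgn_at r i,0]])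
      = conj_sign (m + m) * complex_to_real_mat (J_c m * quat_to_complex_mat (sig_mat r (m - r)))" (is ?C)
proof -
  have m: "r + (m - r) = m" using r by simp
  let ?D = "block_diag (sig_mat r (m - r)) (sig_mat r (m - r)) :: complex mat"
  let ?W = "block_antidiag (- sig_mat r (m - r)) (sig_mat r (m - r)) :: complex mat"
  have D: "?D \<in> carrier_mat (m + m) (m + m)" and W: "?W \<in> carrier_mat (m + m) (m + m)"
    using m by (auto simp: block_diag_def block_antidiag_def intro!: carrier_matI)
  have JW: "J_c m * ?D = ?W" using J_quat_sig_mat[of r "m - r"] unfolding quat_sig_mat m .
  show ?A unfolding quat_sig_mat complex_to_real_mat_def using D m r
    by (intro gram4_block gram2_eqI) (auto simp: table4_def block_diag_def sig_mat_index)
  show ?B unfolding quat_sig_mat complex_to_real_mat_forms[OF D] using D m r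
    by (intro gram4_block gram2_eqI) (auto simp: table4_def block_diag_def sig_mat_index)
  show ?C unfolding quat_sig_mat JW complex_to_real_mat_forms[OF W] using W m r
    by (intro gram4_block gram2_eqI) (auto simp: table4_def block_antidiag_def sig_mat_index)
qed

lemma gram_quat_i:
  "gram_mat 4 m (\<lambda>i. table4 [[0,0,-1,0],[0,0,0,1],[1,0,0,0],[0,-1,0,0]])
      = complex_to_real_mat (quat_to_complex_mat (quat_i \<cdot>\<^sub>m 1\<^sub>m m))" (is ?A)
  "gram_mat 4 m (\<lambda>i. table4 [[-1,0,0,0],[0,1,0,0],[0,0,-1,0],[0,0,0,1]])
      = complex_to_real_mat (quat_to_complex_mat (quat_i \<cdot>\<^sub>m 1\<^sub>m m)) * real_i (m + m)" (is ?B)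
  "gram_mat 4 m (\<lambda>i. table4 [[0,0,0,-1],[0,0,-1,0],[0,-1,0,0],[-1,0,0,0]])
      = conj_sign (m + m) * complex_to_real_mat (J_c m * quat_to_complex_mat (quat_i \<cdot>\<^sub>m 1\<^sub>m m))" (is ?C)
proof -
  let ?D = "block_diag (\<i> \<cdot>\<^sub>m 1\<^sub>m m) (- (\<i> \<cdot>\<^sub>m 1\<^sub>m m))"
  let ?W = "\<i> \<cdot>\<^sub>m block_antidiag (1\<^sub>m m) (1\<^sub>m m)"
  have D: "?D \<in> carrier_mat (m + m) (m + m)" and W: "?W \<in> carrier_mat (m + m) (m + m)"
    by (auto simp: block_diag_def block_antidiag_def intro!: carrier_matI)
  show ?A unfolding quat_i_mat complex_to_real_mat_def using D
    by (intro gram4_block gram2_eqI) (auto simp: table4_def block_diag_def)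
  show ?B unfolding quat_i_mat complex_to_real_mat_forms[OF D] using D
    by (intro gram4_block gram2_eqI) (auto simp: table4_def block_diag_def)
  show ?C unfolding J_quat_i_mat complex_to_real_mat_forms[OF W] using W
    by (intro gram4_block gram2_eqI) (auto simp: table4_def block_antidiag_def)
qed

section \<open>Conjugation into the classical groups: real commutant\<close>

context block_form begin

lemma tied_orth:
  assumes blk: "\<And>i. i < m \<Longrightarrow> Blk (u i)"
    and orth: "\<And>i j a b. i < m \<Longrightarrow> j < m \<Longrightarrow> i \<noteq> j \<Longrightarrow> a < d \<Longrightarrow> b < d \<Longrightarrow> bform B (u i a) (u j b) = 0"
    and A: "A \<in> Es" and ij: "i < m" "j < m" "i \<noteq> j" "a < d" "b < d"
  shows "bform (B * A) (u i a) (u j b) = 0"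
proof -
  have c: "u i a \<in> carrier_vec n" "u j b \<in> carrier_vec n" using blk_carrier blk ij by blast+
  have Ac: "A \<in> carrier_mat n n" using A Es by blast
  obtain t b' where "b' < d" "\<And>x. x \<in> carrier_vec n \<Longrightarrow> bform B (u i a) (A *\<^sub>v x) = t * bform B (u i b') x"
    using tied[OF blk[OF ij(1)] A ij(4)] by blast
  then show ?thesis using bform_mult_right[OF B Ac c] orth[OF ij(1,2,3) _ ij(5), of b'] c by simp
qed

end

lemma nondegenerate_pair:
  assumes "stable_subspace n Es C" "nondegenerate_on n B C" "C \<noteq> {0\<^sub>v n}"
  obtains x y where "x \<in> C" "y \<in> C" "bform B x y \<noteq> 0"
  using assms stable_subspaceD(2)[OF assms(1)] unfolding nondegenerate_on_def by blast

text \<open>Polarization.\<close>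

lemma symmetric_nonisotropic:
  assumes C: "stable_subspace n Es C" and F: "F \<in> carrier_mat n n" "transpose_mat F = F"
    and xy: "x \<in> C" "y \<in> C" "bform F x y \<noteq> 0"
  obtains v where "v \<in> C" "bform F v v \<noteq> 0"
proof (rule ccontr)
  assume "\<not> thesis"
  then have 0: "bform F v v = 0" if "v \<in> C" for v using that \<open>\<And>v. v \<in> C \<Longrightarrow> bform F v v \<noteq> 0 \<Longrightarrow> thesis\<close> by blast
  have c: "x \<in> carrier_vec n" "y \<in> carrier_vec n" "x + y \<in> carrier_vec n" using stable_subspaceD(1)[OF C] xy by auto
  have "bform F (x + y) (x + y) = bform F x x + bform F y x + (bform F x y + bform F y y)"
    using bform_add_right[OF F(1) c(3) c(1,2)] bform_add_left[OF F(1) c(1) c(1,2)] bform_add_left[OF F(1) c(2) c(1,2)] by simp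
  moreover have "bform F y x = bform F x y" using bform_transpose[OF F(1) c(1,2)] unfolding F(2) by simp
  ultimately show False using 0 xy stable_subspaceD(3)[OF C xy(1,2)] by simp
qed

lemma normalized_vector:
  assumes C: "stable_subspace n Es C" and F: "F \<in> carrier_mat n n" and v: "v \<in> C" "bform F v v \<noteq> 0"
  obtains w where "w \<in> C" "bform F w w = 1 \<or> bform F w w = -1"
proof -
  let ?c = "1 / sqrt \<bar>bform F v v\<bar>"
  have vc: "v \<in> carrier_vec n" "?c \<cdot>\<^sub>v v \<in> carrier_vec n" using stable_subspaceD(1)[OF C] v by auto
  have "?c * ?c = 1 / \<bar>bform F v v\<bar>" by simp
  then have "bform F (?c \<cdot>\<^sub>v v) (?c \<cdot>\<^sub>v v) = bform F v v / \<bar>bform F v v\<bar>"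
    using bform_smult_right[OF F vc(2,1), of ?c] bform_smult_left[OF F vc(1,1), of ?c] by simp
  then have "bform F (?c \<cdot>\<^sub>v v) (?c \<cdot>\<^sub>v v) = 1 \<or> bform F (?c \<cdot>\<^sub>v v) (?c \<cdot>\<^sub>v v) = -1"
    using v(2) by (cases "bform F v v > 0") auto
  then show ?thesis using that stable_subspaceD(4)[OF C v(1)] by blast
qed

context irreducible_group begin

text \<open>A change of basis conjugates \<open>H\<close> into the common isometry group of the transformed invariant forms.\<close>

lemma conj_into_isometries:
  assumes M: "M \<in> carrier_mat n n" "\<And>z. z \<in> carrier_vec n \<Longrightarrow> M *\<^sub>v z = 0\<^sub>v n \<Longrightarrow> z = 0\<^sub>v n"
    and Fs: "Fs \<subseteq> Inv"
    and L: "\<And>A. A \<in> carrier (GL TYPE(real) n) \<Longrightarrow>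
       (\<And>F. F \<in> Fs \<Longrightarrow> transpose_mat A * (transpose_mat M * F * M) * A = transpose_mat M * F * M) \<Longrightarrow> A \<in> L"
  shows "conj_into n H L"
proof -
  obtain P where P: "P \<in> carrier_mat n n" "M * P = 1\<^sub>m n" "P * M = 1\<^sub>m n"
    using invertible_if_kernel_trivial[OF M] .
  have PG: "P \<in> carrier (GL TYPE(real) n)" using P M(1) unfolding GL_iff by blast
  have grp: "group (GL TYPE(real) n)" by (rule GL_group)
  have invP: "inv\<^bsub>GL TYPE(real) n\<^esub> P = M"
  proof (rule group.inv_equality[OF grp _ PG])
    show "M \<otimes>\<^bsub>GL TYPE(real) n\<^esub> P = \<one>\<^bsub>GL TYPE(real) n\<^esub>"
      using P by (simp add: GL_def units_of_def ring_mat_def)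
    show "M \<in> carrier (GL TYPE(real) n)" using P M(1) unfolding GL_iff by blast
  qed
  have "P * h * M \<in> L" if h: "h \<in> H" for h
  proof (rule L)
    have hc: "h \<in> carrier_mat n n" using H_carrier[OF h] .
    have hG: "h \<in> carrier (GL TYPE(real) n)" using h H_GL by blast
    then obtain g where g: "g \<in> carrier_mat n n" "g * h = 1\<^sub>m n" "h * g = 1\<^sub>m n" unfolding GL_iff by blast
    note [simp] = hc g(1) P(1) M(1)
    have canc: "M * (P * X) = X" "P * (M * X) = X" "g * (h * X) = X" "h * (g * X) = X" if "X \<in> carrier_mat n n" for X
      using that P(2,3) g(2,3) by (simp_all add: mat_ring_simps(1)[symmetric] left_mult_one_mat del: assoc_mult_mat)
    have "(P * g * M) * (P * h * M) = 1\<^sub>m n" "(P * h * M) * (P * g * M) = 1\<^sub>m n"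
      by (simp_all add: mat_ring_simps canc P(3))
    then show "P * h * M \<in> carrier (GL TYPE(real) n)" unfolding GL_iff
      by (intro conjI bexI[of _ "P * g * M"]) simp_all
    fix F assume F: "F \<in> Fs"
    have FI: "F \<in> Inv" using F Fs by blast
    note [simp] = Inv_carrier[OF FI]
    have tc: "transpose_mat P * (transpose_mat M * X) = X" if "X \<in> carrier_mat n n" for X
    proof -
      have "transpose_mat P * transpose_mat M = 1\<^sub>m n" using P(2) by (simp flip: mat_transpose_simps(1))
      then show ?thesis using that by (simp add: mat_ring_simps(1)[symmetric] left_mult_one_mat del: assoc_mult_mat)
    qed
    have tc': "transpose_mat M * (transpose_mat P * X) = X" if "X \<in> carrier_mat n n" for X
    proof -
      have "transpose_mat M * transpose_mat P = 1\<^sub>m n" using P(3) by (simp flip: mat_transpose_simps(1))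
      then show ?thesis using that by (simp add: mat_ring_simps(1)[symmetric] left_mult_one_mat del: assoc_mult_mat)
    qed
    have "transpose_mat (P * h * M) * (transpose_mat M * F * M) * (P * h * M)
        = transpose_mat M * (transpose_mat h * F * h) * M"
      by (simp add: mat_transpose_simps mat_ring_simps canc tc)
    also have "\<dots> = transpose_mat M * F * M" unfolding InvD[OF FI h] ..
    finally show "transpose_mat (P * h * M) * (transpose_mat M * F * M) * (P * h * M) = transpose_mat M * F * M" .
  qed
  then have "(\<lambda>h. P * h * inv\<^bsub>GL TYPE(real) n\<^esub> P) ` H \<subseteq> L" unfolding invP by blast
  then show ?thesis unfolding conj_into_def using PG by blast
qed

text \<open>A matrix commuting with \<open>L\<close> is conjugate to an element of \<open>E\<close>, and non-zero elements of \<open>E\<close> are injective.\<close>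

lemma no_singular_centralizer:
  assumes conj: "conj_into n H L"
    and Z: "Z \<in> carrier_mat n n" "Z \<noteq> 0\<^sub>m n n" and v: "v \<in> carrier_vec n" "v \<noteq> 0\<^sub>v n" "Z *\<^sub>v v = 0\<^sub>v n"
    and comm: "\<And>A. A \<in> L \<Longrightarrow> A \<in> carrier_mat n n \<Longrightarrow> A * Z = Z * A"
  shows False
proof -
  let ?G = "GL TYPE(real) n"
  obtain P where P: "P \<in> carrier ?G" "\<And>h. h \<in> H \<Longrightarrow> P * h * inv\<^bsub>?G\<^esub> P \<in> L"
    using conj unfolding conj_into_def by blast
  have grp: "group ?G" by (rule GL_group)
  define Q where "Q = inv\<^bsub>?G\<^esub> P"
  have QG: "Q \<in> carrier ?G" unfolding Q_def by (rule group.inv_closed[OF grp P(1)])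
  have c: "P \<in> carrier_mat n n" "Q \<in> carrier_mat n n" using P(1) QG unfolding GL_iff by blast+
  have PQ: "Q * P = 1\<^sub>m n" "P * Q = 1\<^sub>m n"
    using group.l_inv[OF grp P(1)] group.r_inv[OF grp P(1)] unfolding Q_def[symmetric]
    by (simp_all add: GL_def units_of_def ring_mat_def)
  note [simp] = c Z(1)
  have canc: "P * (Q * X) = X" "Q * (P * X) = X" if "X \<in> carrier_mat n n" for X
    using that PQ by (simp_all add: mat_ring_simps(1)[symmetric] left_mult_one_mat del: assoc_mult_mat)
  have "Q * Z * P \<in> E"
  proof (rule EndI)
    fix h assume h: "h \<in> H"
    note [simp] = H_carrier[OF h]
    have "(P * h * Q) * Z = Z * (P * h * Q)" using comm[OF P(2)[OF h, folded Q_def]] by simp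
    then have "Q * ((P * h * Q) * Z) * P = Q * (Z * (P * h * Q)) * P" by simp
    then show "Q * Z * P * h = h * (Q * Z * P)" by (simp add: mat_ring_simps canc PQ)
  qed simp
  moreover have "Q *\<^sub>v v \<in> carrier_vec n" using mult_mat_vec_carrier[OF c(2) v(1)] .
  moreover have "Q *\<^sub>v v \<noteq> 0\<^sub>v n"
  proof
    assume "Q *\<^sub>v v = 0\<^sub>v n"
    then have "P *\<^sub>v (Q *\<^sub>v v) = 0\<^sub>v n" using mat_mult_zero_vec[OF c(1)] by simp
    then have "(P * Q) *\<^sub>v v = 0\<^sub>v n" using assoc_mult_mat_vec[OF c v(1)] by simp
    then show False using PQ v by simp
  qed
  moreover have "(Q * Z * P) *\<^sub>v (Q *\<^sub>v v) = 0\<^sub>v n"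
  proof -
    have "(Q * Z * P) *\<^sub>v (Q *\<^sub>v v) = (Q * Z * P * Q) *\<^sub>v v"
      by (rule assoc_mult_mat_vec[symmetric, of _ n n _ n]) (use v in simp_all)
    also have "Q * Z * P * Q = Q * Z" by (simp add: mat_ring_simps PQ)
    also have "(Q * Z) *\<^sub>v v = Q *\<^sub>v (Z *\<^sub>v v)" by (rule assoc_mult_mat_vec[of _ n n _ n]) (use v in simp_all)
    also have "\<dots> = 0\<^sub>v n" unfolding v(3) by (rule mat_mult_zero_vec[OF c(2)])
    finally show ?thesis .
  qed
  ultimately have "Q * Z * P = 0\<^sub>m n n" by (rule End_kernel)
  then have "P * (Q * Z * P) * Q = 0\<^sub>m n n" using left_mult_zero_mat[OF c(2), of n] right_mult_zero_mat[OF c(1), of n] by simp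
  then have "Z = 0\<^sub>m n n" by (simp add: mat_ring_simps canc PQ)
  then show False using Z(2) by simp
qed

lemma Inv_nondegenerate:
  assumes B: "B \<in> Inv" "B \<noteq> 0\<^sub>m n n"
  shows "nondegenerate_on n B (carrier_vec n)"
  unfolding nondegenerate_on_def
proof (intro ballI impI)
  fix x :: "real vec" assume x: "x \<in> carrier_vec n" "\<forall>y\<in>carrier_vec n. bform B x y = 0"
  have Bc: "B \<in> carrier_mat n n" using Inv_carrier[OF B(1)] .
  let ?T = "transpose_mat B"
  have T: "?T \<in> Inv" "?T \<in> carrier_mat n n" using Inv_transpose[OF B(1)] Bc by simp_all
  have T0: "?T \<noteq> 0\<^sub>m n n" using B(2) by (metis transpose_transpose zero_transpose_mat)
  have "(?T *\<^sub>v x) $ i = 0" if "i < n" for i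
  proof -
    have "(?T *\<^sub>v x) $ i = unit_vec n i \<bullet> (?T *\<^sub>v x)"
      using that x(1) T(2) by (intro scalar_prod_left_unit[symmetric]) simp_all
    also have "\<dots> = bform B x (unit_vec n i)" using bform_transpose[OF Bc unit_vec_carrier x(1), of i] by (simp add: bform_def)
    finally show ?thesis using x(2) by simp
  qed
  then have "?T *\<^sub>v x = 0\<^sub>v n" using T(2) by (intro eq_vecI) auto
  then show "x = 0\<^sub>v n" using invariant_form_kernel[OF T(2) _ x(1)] T T0 by auto
qed

text \<open>This is Sylvester's law: a block is a single vector of square \<open>\<plusminus>1\<close>.\<close>

theorem real_symmetric_case:
  assumes form: "B \<in> Inv" "B \<noteq> 0\<^sub>m n n" "transpose_mat B = B"
  shows "\<exists>p q. p + q = n \<and> conj_into n H (O_real p q)"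
proof -
  have Bc: "B \<in> carrier_mat n n" using Inv_carrier[OF form(1)] .
  interpret block_form n 1 B 1 "{}" "\<lambda>u. u 0 \<in> carrier_vec n \<and> (bform B (u 0) (u 0) = 1 \<or> bform B (u 0) (u 0) = -1)" "\<lambda>b. b"
  proof
    fix C assume C: "stable_subspace n {} C" "nondegenerate_on n B C" "C \<noteq> {0\<^sub>v n}"
    obtain x y where "x \<in> C" "y \<in> C" "bform B x y \<noteq> 0" using nondegenerate_pair[OF C] .
    then obtain v where "v \<in> C" "bform B v v \<noteq> 0" using symmetric_nonisotropic[OF C(1) Bc form(3)] by blast
    then obtain w where w: "w \<in> C" "bform B w w = 1 \<or> bform B w w = -1" using normalized_vector[OF C(1) Bc] by blast
    then show "\<exists>u. (u 0 \<in> carrier_vec n \<and> (bform B (u 0) (u 0) = 1 \<or> bform B (u 0) (u 0) = -1)) \<and> (\<forall>a<1. u a \<in> C)"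
      using stable_subspaceD(1)[OF C(1)] by (intro exI[of _ "\<lambda>_. w"]) simp
  qed (use form Bc Inv_nondegenerate[OF form(1,2)] in auto)
  obtain m r u where f: "n = 1 * m" "r \<le> m"
    "\<And>i. i < m \<Longrightarrow> u i 0 \<in> carrier_vec n \<and> (bform B (u i 0) (u i 0) = 1 \<or> bform B (u i 0) (u i 0) = -1)"
    "\<And>i. i < m \<Longrightarrow> bform B (u i 0) (u i 0) = -1 \<longleftrightarrow> i < r"
    "\<And>i j a b. i < m \<Longrightarrow> j < m \<Longrightarrow> i \<noteq> j \<Longrightarrow> a < 1 \<Longrightarrow> b < 1 \<Longrightarrow> bform B (u i a) (u j b) = 0"
    "\<And>z. z \<in> carrier_vec n \<Longrightarrow> block_columns n 1 m u *\<^sub>v z = 0\<^sub>v n \<Longrightarrow> z = 0\<^sub>v n"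
    by (rule block_frame[of "\<lambda>u. bform B (u 0) (u 0) = -1"]) (rule that; assumption)
  let ?M = "block_columns n 1 m u"
  have gram: "transpose_mat ?M * B * ?M = gram_mat 1 m (\<lambda>i a b. sgn_at r i)"
    by (rule block_gram[OF f(1) Bc _ f(5)]) (use f(3,4) in auto)
  have "conj_into n H (O_real r (m - r))"
  proof (rule conj_into_isometries[of ?M "{B}"])
    show "?M \<in> carrier_mat n n" using f(1) by (simp add: block_columns_def)
    fix A assume "A \<in> carrier (GL TYPE(real) n)"
      "\<And>F. F \<in> {B} \<Longrightarrow> transpose_mat A * (transpose_mat ?M * F * ?M) * A = transpose_mat ?M * F * ?M"
    then have "A \<in> carrier (GL TYPE(real) n)" "transpose_mat A * sig_mat r (m - r) * A = sig_mat r (m - r)"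
      unfolding gram_sig_mat[OF f(2), symmetric] gram[symmetric] by blast+
    then show "A \<in> O_real r (m - r)" using f(1,2) unfolding O_real_def bilinear_isometries_iff by simp
  qed (use form f(6) in blast)+
  then show ?thesis using f(1,2) by (intro exI[of _ r] exI[of _ "m - r"]) simp
qed

text \<open>A block is a pair of vectors spanning a hyperbolic plane.\<close>

theorem real_skew_case:
  assumes form: "B \<in> Inv" "B \<noteq> 0\<^sub>m n n" "transpose_mat B = (-1) \<cdot>\<^sub>m B"
  shows "2 dvd n \<and> conj_into n H (Sp_real (n div 2))"
proof -
  have Bc: "B \<in> carrier_mat n n" using Inv_carrier[OF form(1)] .
  have swap: "bform B y x = - bform B x y" if "x \<in> carrier_vec n" "y \<in> carrier_vec n" for x y
    using bform_transpose[OF Bc that] bform_mat_smult[OF Bc that, of "-1"] unfolding form(3) by simp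
  have self: "bform B x x = 0" if "x \<in> carrier_vec n" for x using swap[OF that that] by simp
  let ?Blk = "\<lambda>u :: nat \<Rightarrow> real vec. u 0 \<in> carrier_vec n \<and> u 1 \<in> carrier_vec n \<and> bform B (u 0) (u 1) = -1"
  interpret block_form n 2 B "-1" "{}" ?Blk "\<lambda>b. 1 - b"
  proof
    show "u a \<in> carrier_vec n" if "?Blk u" "a < 2" for u a using that unfolding less_numeral_cases(2) by auto
    show "bform B (u c) (u (1 - b)) = 0 \<longleftrightarrow> c \<noteq> b" if "?Blk u" "b < 2" "c < 2" for u b c
      using that swap[of "u 0" "u 1"] self unfolding less_numeral_cases(2) by auto
    fix C assume C: "stable_subspace n {} C" "nondegenerate_on n B C" "C \<noteq> {0\<^sub>v n}"
    obtain x y where xy: "x \<in> C" "y \<in> C" "bform B x y \<noteq> 0" using nondegenerate_pair[OF C] .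
    have c: "x \<in> carrier_vec n" "y \<in> carrier_vec n" using stable_subspaceD(1)[OF C(1)] xy by auto
    let ?y = "(-1 / bform B x y) \<cdot>\<^sub>v y"
    have "bform B x ?y = -1" using bform_smult_right[OF Bc c] xy(3) by simp
    then show "\<exists>u. ?Blk u \<and> (\<forall>a<2. u a \<in> C)"
      using xy c stable_subspaceD(4)[OF C(1) xy(2)] by (intro exI[of _ "\<lambda>a. if a = 0 then x else ?y"]) simp
  qed (use form Bc Inv_nondegenerate[OF form(1,2)] in auto)
  obtain m r u where f: "n = 2 * m" "r \<le> m"
    "\<And>i. i < m \<Longrightarrow> ?Blk (u i)"
    "\<And>i. i < m \<Longrightarrow> False \<longleftrightarrow> i < r"
    "\<And>i j a b. i < m \<Longrightarrow> j < m \<Longrightarrow> i \<noteq> j \<Longrightarrow> a < 2 \<Longrightarrow> b < 2 \<Longrightarrow> bform B (u i a) (u j b) = 0"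
    "\<And>z. z \<in> carrier_vec n \<Longrightarrow> block_columns n 2 m u *\<^sub>v z = 0\<^sub>v n \<Longrightarrow> z = 0\<^sub>v n"
    by (rule block_frame[of "\<lambda>u. False"]) (rule that; assumption)
  let ?M = "block_columns n 2 m u"
  have gram: "transpose_mat ?M * B * ?M = J_mat m"
  proof -
    have "transpose_mat ?M * B * ?M = gram_mat 2 m (\<lambda>i. table2 0 (-1) 1 0)"
    proof (rule block_gram[OF f(1) Bc blk_carrier[OF f(3)] f(5)])
      show "bform B (u i a) (u i b) = table2 0 (-1) 1 0 a b" if "i < m" "a < 2" "b < 2" for i a b
        using f(3)[OF that(1)] that(2,3) swap[of "u i 0" "u i 1"] self unfolding less_numeral_cases(2) table2_def by auto
    qed
    then show ?thesis unfolding gram_J .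
  qed
  have "conj_into n H (Sp_real m)"
  proof (rule conj_into_isometries[of ?M "{B}"])
    show "?M \<in> carrier_mat n n" using f(1) by (simp add: block_columns_def)
    fix A assume "A \<in> carrier (GL TYPE(real) n)"
      "\<And>F. F \<in> {B} \<Longrightarrow> transpose_mat A * (transpose_mat ?M * F * ?M) * A = transpose_mat ?M * F * ?M"
    then have "A \<in> carrier (GL TYPE(real) n)" "transpose_mat A * J_mat m * A = J_mat m" unfolding gram[symmetric] by blast+
    then show "A \<in> Sp_real m" using f(1) unfolding Sp_real_def bilinear_isometries_iff by simp
  qed (use form f(6) in blast)+
  then show ?thesis using f(1) by simp
qed

end

section \<open>Conjugation into the classical groups: complex commutant\<close>

context irreducible_group begin

lemma form_adjoint:
  assumes B: "B \<in> carrier_mat n n" and X: "X \<in> carrier_mat n n" and t: "transpose_mat X * B = \<delta> \<cdot>\<^sub>m (B * X)"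
    and xy: "x \<in> carrier_vec n" "y \<in> carrier_vec n"
  shows "bform B (X *\<^sub>v x) y = \<delta> * bform B x (X *\<^sub>v y)"
  using bform_mult_left[OF B X xy] bform_mult_right[OF B X xy] bform_mat_smult[OF mult_carrier_mat[OF B X] xy]
  unfolding t by simp

lemma unit_square_vec:
  assumes X: "X \<in> carrier_mat n n" "X * X = sc (-1)" and x: "x \<in> carrier_vec n"
  shows "X *\<^sub>v (X *\<^sub>v x) = (-1) \<cdot>\<^sub>v x"
proof -
  have "X *\<^sub>v (X *\<^sub>v x) = (X * X) *\<^sub>v x"
    by (rule assoc_mult_mat_vec[OF X(1) X(1) x, symmetric])
  also have "\<dots> = (-1) \<cdot>\<^sub>v (1\<^sub>m n *\<^sub>v x)" unfolding X(2) using x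
    by (intro eq_vecI) (auto simp: carrier_vecD row_smult smult_scalar_prod_distrib[of _ n])
  finally show ?thesis using x by simp
qed

text \<open>When \<open>I\<close> is self-adjoint, \<open>h(x, y) = B(x, y) - i B(x, I y)\<close> is complex bilinear with real part \<open>B\<close>. A
  vector that is not isotropic for \<open>B\<close> has \<open>h(v, v) \<noteq> 0\<close>, and a complex square root scales this value to \<open>1\<close>. The block
  is \<open>(v, I v)\<close>.\<close>

theorem complex_symmetric_case:
  assumes I: "I \<in> E" "I * I = sc (-1)"
    and form: "B \<in> Inv" "B \<noteq> 0\<^sub>m n n" "transpose_mat B = B" "transpose_mat I * B = B * I"
  shows "2 dvd n \<and> conj_into n H (complex_to_real_mat ` O_complex (n div 2))"
proof -
  have Bc: "B \<in> carrier_mat n n" using Inv_carrier[OF form(1)] .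
  have Ic: "I \<in> carrier_mat n n" using End_carrier[OF I(1)] .
  have Iv: "I *\<^sub>v x \<in> carrier_vec n" if "x \<in> carrier_vec n" for x using mult_mat_vec_carrier[OF Ic that] .
  have swap: "bform B y x = bform B x y" if "x \<in> carrier_vec n" "y \<in> carrier_vec n" for x y
    using bform_swap[OF Bc _ that, of 1] form(3) by simp
  have adj: "bform B (I *\<^sub>v x) y = bform B x (I *\<^sub>v y)" if "x \<in> carrier_vec n" "y \<in> carrier_vec n" for x y
    using form_adjoint[OF Bc Ic _ that, of 1] form(4) by simp
  have sq: "I *\<^sub>v (I *\<^sub>v x) = (-1) \<cdot>\<^sub>v x" if "x \<in> carrier_vec n" for x using unit_square_vec[OF Ic I(2) that] .
  note sr = bform_smult_right[OF Bc] and sl = bform_smult_left[OF Bc]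
    and ar = bform_add_right[OF Bc] and al = bform_add_left[OF Bc]
  let ?Blk = "\<lambda>u. \<exists>v\<in>carrier_vec n. bform B v v = 1 \<and> bform B v (I *\<^sub>v v) = 0 \<and> u = (\<lambda>a::nat. if a = 0 then v else I *\<^sub>v v)"
  interpret block_form n 2 B 1 "{I}" ?Blk "\<lambda>b. b"
  proof
    show "u a \<in> carrier_vec n" if "?Blk u" "a < 2" for u a using that Iv by auto
    show "bform B (u c) (u b) = 0 \<longleftrightarrow> c \<noteq> b" if "?Blk u" "b < 2" "c < 2" for u b c
      using that unfolding less_numeral_cases(2) by (auto simp: adj sq sr Iv)
    show "\<exists>t b. b < 2 \<and> (\<forall>x\<in>carrier_vec n. bform B (u a) (A *\<^sub>v x) = t * bform B (u b) x)"
      if blk: "?Blk u" and A: "A \<in> {I}" and a: "a < 2" for u A a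
    proof -
      obtain v where v: "v \<in> carrier_vec n" "u = (\<lambda>a::nat. if a = 0 then v else I *\<^sub>v v)" using blk by blast
      have "bform B v (I *\<^sub>v x) = 1 * bform B (I *\<^sub>v v) x" "bform B (I *\<^sub>v v) (I *\<^sub>v x) = (-1) * bform B v x"
        if "x \<in> carrier_vec n" for x using v(1) that by (simp_all add: adj sq sr Iv)
      then have "\<forall>x\<in>carrier_vec n. bform B (u 0) (I *\<^sub>v x) = 1 * bform B (u 1) x"
        "\<forall>x\<in>carrier_vec n. bform B (u 1) (I *\<^sub>v x) = (-1) * bform B (u 0) x" unfolding v(2) by simp_all
      then show ?thesis using A a unfolding less_numeral_cases(2)
        by (metis insertE empty_iff pos2 one_less_numeral_iff semiring_norm(76))
    qed
    fix C assume C: "stable_subspace n {I} C" "nondegenerate_on n B C" "C \<noteq> {0\<^sub>v n}"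
    obtain x y where "x \<in> C" "y \<in> C" "bform B x y \<noteq> 0" using nondegenerate_pair[OF C] .
    then obtain v where v: "v \<in> C" "bform B v v \<noteq> 0" using symmetric_nonisotropic[OF C(1) Bc form(3)] by blast
    have vc: "v \<in> carrier_vec n" using stable_subspaceD(1)[OF C(1) v(1)] .
    define \<alpha> \<beta> where "\<alpha> = bform B v v" and "\<beta> = bform B v (I *\<^sub>v v)"
    \<comment> \<open>\<open>\<alpha> - i \<beta>\<close> is \<open>h(v, v)\<close>, and \<open>w = z v\<close> has \<open>h(w, w) = z\<^sup>2 (\<alpha> - i \<beta>)\<close>.\<close>
    define z where "z = csqrt (1 / Complex \<alpha> (-\<beta>))"
    have "z^2 * Complex \<alpha> (-\<beta>) = 1" unfolding z_def using v(2) by (simp add: complex_eq_iff \<alpha>_def)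
    then have ab: "((Re z)^2 - (Im z)^2) * \<alpha> + 2 * Re z * Im z * \<beta> = 1" "2 * Re z * Im z * \<alpha> - ((Re z)^2 - (Im z)^2) * \<beta> = 0"
      by (simp_all add: complex_eq_iff power2_eq_square algebra_simps)
    define w where "w = Re z \<cdot>\<^sub>v v + Im z \<cdot>\<^sub>v (I *\<^sub>v v)"
    have wC: "w \<in> C" "I *\<^sub>v w \<in> C" unfolding w_def using stable_subspaceD(3-5)[OF C(1)] v(1) by auto
    have wc: "w \<in> carrier_vec n" using stable_subspaceD(1)[OF C(1) wC(1)] .
    have Iw: "I *\<^sub>v w = Re z \<cdot>\<^sub>v (I *\<^sub>v v) + (- Im z) \<cdot>\<^sub>v v"
      unfolding w_def using vc Iv[OF vc] mult_add_distrib_mat_vec[OF Ic, of "Re z \<cdot>\<^sub>v v" "Im z \<cdot>\<^sub>v (I *\<^sub>v v)"]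
      by (simp add: mult_mat_vec[OF Ic] sq) (auto intro!: eq_vecI)
    have "bform B w w = 1"
      using ab(1) vc Iv[OF vc] unfolding w_def by (simp add: ar al sr sl adj sq flip: \<alpha>_def \<beta>_def) (simp add: power2_eq_square algebra_simps)
    moreover have "bform B w (I *\<^sub>v w) = 0"
      unfolding Iw using ab(2) vc Iv[OF vc] unfolding w_def by (simp add: ar al sr sl adj sq flip: \<alpha>_def \<beta>_def) (simp add: power2_eq_square algebra_simps)
    ultimately show "\<exists>u. ?Blk u \<and> (\<forall>a<2. u a \<in> C)"
      using wC wc by (intro exI[of _ "\<lambda>a::nat. if a = 0 then w else I *\<^sub>v w"]) auto
  qed (use form Bc Ic Inv_nondegenerate[OF form(1,2)] in auto)
  obtain m r u where f: "n = 2 * m" "r \<le> m"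
    "\<And>i. i < m \<Longrightarrow> ?Blk (u i)"
    "\<And>i. i < m \<Longrightarrow> False \<longleftrightarrow> i < r"
    "\<And>i j a b. i < m \<Longrightarrow> j < m \<Longrightarrow> i \<noteq> j \<Longrightarrow> a < 2 \<Longrightarrow> b < 2 \<Longrightarrow> bform B (u i a) (u j b) = 0"
    "\<And>z. z \<in> carrier_vec n \<Longrightarrow> block_columns n 2 m u *\<^sub>v z = 0\<^sub>v n \<Longrightarrow> z = 0\<^sub>v n"
    by (rule block_frame[of "\<lambda>u. False"]) (rule that; assumption)
  let ?M = "block_columns n 2 m u"
  have gram0: "transpose_mat ?M * B * ?M = block_diag (1\<^sub>m m) (- 1\<^sub>m m)"
    unfolding gram_block_diag_one[symmetric]
  proof (rule block_gram[OF f(1) Bc blk_carrier[OF f(3)] f(5)])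
    show "bform B (u i a) (u i b) = table2 1 0 0 (-1) a b" if "i < m" "a < 2" "b < 2" for i a b
      using f(3)[OF that(1)] that(2,3) unfolding less_numeral_cases(2) table2_def by (auto simp: adj sq sr Iv)
  qed
  have gram1: "transpose_mat ?M * (B * I) * ?M = block_diag (1\<^sub>m m) (- 1\<^sub>m m) * real_i m"
    unfolding gram_real_i_forms[symmetric]
  proof (rule block_gram[OF f(1) mult_carrier_mat[OF Bc Ic] blk_carrier[OF f(3)] tied_orth[OF f(3,5)]])
    show "bform (B * I) (u i a) (u i b) = table2 0 (-1) (-1) 0 a b" if "i < m" "a < 2" "b < 2" for i a b
      using f(3)[OF that(1)] that(2,3) unfolding less_numeral_cases(2) table2_def
      by (auto simp: adj sq sr Iv bform_mult_right[OF Bc Ic, symmetric])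
  qed simp_all
  have "conj_into n H (complex_to_real_mat ` O_complex m)"
  proof (rule conj_into_isometries[of ?M "{B, B * I}"])
    show "?M \<in> carrier_mat n n" using f(1) by (simp add: block_columns_def)
    show "{B, B * I} \<subseteq> Inv" using form(1) Inv_mult_End[OF form(1) I(1)] by blast
    fix A assume A: "A \<in> carrier (GL TYPE(real) n)"
      "\<And>F. F \<in> {B, B * I} \<Longrightarrow> transpose_mat A * (transpose_mat ?M * F * ?M) * A = transpose_mat ?M * F * ?M"
    let ?K = "conj_sign m"
    have K: "?K = block_diag (1\<^sub>m m) (- 1\<^sub>m m)" by (simp add: conj_sign_def)
    have AG: "A \<in> carrier (GL TYPE(real) (m + m))" using A(1) f(1) by (simp add: mult_2)
    have 1: "transpose_mat A * ?K * A = ?K" "transpose_mat A * (?K * real_i m) * A = ?K * real_i m"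
      using A(2)[of B] A(2)[of "B * I"] unfolding gram0 gram1 K by simp_all
    have "A * real_i m = real_i m * A"
      by (rule isometry_commutes[OF AG conj_sign_carrier real_i_carrier conj_sign_carrier conj_sign_square 1])
    then have "A \<in> GL_complex_in_real m" by (rule commutes_real_i_GL[OF AG])
    then show "A \<in> complex_to_real_mat ` O_complex m"
      unfolding O_complex_image O_split_realized_def using AG 1(1) K by (simp add: mult_2 bilinear_isometries_iff)
  qed (use f(6) in blast)
  then show ?thesis using f(1) by simp
qed

text \<open>When \<open>I\<close> is skew-adjoint, \<open>B\<close> is the real part of a Hermitian form, \<open>B(v, I v) = 0\<close> is automatic, and a vector of
  square \<open>\<plusminus>1\<close> already gives a block \<open>(v, I v)\<close>.\<close>

theorem complex_hermitian_case:
  assumes I: "I \<in> E" "I * I = sc (-1)"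
    and form: "B \<in> Inv" "B \<noteq> 0\<^sub>m n n" "transpose_mat B = B" "transpose_mat I * B = (-1) \<cdot>\<^sub>m (B * I)"
  shows "\<exists>p q. p + q = n \<and> 2 dvd p \<and> 2 dvd q \<and> conj_into n H (complex_to_real_mat ` U_complex (p div 2) (q div 2))"
proof -
  have Bc: "B \<in> carrier_mat n n" using Inv_carrier[OF form(1)] .
  have Ic: "I \<in> carrier_mat n n" using End_carrier[OF I(1)] .
  have Iv: "I *\<^sub>v x \<in> carrier_vec n" if "x \<in> carrier_vec n" for x using mult_mat_vec_carrier[OF Ic that] .
  have swap: "bform B y x = bform B x y" if "x \<in> carrier_vec n" "y \<in> carrier_vec n" for x y
    using bform_swap[OF Bc _ that, of 1] form(3) by simp
  have adj: "bform B (I *\<^sub>v x) y = - bform B x (I *\<^sub>v y)" if "x \<in> carrier_vec n" "y \<in> carrier_vec n" for x y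
    using form_adjoint[OF Bc Ic _ that, of "-1"] form(4) by simp
  have sq: "I *\<^sub>v (I *\<^sub>v x) = (-1) \<cdot>\<^sub>v x" if "x \<in> carrier_vec n" for x using unit_square_vec[OF Ic I(2) that] .
  have self: "bform B x (I *\<^sub>v x) = 0" if "x \<in> carrier_vec n" for x
    using adj[OF that that] swap[OF Iv[OF that] that] by simp
  note sr = bform_smult_right[OF Bc] and sl = bform_smult_left[OF Bc]
  let ?Blk = "\<lambda>u. \<exists>v\<in>carrier_vec n. (bform B v v = 1 \<or> bform B v v = -1) \<and> u = (\<lambda>a::nat. if a = 0 then v else I *\<^sub>v v)"
  interpret block_form n 2 B 1 "{I}" ?Blk "\<lambda>b. b"
  proof
    show "u a \<in> carrier_vec n" if "?Blk u" "a < 2" for u a using that Iv by auto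
    show "bform B (u c) (u b) = 0 \<longleftrightarrow> c \<noteq> b" if "?Blk u" "b < 2" "c < 2" for u b c
      using that unfolding less_numeral_cases(2) by (auto simp: adj sq sr Iv self)
    show "\<exists>t b. b < 2 \<and> (\<forall>x\<in>carrier_vec n. bform B (u a) (A *\<^sub>v x) = t * bform B (u b) x)"
      if blk: "?Blk u" and A: "A \<in> {I}" and a: "a < 2" for u A a
    proof -
      obtain v where v: "v \<in> carrier_vec n" "u = (\<lambda>a::nat. if a = 0 then v else I *\<^sub>v v)" using blk by blast
      have "bform B v (I *\<^sub>v x) = (-1) * bform B (I *\<^sub>v v) x" "bform B (I *\<^sub>v v) (I *\<^sub>v x) = 1 * bform B v x"
        if "x \<in> carrier_vec n" for x using v(1) that by (simp_all add: adj sq sr Iv)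
      then have "\<forall>x\<in>carrier_vec n. bform B (u 0) (I *\<^sub>v x) = (-1) * bform B (u 1) x"
        "\<forall>x\<in>carrier_vec n. bform B (u 1) (I *\<^sub>v x) = 1 * bform B (u 0) x" unfolding v(2) by simp_all
      then show ?thesis using A a unfolding less_numeral_cases(2)
        by (metis insertE empty_iff pos2 one_less_numeral_iff semiring_norm(76))
    qed
    fix C assume C: "stable_subspace n {I} C" "nondegenerate_on n B C" "C \<noteq> {0\<^sub>v n}"
    obtain x y where "x \<in> C" "y \<in> C" "bform B x y \<noteq> 0" using nondegenerate_pair[OF C] .
    then obtain v where "v \<in> C" "bform B v v \<noteq> 0" using symmetric_nonisotropic[OF C(1) Bc form(3)] by blast
    then obtain w where w: "w \<in> C" "bform B w w = 1 \<or> bform B w w = -1" using normalized_vector[OF C(1) Bc] by blast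
    have "I *\<^sub>v w \<in> C" "w \<in> carrier_vec n" using stable_subspaceD(5)[OF C(1) _ w(1)] stable_subspaceD(1)[OF C(1) w(1)] by auto
    then show "\<exists>u. ?Blk u \<and> (\<forall>a<2. u a \<in> C)"
      using w by (intro exI[of _ "\<lambda>a::nat. if a = 0 then w else I *\<^sub>v w"]) auto
  qed (use form Bc Ic Inv_nondegenerate[OF form(1,2)] in auto)
  obtain m r u where f: "n = 2 * m" "r \<le> m"
    "\<And>i. i < m \<Longrightarrow> ?Blk (u i)"
    "\<And>i. i < m \<Longrightarrow> bform B (u i 0) (u i 0) = -1 \<longleftrightarrow> i < r"
    "\<And>i j a b. i < m \<Longrightarrow> j < m \<Longrightarrow> i \<noteq> j \<Longrightarrow> a < 2 \<Longrightarrow> b < 2 \<Longrightarrow> bform B (u i a) (u j b) = 0"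
    "\<And>z. z \<in> carrier_vec n \<Longrightarrow> block_columns n 2 m u *\<^sub>v z = 0\<^sub>v n \<Longrightarrow> z = 0\<^sub>v n"
    by (rule block_frame[of "\<lambda>u. bform B (u 0) (u 0) = -1"]) (rule that; assumption)
  have ui: "\<exists>v\<in>carrier_vec n. bform B v v = sgn_at r i \<and> u i = (\<lambda>a::nat. if a = 0 then v else I *\<^sub>v v)" if "i < m" for i
    using f(3,4)[OF that] by auto
  let ?M = "block_columns n 2 m u" and ?S = "sig_mat r (m - r)"
  have gram0: "transpose_mat ?M * B * ?M = complex_to_real_mat ?S"
    unfolding gram_sig_diag[OF f(2), symmetric]
  proof (rule block_gram[OF f(1) Bc blk_carrier[OF f(3)] f(5)])
    show "bform B (u i a) (u i b) = table2 (sgn_at r i) 0 0 (sgn_at r i) a b" if "i < m" "a < 2" "b < 2" for i a b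
      using ui[OF that(1)] that(2,3) unfolding less_numeral_cases(2) table2_def by (auto simp: adj sq sr Iv self)
  qed
  have gram1: "transpose_mat ?M * (B * I) * ?M = complex_to_real_mat ?S * real_i m"
    unfolding gram_sig_i[OF f(2), symmetric]
  proof (rule block_gram[OF f(1) mult_carrier_mat[OF Bc Ic] blk_carrier[OF f(3)] tied_orth[OF f(3,5)]])
    show "bform (B * I) (u i a) (u i b) = table2 0 (- sgn_at r i) (sgn_at r i) 0 a b" if "i < m" "a < 2" "b < 2" for i a b
      using ui[OF that(1)] that(2,3) unfolding less_numeral_cases(2) table2_def
      by (auto simp: adj sq sr Iv self bform_mult_right[OF Bc Ic, symmetric])
  qed simp_all
  have "conj_into n H (complex_to_real_mat ` U_complex r (m - r))"
  proof (rule conj_into_isometries[of ?M "{B, B * I}"])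
    show "?M \<in> carrier_mat n n" using f(1) by (simp add: block_columns_def)
    show "{B, B * I} \<subseteq> Inv" using form(1) Inv_mult_End[OF form(1) I(1)] by blast
    fix A assume A: "A \<in> carrier (GL TYPE(real) n)"
      "\<And>F. F \<in> {B, B * I} \<Longrightarrow> transpose_mat A * (transpose_mat ?M * F * ?M) * A = transpose_mat ?M * F * ?M"
    have m: "r + (m - r) = m" using f(2) by simp
    have AG: "A \<in> carrier (GL TYPE(real) (m + m))" using A(1) f(1) by (simp add: mult_2)
    show "A \<in> complex_to_real_mat ` U_complex r (m - r)"
      unfolding U_complex_def hermitian_isometries[OF sig_mat_carrier sig_mat_carrier sig_mat_square] unfolding m
      using A(2)[of B] A(2)[of "B * I"] AG unfolding gram0 gram1 by (simp add: bilinear_isometries_iff)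
  qed (use f(6) in blast)
  then show ?thesis using f(1,2) by (intro exI[of _ "2 * r"] exI[of _ "2 * (m - r)"]) simp
qed

text \<open>A block is \<open>(v, w, I v, I w)\<close> with \<open>h(v, w) = -1\<close> for the complex skew form \<open>h\<close> with real part \<open>B\<close>; given any
  \<open>y\<close> with \<open>B(v, y) \<noteq> 0\<close>, a complex multiple \<open>w\<close> of \<open>y\<close> achieves this value.\<close>

theorem complex_skew_case:
  assumes I: "I \<in> E" "I * I = sc (-1)"
    and form: "B \<in> Inv" "B \<noteq> 0\<^sub>m n n" "transpose_mat B = (-1) \<cdot>\<^sub>m B" "transpose_mat I * B = B * I"
  shows "4 dvd n \<and> conj_into n H (complex_to_real_mat ` Sp_complex (n div 4))"
proof -
  have Bc: "B \<in> carrier_mat n n" using Inv_carrier[OF form(1)] .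
  have Ic: "I \<in> carrier_mat n n" using End_carrier[OF I(1)] .
  have Iv: "I *\<^sub>v x \<in> carrier_vec n" if "x \<in> carrier_vec n" for x using mult_mat_vec_carrier[OF Ic that] .
  have swap: "bform B y x = - bform B x y" if "x \<in> carrier_vec n" "y \<in> carrier_vec n" for x y
    using bform_swap[OF Bc form(3) that] by simp
  have adj: "bform B (I *\<^sub>v x) y = bform B x (I *\<^sub>v y)" if "x \<in> carrier_vec n" "y \<in> carrier_vec n" for x y
    using form_adjoint[OF Bc Ic _ that, of 1] form(4) by simp
  have sq: "I *\<^sub>v (I *\<^sub>v x) = (-1) \<cdot>\<^sub>v x" if "x \<in> carrier_vec n" for x using unit_square_vec[OF Ic I(2) that] .
  have self: "bform B x x = 0" if "x \<in> carrier_vec n" for x using swap[OF that that] by simp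
  have selfI: "bform B x (I *\<^sub>v x) = 0" if "x \<in> carrier_vec n" for x
    using adj[OF that that] swap[OF Iv[OF that] that] by simp
  note sr = bform_smult_right[OF Bc] and sl = bform_smult_left[OF Bc]
    and ar = bform_add_right[OF Bc] and al = bform_add_left[OF Bc]
  let ?u = "\<lambda>v w a::nat. if a = 0 then v else if a = 1 then w else if a = 2 then I *\<^sub>v v else I *\<^sub>v w"
  let ?Blk = "\<lambda>u. \<exists>v\<in>carrier_vec n. \<exists>w\<in>carrier_vec n. bform B v w = -1 \<and> bform B v (I *\<^sub>v w) = 0 \<and> u = ?u v w"
  let ?\<pi> = "\<lambda>b::nat. if b = 0 then 1 else if b = 1 then 0 else if b = 2 then 3 else 2 :: nat"
  let ?T0 = "[[0,-1,0,0],[1,0,0,0],[0,0,0,1],[0,0,-1,0]] :: real list list"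
  let ?T1 = "[[0,0,0,1],[0,0,-1,0],[0,1,0,0],[-1,0,0,0]] :: real list list"
  have tab: "bform B (?u v w a) (?u v w b) = table4 ?T0 a b" "bform B (?u v w a) (I *\<^sub>v ?u v w b) = table4 ?T1 a b"
    if vw: "v \<in> carrier_vec n" "w \<in> carrier_vec n" "bform B v w = -1" "bform B v (I *\<^sub>v w) = 0" and ab: "a < 4" "b < 4"
    for v w a b
  proof -
    have c: "I *\<^sub>v v \<in> carrier_vec n" "I *\<^sub>v w \<in> carrier_vec n" using Iv vw by blast+
    have 0: "bform B w v = 1" "bform B w (I *\<^sub>v v) = 0" "bform B v v = 0" "bform B w w = 0"
      "bform B v (I *\<^sub>v v) = 0" "bform B w (I *\<^sub>v w) = 0"
      using vw swap[OF vw(1,2)] adj[OF vw(1,2)] swap[OF c(1) vw(2)] self selfI by simp_all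
    have cc: "I *\<^sub>v (I *\<^sub>v v) \<in> carrier_vec n" "I *\<^sub>v (I *\<^sub>v w) \<in> carrier_vec n" using Iv c by blast+
    have 1: "bform B (I *\<^sub>v v) v = bform B v (I *\<^sub>v v)" "bform B (I *\<^sub>v v) (I *\<^sub>v v) = bform B v (I *\<^sub>v (I *\<^sub>v v))"
      "bform B (I *\<^sub>v v) (I *\<^sub>v (I *\<^sub>v v)) = bform B v (I *\<^sub>v (I *\<^sub>v (I *\<^sub>v v)))" "bform B (I *\<^sub>v v) w = bform B v (I *\<^sub>v w)"
      "bform B (I *\<^sub>v v) (I *\<^sub>v w) = bform B v (I *\<^sub>v (I *\<^sub>v w))" "bform B (I *\<^sub>v v) (I *\<^sub>v (I *\<^sub>v w)) = bform B v (I *\<^sub>v (I *\<^sub>v (I *\<^sub>v w)))"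
      "bform B (I *\<^sub>v w) v = bform B w (I *\<^sub>v v)" "bform B (I *\<^sub>v w) (I *\<^sub>v v) = bform B w (I *\<^sub>v (I *\<^sub>v v))"
      "bform B (I *\<^sub>v w) (I *\<^sub>v (I *\<^sub>v v)) = bform B w (I *\<^sub>v (I *\<^sub>v (I *\<^sub>v v)))" "bform B (I *\<^sub>v w) w = bform B w (I *\<^sub>v w)"
      "bform B (I *\<^sub>v w) (I *\<^sub>v w) = bform B w (I *\<^sub>v (I *\<^sub>v w))" "bform B (I *\<^sub>v w) (I *\<^sub>v (I *\<^sub>v w)) = bform B w (I *\<^sub>v (I *\<^sub>v (I *\<^sub>v w)))"
      by (simp_all only: adj vw(1,2) c cc)
    have 2: "bform B v (I *\<^sub>v (I *\<^sub>v v)) = - bform B v v" "bform B v (I *\<^sub>v (I *\<^sub>v (I *\<^sub>v v))) = - bform B v (I *\<^sub>v v)"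
      "bform B v (I *\<^sub>v (I *\<^sub>v w)) = - bform B v w" "bform B v (I *\<^sub>v (I *\<^sub>v (I *\<^sub>v w))) = - bform B v (I *\<^sub>v w)"
      "bform B w (I *\<^sub>v (I *\<^sub>v v)) = - bform B w v" "bform B w (I *\<^sub>v (I *\<^sub>v (I *\<^sub>v v))) = - bform B w (I *\<^sub>v v)"
      "bform B w (I *\<^sub>v (I *\<^sub>v w)) = - bform B w w" "bform B w (I *\<^sub>v (I *\<^sub>v (I *\<^sub>v w))) = - bform B w (I *\<^sub>v w)"
      using vw(1,2) c by (simp_all add: sq sr mult_mat_vec[OF Ic])
    show "bform B (?u v w a) (?u v w b) = table4 ?T0 a b" "bform B (?u v w a) (I *\<^sub>v ?u v w b) = table4 ?T1 a b"
      using ab unfolding less_numeral_cases(3) table4_def by (elim disjE; simp add: 0 1 2 vw(3,4))+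
  qed
  interpret block_form n 4 B "-1" "{I}" ?Blk ?\<pi>
  proof
    show "u a \<in> carrier_vec n" if blk: "?Blk u" and "a < 4" for u a
    proof -
      obtain v w where v: "v \<in> carrier_vec n" "w \<in> carrier_vec n" "u = ?u v w" using blk by blast
      show ?thesis unfolding v(3) using v(1,2) Iv by simp
    qed
    show "bform B (u c) (u (?\<pi> b)) = 0 \<longleftrightarrow> c \<noteq> b" if blk: "?Blk u" and b: "b < 4" and c: "c < 4" for u b c
    proof -
      obtain v w where v: "v \<in> carrier_vec n" "w \<in> carrier_vec n" "bform B v w = -1" "bform B v (I *\<^sub>v w) = 0" "u = ?u v w"
        using blk by blast
      have "?\<pi> b < 4" by simp
      from tab(1)[OF v(1-4) c this] show ?thesis
        unfolding v(5) using b c unfolding less_numeral_cases(3) table4_def by (elim disjE) simp_all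
    qed
    show "\<exists>t b. b < 4 \<and> (\<forall>x\<in>carrier_vec n. bform B (u a) (A *\<^sub>v x) = t * bform B (u b) x)"
      if blk: "?Blk u" and A: "A \<in> {I}" and a: "a < 4" for u A a
    proof -
      obtain v w where v: "v \<in> carrier_vec n" "w \<in> carrier_vec n" "u = ?u v w" using blk by blast
      have "\<forall>x\<in>carrier_vec n. bform B (u 0) (I *\<^sub>v x) = 1 * bform B (u 2) x"
        "\<forall>x\<in>carrier_vec n. bform B (u 1) (I *\<^sub>v x) = 1 * bform B (u 3) x"
        "\<forall>x\<in>carrier_vec n. bform B (u 2) (I *\<^sub>v x) = (-1) * bform B (u 0) x"
        "\<forall>x\<in>carrier_vec n. bform B (u 3) (I *\<^sub>v x) = (-1) * bform B (u 1) x"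
        unfolding v(3) using v(1,2) by (simp_all add: adj sq sr Iv)
      moreover have "(0::nat) < 4" "(1::nat) < 4" "(2::nat) < 4" "(3::nat) < 4" by simp_all
      ultimately show ?thesis using A a unfolding less_numeral_cases(3) singleton_iff by blast
    qed
    fix C assume C: "stable_subspace n {I} C" "nondegenerate_on n B C" "C \<noteq> {0\<^sub>v n}"
    obtain x y where xy: "x \<in> C" "y \<in> C" "bform B x y \<noteq> 0" using nondegenerate_pair[OF C] .
    have c: "x \<in> carrier_vec n" "y \<in> carrier_vec n" using stable_subspaceD(1)[OF C(1)] xy by auto
    define \<alpha> \<beta> where "\<alpha> = bform B x y" and "\<beta> = bform B x (I *\<^sub>v y)"
    define k where "k = \<alpha>^2 + \<beta>^2"
    have k: "k \<noteq> 0" using xy(3) unfolding k_def \<alpha>_def by (simp add: sum_power2_eq_zero_iff)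
    \<comment> \<open>Multiplication of \<open>y\<close> by \<open>- 1 / (\<alpha> - i \<beta>)\<close>, where \<open>\<alpha> - i \<beta> = h(x, y)\<close>.\<close>
    define w where "w = (- \<alpha> / k) \<cdot>\<^sub>v y + (- \<beta> / k) \<cdot>\<^sub>v (I *\<^sub>v y)"
    have wC: "w \<in> C" "I *\<^sub>v w \<in> C" "I *\<^sub>v x \<in> C" unfolding w_def using stable_subspaceD(3-5)[OF C(1)] xy by auto
    have wc: "w \<in> carrier_vec n" using stable_subspaceD(1)[OF C(1) wC(1)] .
    have Iw: "I *\<^sub>v w = (- \<alpha> / k) \<cdot>\<^sub>v (I *\<^sub>v y) + (\<beta> / k) \<cdot>\<^sub>v y"
      unfolding w_def using c Iv[OF c(2)] mult_add_distrib_mat_vec[OF Ic, of "(- \<alpha> / k) \<cdot>\<^sub>v y" "(- \<beta> / k) \<cdot>\<^sub>v (I *\<^sub>v y)"]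
      by (simp add: mult_mat_vec[OF Ic] sq) (auto intro!: eq_vecI)
    have "bform B x w = - (\<alpha> * \<alpha> + \<beta> * \<beta>) / k"
      using c Iv[OF c(2)] unfolding w_def by (simp add: ar sr flip: \<alpha>_def \<beta>_def) (simp add: diff_divide_distrib)
    also have "\<alpha> * \<alpha> + \<beta> * \<beta> = k" unfolding k_def by (simp add: power2_eq_square)
    also have "- k / k = -1" using k by simp
    finally have 1: "bform B x w = -1" .
    have 2: "bform B x (I *\<^sub>v w) = 0"
      unfolding Iw using c Iv[OF c(2)] by (simp add: ar sr flip: \<alpha>_def \<beta>_def)
    show "\<exists>u. ?Blk u \<and> (\<forall>a<4. u a \<in> C)"
      using wC wc xy(1) c(1) 1 2 by (intro exI[of _ "?u x w"]) auto
  qed (use form Bc Ic Inv_nondegenerate[OF form(1,2)] in auto)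
  obtain m r u where f: "n = 4 * m" "r \<le> m"
    "\<And>i. i < m \<Longrightarrow> ?Blk (u i)"
    "\<And>i. i < m \<Longrightarrow> False \<longleftrightarrow> i < r"
    "\<And>i j a b. i < m \<Longrightarrow> j < m \<Longrightarrow> i \<noteq> j \<Longrightarrow> a < 4 \<Longrightarrow> b < 4 \<Longrightarrow> bform B (u i a) (u j b) = 0"
    "\<And>z. z \<in> carrier_vec n \<Longrightarrow> block_columns n 4 m u *\<^sub>v z = 0\<^sub>v n \<Longrightarrow> z = 0\<^sub>v n"
    by (rule block_frame[of "\<lambda>u. False"]) (rule that; assumption)
  let ?M = "block_columns n 4 m u" and ?K = "conj_sign (m + m) * complex_to_real_mat (J_c m)"
  have gram0: "transpose_mat ?M * B * ?M = ?K"
    unfolding gram_sp_complex(1)[symmetric]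
  proof (rule block_gram[OF f(1) Bc blk_carrier[OF f(3)] f(5)])
    show "bform B (u i a) (u i b) = table4 ?T0 a b" if "i < m" "a < 4" "b < 4" for i a b
    proof -
      obtain v w where v: "v \<in> carrier_vec n" "w \<in> carrier_vec n" "bform B v w = -1" "bform B v (I *\<^sub>v w) = 0" "u i = ?u v w"
        using f(3)[OF \<open>i < m\<close>] by blast
      show ?thesis unfolding v(5) by (rule tab(1)[OF v(1-4) that(2,3)])
    qed
  qed
  have gram1: "transpose_mat ?M * (B * I) * ?M = ?K * real_i (m + m)"
    unfolding gram_sp_complex(2)[symmetric]
  proof (rule block_gram[OF f(1) mult_carrier_mat[OF Bc Ic] blk_carrier[OF f(3)] tied_orth[OF f(3,5)]])
    show "bform (B * I) (u i a) (u i b) = table4 ?T1 a b" if "i < m" "a < 4" "b < 4" for i a b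
    proof -
      obtain v w where v: "v \<in> carrier_vec n" "w \<in> carrier_vec n" "bform B v w = -1" "bform B v (I *\<^sub>v w) = 0" "u i = ?u v w"
        using f(3)[OF \<open>i < m\<close>] by blast
      have "bform B (u i a) (I *\<^sub>v u i b) = table4 ?T1 a b" unfolding v(5) by (rule tab(2)[OF v(1-4) that(2,3)])
      then show ?thesis
        using bform_mult_right[OF Bc Ic blk_carrier[OF f(3)[OF that(1)] that(2)] blk_carrier[OF f(3)[OF that(1)] that(3)]]
        by simp
    qed
  qed simp_all
  have "conj_into n H (complex_to_real_mat ` Sp_complex m)"
  proof (rule conj_into_isometries[of ?M "{B, B * I}"])
    show "?M \<in> carrier_mat n n" using f(1) by (simp add: block_columns_def)
    show "{B, B * I} \<subseteq> Inv" using form(1) Inv_mult_End[OF form(1) I(1)] by blast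
    fix A assume A: "A \<in> carrier (GL TYPE(real) n)"
      "\<And>F. F \<in> {B, B * I} \<Longrightarrow> transpose_mat A * (transpose_mat ?M * F * ?M) * A = transpose_mat ?M * F * ?M"
    have nm: "n = m + m + (m + m)" using f(1) by simp
    have AG: "A \<in> carrier (GL TYPE(real) (m + m + (m + m)))" using A(1) unfolding nm .
    have 1: "transpose_mat A * ?K * A = ?K" "transpose_mat A * (?K * real_i (m + m)) * A = ?K * real_i (m + m)"
      using A(2)[of B] A(2)[of "B * I"] unfolding gram0 gram1 by simp_all
    let ?J = "complex_to_real_mat (J_c m)" and ?k = "m + m + (m + m)"
    have J: "?J \<in> carrier_mat ?k ?k" using complex_to_real_mat_carrier[OF J_mat_carrier] .
    have JJ: "?J * ?J = (-1) \<cdot>\<^sub>m 1\<^sub>m ?k"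
    proof -
      have "J_c m * J_c m = - 1\<^sub>m (m + m)"
        unfolding J_mat_blocks by (subst mult_four_block_mat[of _ m m _ m _ m _ _ m _ m]) (auto intro!: eq_matI)
      then have "?J * ?J = complex_to_real_mat (- 1\<^sub>m (m + m))"
        using complex_to_real_mat_mult[OF J_mat_carrier J_mat_carrier, of m] by simp
      also have "\<dots> = (-1) \<cdot>\<^sub>m 1\<^sub>m ?k" by (intro eq_matI) (auto simp: complex_to_real_mat_def)
      finally show ?thesis .
    qed
    let ?L = "(-1) \<cdot>\<^sub>m (?J * conj_sign (m + m))"
    have JK: "?J * conj_sign (m + m) \<in> carrier_mat ?k ?k" using mult_carrier_mat[OF J conj_sign_carrier] .
    have Kc: "?K \<in> carrier_mat ?k ?k" using mult_carrier_mat[OF conj_sign_carrier J] .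
    have "(?J * conj_sign (m + m)) * ?K = ?J * ((conj_sign (m + m) * conj_sign (m + m)) * ?J)"
      using J by (simp add: assoc_mult_mat[of _ ?k ?k _ ?k _ ?k])
    also have "\<dots> = (-1) \<cdot>\<^sub>m 1\<^sub>m ?k" unfolding conj_sign_square left_mult_one_mat[OF J] JJ ..
    finally have LK: "?L * ?K = 1\<^sub>m ?k" unfolding mult_smult_assoc_mat[OF JK Kc] by simp
    have "A * real_i (m + m) = real_i (m + m) * A"
      by (rule isometry_commutes[OF AG Kc real_i_carrier _ LK 1]) (use JK in simp)
    then have "A \<in> GL_complex_in_real (m + m)" by (rule commutes_real_i_GL[OF AG])
    then show "A \<in> complex_to_real_mat ` Sp_complex m"
      unfolding Sp_complex_def mult_2 complex_bilinear_isometries[OF J_mat_carrier] using AG 1(1)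
      by (simp add: bilinear_isometries_iff)
  qed (use f(6) in blast)
  then show ?thesis using f(1) by simp
qed

text \<open>Both quaternionic families: preserving \<open>B\<close> and \<open>B I\<close> makes a matrix a complex isometry of the
  (skew-)Hermitian form, and preserving \<open>B J\<close>, the real part of the bilinear form, makes it quaternionic.\<close>

lemma quaternion_conj_into:
  assumes nm: "n = 4 * m" and M: "M \<in> carrier_mat n n" "\<And>z. z \<in> carrier_vec n \<Longrightarrow> M *\<^sub>v z = 0\<^sub>v n \<Longrightarrow> z = 0\<^sub>v n"
    and Fs: "{B, B * I, B * J} \<subseteq> Inv"
    and F: "F \<in> carrier_mat m m" "L \<in> carrier_mat m m" "F * L = 1\<^sub>m m" "L * F = 1\<^sub>m m"
    and gram: "transpose_mat M * B * M = complex_to_real_mat (quat_to_complex_mat F)"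
      "transpose_mat M * (B * I) * M = complex_to_real_mat (quat_to_complex_mat F) * real_i (m + m)"
      "transpose_mat M * (B * J) * M = conj_sign (m + m) * complex_to_real_mat (J_c m * quat_to_complex_mat F)"
  shows "conj_into n H (quat_to_real_mat ` sesquilinear_isometries qcnj m F)"
proof (rule conj_into_isometries[OF M Fs])
  fix A assume A: "A \<in> carrier (GL TYPE(real) n)"
    "\<And>F. F \<in> {B, B * I, B * J} \<Longrightarrow> transpose_mat A * (transpose_mat M * F * M) * A = transpose_mat M * F * M"
  let ?q = "quat_to_complex_mat" and ?k = "m + m"
  have n4: "n = ?k + ?k" using nm by simp
  have q: "?q F \<in> carrier_mat ?k ?k" "?q L \<in> carrier_mat ?k ?k" using quat_to_complex_mat_carrier F by blast+
  have LF: "?q L * ?q F = 1\<^sub>m ?k" using quat_to_complex_mat_mult[OF F(2,1)] F(4) quat_to_complex_mat_one by metis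
  have AG: "A \<in> carrier (GL TYPE(real) (?k + ?k))" using A(1) unfolding n4 .
  have "A \<in> complex_to_real_mat ` sesquilinear_isometries cnj ?k (?q F)"
    unfolding hermitian_isometries[OF q LF] using A(2)[of B] A(2)[of "B * I"] AG unfolding gram
    by (simp add: bilinear_isometries_iff)
  then obtain C where C: "A = complex_to_real_mat C" "C \<in> sesquilinear_isometries cnj ?k (?q F)" by blast
  have CG: "C \<in> carrier (GL TYPE(complex) ?k)" using C(2) by (simp add: sesquilinear_isometries_iff)
  then have Cc: "C \<in> carrier_mat ?k ?k" unfolding GL_iff by blast
  have "transpose_mat C * (J_c m * ?q F) * C = J_c m * ?q F"
    using A(2)[of "B * J"] bilinear_isometry_iff[OF Cc mult_carrier_mat[OF J_mat_carrier q(1)]] unfolding gram C(1) by simp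
  then have "C \<in> ?q ` sesquilinear_isometries qcnj m F"
    unfolding quaternion_isometries[OF F(1-3)] using C(2) CG by (simp add: bilinear_isometries_iff)
  then show "A \<in> quat_to_real_mat ` sesquilinear_isometries qcnj m F"
    unfolding C(1) quat_to_real_mat_def by blast
qed

end

locale quaternion_form = irreducible_group +
  fixes I J B :: "real mat" and \<epsilon> :: real
  assumes IJ: "I \<in> E" "J \<in> E" "I * I = sc (-1)" "J * J = sc (-1)" "J * I = (-1) \<cdot>\<^sub>m (I * J)"
    and form: "B \<in> Inv" "B \<noteq> 0\<^sub>m n n" "transpose_mat B = \<epsilon> \<cdot>\<^sub>m B"
      "transpose_mat I * B = (-1) \<cdot>\<^sub>m (B * I)" "transpose_mat J * B = (-1) \<cdot>\<^sub>m (B * J)"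
begin

lemma B_carrier: "B \<in> carrier_mat n n" using Inv_carrier[OF form(1)] .
lemma I_carrier: "I \<in> carrier_mat n n" using End_carrier[OF IJ(1)] .
lemma J_carrier: "J \<in> carrier_mat n n" using End_carrier[OF IJ(2)] .

lemma I_vec_carrier: "x \<in> carrier_vec n \<Longrightarrow> I *\<^sub>v x \<in> carrier_vec n" using mult_mat_vec_carrier[OF I_carrier] .
lemma J_vec_carrier: "x \<in> carrier_vec n \<Longrightarrow> J *\<^sub>v x \<in> carrier_vec n" using mult_mat_vec_carrier[OF J_carrier] .

lemma units_adjoint:
  assumes "x \<in> carrier_vec n" "y \<in> carrier_vec n"
  shows "bform B (I *\<^sub>v x) y = - bform B x (I *\<^sub>v y)" "bform B (J *\<^sub>v x) y = - bform B x (J *\<^sub>v y)"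
  using form_adjoint[OF B_carrier I_carrier form(4) assms] form_adjoint[OF B_carrier J_carrier form(5) assms] by simp_all

lemma unit_products_vec:
  assumes "x \<in> carrier_vec n"
  shows "I *\<^sub>v (I *\<^sub>v x) = (-1) \<cdot>\<^sub>v x" "J *\<^sub>v (J *\<^sub>v x) = (-1) \<cdot>\<^sub>v x"
    "J *\<^sub>v (I *\<^sub>v x) = (-1) \<cdot>\<^sub>v (I *\<^sub>v (J *\<^sub>v x))"
proof -
  show "I *\<^sub>v (I *\<^sub>v x) = (-1) \<cdot>\<^sub>v x" "J *\<^sub>v (J *\<^sub>v x) = (-1) \<cdot>\<^sub>v x"
    using unit_square_vec[OF I_carrier IJ(3) assms] unit_square_vec[OF J_carrier IJ(4) assms] .
  have c: "I * J \<in> carrier_mat n n" using I_carrier J_carrier by simp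
  have "J *\<^sub>v (I *\<^sub>v x) = (J * I) *\<^sub>v x" by (rule assoc_mult_mat_vec[OF J_carrier I_carrier assms, symmetric])
  also have "\<dots> = (-1) \<cdot>\<^sub>v ((I * J) *\<^sub>v x)" unfolding IJ(5) using c assms
    by (intro eq_vecI) (auto simp: carrier_vecD row_smult smult_scalar_prod_distrib[of _ n] simp del: assoc_mult_mat_vec)
  also have "(I * J) *\<^sub>v x = I *\<^sub>v (J *\<^sub>v x)" by (rule assoc_mult_mat_vec[OF I_carrier J_carrier assms])
  finally show "J *\<^sub>v (I *\<^sub>v x) = (-1) \<cdot>\<^sub>v (I *\<^sub>v (J *\<^sub>v x))" .
qed

lemma units_smult_vec:
  assumes "x \<in> carrier_vec n"
  shows "I *\<^sub>v (c \<cdot>\<^sub>v x) = c \<cdot>\<^sub>v (I *\<^sub>v x)" "J *\<^sub>v (c \<cdot>\<^sub>v x) = c \<cdot>\<^sub>v (J *\<^sub>v x)"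
  using mult_mat_vec[OF I_carrier assms] mult_mat_vec[OF J_carrier assms] by simp_all

lemma units_add_vec:
  assumes "x \<in> carrier_vec n" "y \<in> carrier_vec n"
  shows "I *\<^sub>v (x + y) = I *\<^sub>v x + I *\<^sub>v y" "J *\<^sub>v (x + y) = J *\<^sub>v x + J *\<^sub>v y"
  using mult_add_distrib_mat_vec[OF I_carrier assms] mult_add_distrib_mat_vec[OF J_carrier assms] by simp_all

lemmas form_smult_right = bform_smult_right[OF B_carrier]
lemmas form_smult_left = bform_smult_left[OF B_carrier]
lemmas form_add_right = bform_add_right[OF B_carrier]
lemmas form_add_left = bform_add_left[OF B_carrier]
lemmas quaternion_form_simps = units_adjoint unit_products_vec form_smult_right I_vec_carrier J_vec_carrier units_smult_vec

text \<open>The order \<open>v, J v, I v, I J v\<close> is that of the two real parts followed by the two imaginary parts.\<close>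

definition qblock :: "real vec \<Rightarrow> nat \<Rightarrow> real vec" where
  "qblock v a = (if a = 0 then v else if a = 1 then J *\<^sub>v v else if a = 2 then I *\<^sub>v v else I *\<^sub>v (J *\<^sub>v v))"

lemma qblock_carrier: "v \<in> carrier_vec n \<Longrightarrow> qblock v a \<in> carrier_vec n"
  by (simp add: qblock_def I_vec_carrier J_vec_carrier)

lemma qblock_in:
  assumes "stable_subspace n {I, J} C" "v \<in> C"
  shows "qblock v a \<in> C"
  using stable_subspaceD(5)[OF assms(1)] assms(2) by (simp add: qblock_def)

lemma qblock_tied:
  assumes v: "v \<in> carrier_vec n" and A: "A \<in> {I, J}" and a: "a < 4"
  shows "\<exists>t b. b < 4 \<and> (\<forall>x\<in>carrier_vec n. bform B (qblock v a) (A *\<^sub>v x) = t * bform B (qblock v b) x)"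
proof -
  let ?u = "qblock v"
  have "\<forall>x\<in>carrier_vec n. bform B (?u 0) (I *\<^sub>v x) = (-1) * bform B (?u 2) x"
    "\<forall>x\<in>carrier_vec n. bform B (?u 1) (I *\<^sub>v x) = (-1) * bform B (?u 3) x"
    "\<forall>x\<in>carrier_vec n. bform B (?u 2) (I *\<^sub>v x) = 1 * bform B (?u 0) x"
    "\<forall>x\<in>carrier_vec n. bform B (?u 3) (I *\<^sub>v x) = 1 * bform B (?u 1) x"
    "\<forall>x\<in>carrier_vec n. bform B (?u 0) (J *\<^sub>v x) = (-1) * bform B (?u 1) x"
    "\<forall>x\<in>carrier_vec n. bform B (?u 1) (J *\<^sub>v x) = 1 * bform B (?u 0) x"
    "\<forall>x\<in>carrier_vec n. bform B (?u 2) (J *\<^sub>v x) = 1 * bform B (?u 3) x"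
    "\<forall>x\<in>carrier_vec n. bform B (?u 3) (J *\<^sub>v x) = (-1) * bform B (?u 2) x"
    using v by (simp_all add: qblock_def quaternion_form_simps)
  moreover have "(0::nat) < 4" "(1::nat) < 4" "(2::nat) < 4" "(3::nat) < 4" by simp_all
  ultimately show ?thesis using A a unfolding less_numeral_cases(3) insert_iff by blast
qed

lemma BIJ_Inv: "{B, B * I, B * J} \<subseteq> Inv"
  using form(1) Inv_mult_End[OF form(1) IJ(1)] Inv_mult_End[OF form(1) IJ(2)] by blast

end

context quaternion_form begin

lemma symmetric_tables:
  assumes sym: "\<epsilon> = 1" and v: "v \<in> carrier_vec n" "bform B v v = s" and ab: "a < 4" "b < 4"
  shows "bform B (qblock v a) (qblock v b) = table4 [[s,0,0,0],[0,s,0,0],[0,0,s,0],[0,0,0,s]] a b" (is ?A)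
    "bform (B * I) (qblock v a) (qblock v b) = table4 [[0,0,-s,0],[0,0,0,-s],[s,0,0,0],[0,s,0,0]] a b" (is ?B)
    "bform (B * J) (qblock v a) (qblock v b) = table4 [[0,-s,0,0],[s,0,0,0],[0,0,0,s],[0,0,-s,0]] a b" (is ?C)
proof -
  have swap: "bform B y x = bform B x y" if "x \<in> carrier_vec n" "y \<in> carrier_vec n" for x y
    using bform_swap[OF B_carrier form(3) that] sym by simp
  have 0: "bform B v (I *\<^sub>v v) = 0" "bform B v (J *\<^sub>v v) = 0" "bform B v (I *\<^sub>v (J *\<^sub>v v)) = 0"
    using swap[of v "I *\<^sub>v v"] swap[of v "J *\<^sub>v v"] swap[of v "I *\<^sub>v (J *\<^sub>v v)"] v(1) by (simp_all add: quaternion_form_simps)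
  note c = qblock_carrier[OF v(1)]
  show ?A using ab v 0 unfolding less_numeral_cases(3) table4_def by (elim disjE; simp add: qblock_def quaternion_form_simps)
  show ?B unfolding bform_mult_right[OF B_carrier I_carrier c c, symmetric]
    using ab v 0 unfolding less_numeral_cases(3) table4_def by (elim disjE; simp add: qblock_def quaternion_form_simps)
  show ?C unfolding bform_mult_right[OF B_carrier J_carrier c c, symmetric]
    using ab v 0 unfolding less_numeral_cases(3) table4_def by (elim disjE; simp add: qblock_def quaternion_form_simps)
qed

lemma skew_tables:
  assumes skew: "\<epsilon> = -1" and v: "v \<in> carrier_vec n" "bform B v (I *\<^sub>v v) = -1" "bform B v (J *\<^sub>v v) = 0"
      "bform B v (I *\<^sub>v (J *\<^sub>v v)) = 0" and ab: "a < 4" "b < 4"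
  shows "bform B (qblock v a) (qblock v b) = table4 [[0,0,-1,0],[0,0,0,1],[1,0,0,0],[0,-1,0,0]] a b" (is ?A)
    "bform (B * I) (qblock v a) (qblock v b) = table4 [[-1,0,0,0],[0,1,0,0],[0,0,-1,0],[0,0,0,1]] a b" (is ?B)
    "bform (B * J) (qblock v a) (qblock v b) = table4 [[0,0,0,-1],[0,0,-1,0],[0,-1,0,0],[-1,0,0,0]] a b" (is ?C)
proof -
  have "bform B v v = - bform B v v" using bform_swap[OF B_carrier form(3) v(1) v(1)] skew by simp
  then have 0: "bform B v v = 0" by simp
  note c = qblock_carrier[OF v(1)]
  show ?A using ab v 0 unfolding less_numeral_cases(3) table4_def by (elim disjE; simp add: qblock_def quaternion_form_simps)
  show ?B unfolding bform_mult_right[OF B_carrier I_carrier c c, symmetric]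
    using ab v 0 unfolding less_numeral_cases(3) table4_def by (elim disjE; simp add: qblock_def quaternion_form_simps)
  show ?C unfolding bform_mult_right[OF B_carrier J_carrier c c, symmetric]
    using ab v 0 unfolding less_numeral_cases(3) table4_def by (elim disjE; simp add: qblock_def quaternion_form_simps)
qed

text \<open>A vector of square \<open>\<plusminus>1\<close> gives a block, because its pairings with \<open>I v\<close>, \<open>J v\<close> and \<open>I J v\<close> vanish.\<close>

theorem quaternion_hermitian_case:
  assumes sym: "\<epsilon> = 1"
  shows "\<exists>p q. p + q = n \<and> 4 dvd p \<and> 4 dvd q \<and> conj_into n H (quat_to_real_mat ` Sp_quat (p div 4) (q div 4))"
proof -
  have symB: "transpose_mat B = B" using form(3) sym by simp
  let ?Blk = "\<lambda>u. \<exists>v\<in>carrier_vec n. (bform B v v = 1 \<or> bform B v v = -1) \<and> u = qblock v"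
  interpret b: block_form n 4 B 1 "{I, J}" ?Blk "\<lambda>b. b"
  proof
    show "u a \<in> carrier_vec n" if "?Blk u" "a < 4" for u a using that qblock_carrier by auto
    show "bform B (u c) (u b) = 0 \<longleftrightarrow> c \<noteq> b" if blk: "?Blk u" and b: "b < 4" and c: "c < 4" for u b c
    proof -
      obtain v where v: "v \<in> carrier_vec n" "bform B v v = 1 \<or> bform B v v = -1" "u = qblock v" using blk by blast
      from symmetric_tables(1)[OF sym v(1) refl c b] show ?thesis
        unfolding v(3) using b c v(2) unfolding less_numeral_cases(3) table4_def by (elim disjE) simp_all
    qed
    show "\<exists>t b. b < 4 \<and> (\<forall>x\<in>carrier_vec n. bform B (u a) (A *\<^sub>v x) = t * bform B (u b) x)"
      if "?Blk u" "A \<in> {I, J}" "a < 4" for u A a using that qblock_tied by blast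
    fix C assume C: "stable_subspace n {I, J} C" "nondegenerate_on n B C" "C \<noteq> {0\<^sub>v n}"
    obtain x y where "x \<in> C" "y \<in> C" "bform B x y \<noteq> 0" using nondegenerate_pair[OF C] .
    then obtain v where "v \<in> C" "bform B v v \<noteq> 0" using symmetric_nonisotropic[OF C(1) B_carrier symB] by blast
    then obtain w where w: "w \<in> C" "bform B w w = 1 \<or> bform B w w = -1" using normalized_vector[OF C(1) B_carrier] by blast
    then show "\<exists>u. ?Blk u \<and> (\<forall>a<4. u a \<in> C)"
      using stable_subspaceD(1)[OF C(1)] qblock_in[OF C(1)] by blast
  qed (use form sym B_carrier I_carrier J_carrier Inv_nondegenerate[OF form(1,2)] in auto)
  obtain m r u where f: "n = 4 * m" "r \<le> m"
    "\<And>i. i < m \<Longrightarrow> ?Blk (u i)"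
    "\<And>i. i < m \<Longrightarrow> bform B (u i 0) (u i 0) = -1 \<longleftrightarrow> i < r"
    "\<And>i j a b. i < m \<Longrightarrow> j < m \<Longrightarrow> i \<noteq> j \<Longrightarrow> a < 4 \<Longrightarrow> b < 4 \<Longrightarrow> bform B (u i a) (u j b) = 0"
    "\<And>z. z \<in> carrier_vec n \<Longrightarrow> block_columns n 4 m u *\<^sub>v z = 0\<^sub>v n \<Longrightarrow> z = 0\<^sub>v n"
    by (rule b.block_frame[of "\<lambda>u. bform B (u 0) (u 0) = -1"]) (rule that; assumption)
  have ui: "\<exists>v\<in>carrier_vec n. bform B v v = sgn_at r i \<and> u i = qblock v" if "i < m" for i
    using f(3,4)[OF that] by (auto simp: qblock_def)
  have m: "r + (m - r) = m" using f(2) by simp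
  have S: "sig_mat r (m - r) \<in> carrier_mat m m" "sig_mat r (m - r) * sig_mat r (m - r) = (1\<^sub>m m :: quat mat)"
    using sig_mat_carrier[of r "m - r"] sig_mat_square[of r "m - r"] unfolding m .
  have "conj_into n H (quat_to_real_mat ` sesquilinear_isometries qcnj m (sig_mat r (m - r)))"
  proof (rule quaternion_conj_into[OF f(1) _ f(6) BIJ_Inv S(1,1,2,2)])
    let ?M = "block_columns n 4 m u"
    show "?M \<in> carrier_mat n n" using f(1) by (simp add: block_columns_def)
    show "transpose_mat ?M * B * ?M = complex_to_real_mat (quat_to_complex_mat (sig_mat r (m - r)))"
      unfolding gram_quat_sig(1)[OF f(2), symmetric]
    proof (rule block_gram[OF f(1) B_carrier b.blk_carrier[OF f(3)] f(5)])
      show "bform B (u i a) (u i b) = table4 [[sgn_at r i,0,0,0],[0,sgn_at r i,0,0],[0,0,sgn_at r i,0],[0,0,0,sgn_at r i]] a b" if "i < m" "a < 4" "b < 4" for i a b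
      proof -
        obtain v where v: "v \<in> carrier_vec n" "bform B v v = sgn_at r i" "u i = qblock v" using ui[OF \<open>i < m\<close>] by blast
        show ?thesis unfolding v(3) by (rule symmetric_tables(1)[OF sym v(1,2) that(2,3)])
      qed
    qed
    show "transpose_mat ?M * (B * I) * ?M = complex_to_real_mat (quat_to_complex_mat (sig_mat r (m - r))) * real_i (m + m)"
      unfolding gram_quat_sig(2)[OF f(2), symmetric]
    proof (rule block_gram[OF f(1) mult_carrier_mat[OF B_carrier I_carrier] b.blk_carrier[OF f(3)] b.tied_orth[OF f(3,5)]])
      show "bform (B * I) (u i a) (u i b) = table4 [[0,0,-sgn_at r i,0],[0,0,0,-sgn_at r i],[sgn_at r i,0,0,0],[0,sgn_at r i,0,0]] a b" if "i < m" "a < 4" "b < 4" for i a b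
      proof -
        obtain v where v: "v \<in> carrier_vec n" "bform B v v = sgn_at r i" "u i = qblock v" using ui[OF \<open>i < m\<close>] by blast
        show ?thesis unfolding v(3) by (rule symmetric_tables(2)[OF sym v(1,2) that(2,3)])
      qed
    qed simp_all
    show "transpose_mat ?M * (B * J) * ?M = conj_sign (m + m) * complex_to_real_mat (J_c m * quat_to_complex_mat (sig_mat r (m - r)))"
      unfolding gram_quat_sig(3)[OF f(2), symmetric]
    proof (rule block_gram[OF f(1) mult_carrier_mat[OF B_carrier J_carrier] b.blk_carrier[OF f(3)] b.tied_orth[OF f(3,5)]])
      show "bform (B * J) (u i a) (u i b) = table4 [[0,-sgn_at r i,0,0],[sgn_at r i,0,0,0],[0,0,0,sgn_at r i],[0,0,-sgn_at r i,0]] a b" if "i < m" "a < 4" "b < 4" for i a b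
      proof -
        obtain v where v: "v \<in> carrier_vec n" "bform B v v = sgn_at r i" "u i = qblock v" using ui[OF \<open>i < m\<close>] by blast
        show ?thesis unfolding v(3) by (rule symmetric_tables(3)[OF sym v(1,2) that(2,3)])
      qed
    qed simp_all
  qed
  then have "conj_into n H (quat_to_real_mat ` Sp_quat r (m - r))" unfolding Sp_quat_def m .
  then show ?thesis using f(1,2) by (intro exI[of _ "4 * r"] exI[of _ "4 * (m - r)"]) simp
qed

text \<open>With \<open>q\<close> the pure quaternion of coordinates \<open>q1, q2, q3\<close>, one has \<open>B(v, U v) = \<langle>q, U\<rangle>\<close>, and replacing \<open>v\<close> by \<open>c v\<close> replaces
  \<open>q\<close> by \<open>c q c\<^sup>*\<close>. For pure \<open>c = x I + y J + z I J\<close> this is \<open>2 \<langle>c, q\<rangle> c - |c|\<^sup>2 q\<close>.\<close>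

lemma pure_rotation:
  fixes x y z :: real
  assumes skew: "\<epsilon> = -1" and v: "v \<in> carrier_vec n"
  defines "w \<equiv> x \<cdot>\<^sub>v (I *\<^sub>v v) + (y \<cdot>\<^sub>v (J *\<^sub>v v) + z \<cdot>\<^sub>v (I *\<^sub>v (J *\<^sub>v v)))"
    and "q1 \<equiv> bform B v (I *\<^sub>v v)" and "q2 \<equiv> bform B v (J *\<^sub>v v)" and "q3 \<equiv> bform B v (I *\<^sub>v (J *\<^sub>v v))"
  shows "bform B w (I *\<^sub>v w) = 2 * x * (x * q1 + y * q2 + z * q3) - (x^2 + y^2 + z^2) * q1"
    "bform B w (J *\<^sub>v w) = 2 * y * (x * q1 + y * q2 + z * q3) - (x^2 + y^2 + z^2) * q2"
    "bform B w (I *\<^sub>v (J *\<^sub>v w)) = 2 * z * (x * q1 + y * q2 + z * q3) - (x^2 + y^2 + z^2) * q3"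
proof -
  have "bform B v v = - bform B v v" using bform_swap[OF B_carrier form(3) v(1) v(1)] skew by simp
  then have 0: "bform B v v = 0" by simp
  note s = quaternion_form_simps form_add_right form_add_left form_smult_left units_add_vec 0
  show "bform B w (I *\<^sub>v w) = 2 * x * (x * q1 + y * q2 + z * q3) - (x^2 + y^2 + z^2) * q1"
    unfolding w_def using v by (simp add: s flip: q1_def q2_def q3_def) (simp add: algebra_simps power2_eq_square)
  show "bform B w (J *\<^sub>v w) = 2 * y * (x * q1 + y * q2 + z * q3) - (x^2 + y^2 + z^2) * q2"
    unfolding w_def using v by (simp add: s flip: q1_def q2_def q3_def) (simp add: algebra_simps power2_eq_square)
  show "bform B w (I *\<^sub>v (J *\<^sub>v w)) = 2 * z * (x * q1 + y * q2 + z * q3) - (x^2 + y^2 + z^2) * q3"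
    unfolding w_def using v by (simp add: s flip: q1_def q2_def q3_def) (simp add: algebra_simps power2_eq_square)
qed

text \<open>The pure quaternion \<open>q\<close> attached to \<open>v\<close> has to be rotated onto the negative \<open>I\<close>-axis and scaled to length \<open>1\<close>.
  The pure quaternion \<open>c = q - \<rho> I\<close> with \<open>\<rho> = |q|\<close> does the rotation, as \<open>c q = - \<rho> I c\<close>; it vanishes exactly if
  \<open>q\<close> is on the positive \<open>I\<close>-axis, and then \<open>c = J\<close> works.\<close>

lemma skew_unit_vector:
  assumes skew: "\<epsilon> = -1" and C: "stable_subspace n {I, J} C" "nondegenerate_on n B C" "C \<noteq> {0\<^sub>v n}"
  obtains w where "w \<in> C" "bform B w (I *\<^sub>v w) = -1" "bform B w (J *\<^sub>v w) = 0" "bform B w (I *\<^sub>v (J *\<^sub>v w)) = 0"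
proof -
  note st = stable_subspaceD[OF C(1)]
  have BIc: "B * I \<in> carrier_mat n n" using B_carrier I_carrier by simp
  have BIs: "transpose_mat (B * I) = B * I"
    using form(3,4) skew B_carrier I_carrier by (simp add: mat_transpose_simps mat_ring_simps)
  \<comment> \<open>\<open>B I\<close> is symmetric and not identically zero on \<open>C\<close>, so some \<open>v\<close> has \<open>q1 \<noteq> 0\<close>.\<close>
  obtain x y where xy: "x \<in> C" "y \<in> C" "bform B x y \<noteq> 0" using nondegenerate_pair[OF C] .
  have c: "x \<in> carrier_vec n" "y \<in> carrier_vec n" using st(1) xy by auto
  have "bform (B * I) x (I *\<^sub>v y) \<noteq> 0"
    using xy(3) c by (simp add: bform_mult_right[OF B_carrier I_carrier, symmetric] I_vec_carrier quaternion_form_simps)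
  then obtain v where v: "v \<in> C" "bform (B * I) v v \<noteq> 0"
    using symmetric_nonisotropic[OF C(1) BIc BIs xy(1), of "I *\<^sub>v y"] st(5) xy(2) by blast
  have vc: "v \<in> carrier_vec n" using st(1) v by auto
  define q1 q2 q3 where "q1 = bform B v (I *\<^sub>v v)" and "q2 = bform B v (J *\<^sub>v v)" and "q3 = bform B v (I *\<^sub>v (J *\<^sub>v v))"
  note rot = pure_rotation[OF skew vc, folded q1_def q2_def q3_def]
  have q1: "q1 \<noteq> 0" using v(2) unfolding q1_def bform_mult_right[OF B_carrier I_carrier vc vc] .
  define \<rho> where "\<rho> = sqrt (q1^2 + q2^2 + q3^2)"
  have \<rho>2: "\<rho>^2 = q1^2 + q2^2 + q3^2" unfolding \<rho>_def by simp
  have \<rho>: "\<rho> > 0" unfolding \<rho>_def using q1 by (simp add: add_pos_nonneg)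
  have in_C: "x \<cdot>\<^sub>v (I *\<^sub>v v) + (y \<cdot>\<^sub>v (J *\<^sub>v v) + z \<cdot>\<^sub>v (I *\<^sub>v (J *\<^sub>v v))) \<in> C" for x y z
    using st(3-5) v(1) by auto
  obtain w where w: "w \<in> C" "bform B w (I *\<^sub>v w) < 0" "bform B w (J *\<^sub>v w) = 0" "bform B w (I *\<^sub>v (J *\<^sub>v w)) = 0"
  proof (cases "q1 = \<rho>")
    case True
    then have "q2^2 + q3^2 = 0" using \<rho>2 by simp
    then have "q2 = 0" "q3 = 0" by (simp_all add: sum_power2_eq_zero_iff)
    then show ?thesis using that[OF in_C[of 0 1 0]] rot[of 0 1 0] True \<rho> by simp
  next
    case False
    have "q1^2 \<le> \<rho>^2" unfolding \<rho>2 by simp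
    then have "q1 \<le> \<rho>" using \<rho> by (intro power2_le_imp_le[of q1 \<rho>]) auto
    then have lt: "q1 < \<rho>" using False by simp
    have D: "(q1 - \<rho>) * q1 + q2 * q2 + q3 * q3 = \<rho> * (\<rho> - q1)"
      using \<rho>2 by (simp add: power2_eq_square algebra_simps)
    have N: "(q1 - \<rho>)^2 + q2^2 + q3^2 = 2 * (\<rho> * (\<rho> - q1))"
      using \<rho>2 by (simp add: power2_eq_square algebra_simps)
    have "2 * (q1 - \<rho>) * (\<rho> * (\<rho> - q1)) - 2 * (\<rho> * (\<rho> - q1)) * q1 = - (2 * \<rho> * \<rho> * (\<rho> - q1))"
      by (simp add: algebra_simps)
    also have "\<dots> < 0" using \<rho> lt by simp
    finally show ?thesis
      using that[OF in_C[of "q1 - \<rho>" q2 q3]] rot[of "q1 - \<rho>" q2 q3] unfolding D N by simp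
  qed
  have wc: "w \<in> carrier_vec n" using st(1) w by auto
  let ?t = "1 / sqrt (- bform B w (I *\<^sub>v w))"
  have tt: "?t * ?t = 1 / (- bform B w (I *\<^sub>v w))" using w(2) by simp
  show ?thesis
  proof (rule that)
    show "?t \<cdot>\<^sub>v w \<in> C" using st(4) w(1) .
    have "bform B (?t \<cdot>\<^sub>v w) (I *\<^sub>v (?t \<cdot>\<^sub>v w)) = (?t * ?t) * bform B w (I *\<^sub>v w)"
      using wc by (simp add: units_smult_vec form_smult_right form_smult_left I_vec_carrier)
    also have "\<dots> = -1" unfolding tt using w(2) by simp
    finally show "bform B (?t \<cdot>\<^sub>v w) (I *\<^sub>v (?t \<cdot>\<^sub>v w)) = -1" .
    show "bform B (?t \<cdot>\<^sub>v w) (J *\<^sub>v (?t \<cdot>\<^sub>v w)) = 0" "bform B (?t \<cdot>\<^sub>v w) (I *\<^sub>v (J *\<^sub>v (?t \<cdot>\<^sub>v w))) = 0"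
      using wc w(3,4) by (simp_all add: units_smult_vec form_smult_right form_smult_left I_vec_carrier J_vec_carrier)
  qed
qed

theorem quaternion_skew_case:
  assumes skew: "\<epsilon> = -1"
  shows "4 dvd n \<and> conj_into n H (quat_to_real_mat ` O_star (n div 4))"
proof -
  let ?Blk = "\<lambda>u. \<exists>v\<in>carrier_vec n. bform B v (I *\<^sub>v v) = -1 \<and> bform B v (J *\<^sub>v v) = 0 \<and>
     bform B v (I *\<^sub>v (J *\<^sub>v v)) = 0 \<and> u = qblock v"
  let ?\<pi> = "\<lambda>b::nat. if b = 0 then 2 else if b = 1 then 3 else if b = 2 then 0 else 1 :: nat"
  interpret b: block_form n 4 B "-1" "{I, J}" ?Blk ?\<pi>
  proof
    show "u a \<in> carrier_vec n" if "?Blk u" "a < 4" for u a using that qblock_carrier by auto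
    show "bform B (u c) (u (?\<pi> b)) = 0 \<longleftrightarrow> c \<noteq> b" if blk: "?Blk u" and b: "b < 4" and c: "c < 4" for u b c
    proof -
      obtain v where v: "v \<in> carrier_vec n" "bform B v (I *\<^sub>v v) = -1" "bform B v (J *\<^sub>v v) = 0"
        "bform B v (I *\<^sub>v (J *\<^sub>v v)) = 0" "u = qblock v" using blk by blast
      have "?\<pi> b < 4" by simp
      from skew_tables(1)[OF skew v(1-4) c this] show ?thesis
        unfolding v(5) using b c unfolding less_numeral_cases(3) table4_def by (elim disjE) simp_all
    qed
    show "\<exists>t b. b < 4 \<and> (\<forall>x\<in>carrier_vec n. bform B (u a) (A *\<^sub>v x) = t * bform B (u b) x)"
      if "?Blk u" "A \<in> {I, J}" "a < 4" for u A a using that qblock_tied by blast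
    fix C assume C: "stable_subspace n {I, J} C" "nondegenerate_on n B C" "C \<noteq> {0\<^sub>v n}"
    obtain w where "w \<in> C" "bform B w (I *\<^sub>v w) = -1" "bform B w (J *\<^sub>v w) = 0" "bform B w (I *\<^sub>v (J *\<^sub>v w)) = 0"
      using skew_unit_vector[OF skew C] .
    then show "\<exists>u. ?Blk u \<and> (\<forall>a<4. u a \<in> C)"
      using stable_subspaceD(1)[OF C(1)] qblock_in[OF C(1)] by blast
  qed (use form skew B_carrier I_carrier J_carrier Inv_nondegenerate[OF form(1,2)] in auto)
  obtain m r u where f: "n = 4 * m" "r \<le> m"
    "\<And>i. i < m \<Longrightarrow> ?Blk (u i)"
    "\<And>i. i < m \<Longrightarrow> False \<longleftrightarrow> i < r"
    "\<And>i j a b. i < m \<Longrightarrow> j < m \<Longrightarrow> i \<noteq> j \<Longrightarrow> a < 4 \<Longrightarrow> b < 4 \<Longrightarrow> bform B (u i a) (u j b) = 0"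
    "\<And>z. z \<in> carrier_vec n \<Longrightarrow> block_columns n 4 m u *\<^sub>v z = 0\<^sub>v n \<Longrightarrow> z = 0\<^sub>v n"
    by (rule b.block_frame[of "\<lambda>u. False"]) (rule that; assumption)
  have "conj_into n H (quat_to_real_mat ` sesquilinear_isometries qcnj m (quat_i \<cdot>\<^sub>m 1\<^sub>m m))"
  proof (rule quaternion_conj_into[OF f(1) _ f(6) BIJ_Inv _ _ quat_i_mat_inverse])
    let ?M = "block_columns n 4 m u"
    show "?M \<in> carrier_mat n n" using f(1) by (simp add: block_columns_def)
    show "transpose_mat ?M * B * ?M = complex_to_real_mat (quat_to_complex_mat (quat_i \<cdot>\<^sub>m 1\<^sub>m m))"
      unfolding gram_quat_i(1)[symmetric]
    proof (rule block_gram[OF f(1) B_carrier b.blk_carrier[OF f(3)] f(5)])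
      show "bform B (u i a) (u i b) = table4 [[0,0,-1,0],[0,0,0,1],[1,0,0,0],[0,-1,0,0]] a b" if "i < m" "a < 4" "b < 4" for i a b
      proof -
        obtain v where v: "v \<in> carrier_vec n" "bform B v (I *\<^sub>v v) = -1" "bform B v (J *\<^sub>v v) = 0"
          "bform B v (I *\<^sub>v (J *\<^sub>v v)) = 0" "u i = qblock v" using f(3)[OF \<open>i < m\<close>] by blast
        show ?thesis unfolding v(5) by (rule skew_tables(1)[OF skew v(1-4) that(2,3)])
      qed
    qed
    show "transpose_mat ?M * (B * I) * ?M = complex_to_real_mat (quat_to_complex_mat (quat_i \<cdot>\<^sub>m 1\<^sub>m m)) * real_i (m + m)"
      unfolding gram_quat_i(2)[symmetric]
    proof (rule block_gram[OF f(1) mult_carrier_mat[OF B_carrier I_carrier] b.blk_carrier[OF f(3)] b.tied_orth[OF f(3,5)]])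
      show "bform (B * I) (u i a) (u i b) = table4 [[-1,0,0,0],[0,1,0,0],[0,0,-1,0],[0,0,0,1]] a b" if "i < m" "a < 4" "b < 4" for i a b
      proof -
        obtain v where v: "v \<in> carrier_vec n" "bform B v (I *\<^sub>v v) = -1" "bform B v (J *\<^sub>v v) = 0"
          "bform B v (I *\<^sub>v (J *\<^sub>v v)) = 0" "u i = qblock v" using f(3)[OF \<open>i < m\<close>] by blast
        show ?thesis unfolding v(5) by (rule skew_tables(2)[OF skew v(1-4) that(2,3)])
      qed
    qed simp_all
    show "transpose_mat ?M * (B * J) * ?M = conj_sign (m + m) * complex_to_real_mat (J_c m * quat_to_complex_mat (quat_i \<cdot>\<^sub>m 1\<^sub>m m))"
      unfolding gram_quat_i(3)[symmetric]
    proof (rule block_gram[OF f(1) mult_carrier_mat[OF B_carrier J_carrier] b.blk_carrier[OF f(3)] b.tied_orth[OF f(3,5)]])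
      show "bform (B * J) (u i a) (u i b) = table4 [[0,0,0,-1],[0,0,-1,0],[0,-1,0,0],[-1,0,0,0]] a b" if "i < m" "a < 4" "b < 4" for i a b
      proof -
        obtain v where v: "v \<in> carrier_vec n" "bform B v (I *\<^sub>v v) = -1" "bform B v (J *\<^sub>v v) = 0"
          "bform B v (I *\<^sub>v (J *\<^sub>v v)) = 0" "u i = qblock v" using f(3)[OF \<open>i < m\<close>] by blast
        show ?thesis unfolding v(5) by (rule skew_tables(3)[OF skew v(1-4) that(2,3)])
      qed
    qed simp_all
  qed simp_all
  then have "conj_into n H (quat_to_real_mat ` O_star m)" unfolding O_star_def .
  then show ?thesis using f(1) by simp
qed

end

section \<open>The classification\<close>

context irreducible_group begin

text \<open>The diagonal projection onto the coordinates satisfying \<open>P\<close> commutes with every matrix of \<open>L\<close>.\<close>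

lemma no_block_splitting:
  assumes conj: "conj_into n H L"
    and zero: "\<And>A i j. A \<in> L \<Longrightarrow> A \<in> carrier_mat n n \<Longrightarrow> i < n \<Longrightarrow> j < n \<Longrightarrow> P i \<noteq> P j \<Longrightarrow> A $$ (i, j) = 0"
    and ab: "a < n" "b < n" "P a" "\<not> P b"
  shows False
proof -
  let ?Z = "mat n n (\<lambda>(i, j). if i = j \<and> P i then 1 else 0) :: real mat"
  have Z: "?Z \<in> carrier_mat n n" by simp
  show False
  proof (rule no_singular_centralizer[OF conj Z])
    show "?Z \<noteq> 0\<^sub>m n n"
    proof
      assume "?Z = 0\<^sub>m n n"
      then have "?Z $$ (a, a) = 0\<^sub>m n n $$ (a, a)" by (simp only:)
      then show False using ab by simp
    qed
    show "unit_vec n b \<noteq> (0\<^sub>v n :: real vec)"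
    proof
      assume "unit_vec n b = (0\<^sub>v n :: real vec)"
      then have "unit_vec n b $ b = (0\<^sub>v n :: real vec) $ b" by (simp only:)
      then show False using ab by simp
    qed
    show "?Z *\<^sub>v unit_vec n b = 0\<^sub>v n" using ab by (intro eq_vecI) (auto simp: scalar_prod_right_unit)
    fix A assume A: "A \<in> L" "A \<in> carrier_mat n n"
    show "A * ?Z = ?Z * A"
    proof (rule mat_lin_eqI)
      fix i j assume ij: "i < n" "j < n"
      have "(A * ?Z) $$ (i, j) = (\<Sum>k<n. A $$ (i, k) * (if k = j \<and> P k then 1 else 0))"
        using A ij by (simp add: scalar_prod_def atLeast0LessThan)
      also have "\<dots> = (\<Sum>k<n. if k = j then (if P j then A $$ (i, j) else 0) else 0)"
        by (rule sum.cong) auto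
      finally have AZ: "(A * ?Z) $$ (i, j) = (if P j then A $$ (i, j) else 0)" using ij by simp
      have "(?Z * A) $$ (i, j) = (\<Sum>k<n. (if i = k \<and> P i then 1 else 0) * A $$ (k, j))"
        using A ij by (simp add: scalar_prod_def atLeast0LessThan)
      also have "\<dots> = (\<Sum>k<n. if k = i then (if P i then A $$ (i, j) else 0) else 0)"
        by (rule sum.cong) auto
      finally have ZA: "(?Z * A) $$ (i, j) = (if P i then A $$ (i, j) else 0)" using ij by simp
      show "(A * ?Z) $$ (i, j) = (?Z * A) $$ (i, j)" unfolding AZ ZA using zero[OF A ij] by auto
    qed (use A in simp_all)
  qed simp
qed

text \<open>\<open>O(1, \<complex>)\<close> consists of \<open>\<plusminus>1\<close>, so its elements are diagonal over the reals.\<close>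

lemma O_complex_one_excluded:
  assumes "n = 2" "conj_into n H (complex_to_real_mat ` O_complex 1)"
  shows False
proof (rule no_block_splitting[OF assms(2), of "\<lambda>i. i = 0" 0 1])
  fix A i j assume A: "A \<in> complex_to_real_mat ` O_complex 1" and ij: "i < n" "j < n" "(i = 0) \<noteq> (j = 0)"
  obtain C where C: "A = complex_to_real_mat C" "C \<in> carrier_mat 1 1" "transpose_mat C * 1\<^sub>m 1 * C = 1\<^sub>m 1"
    using A unfolding O_complex_def bilinear_isometries_def GL_iff by blast
  let ?c = "C $$ (0, 0)"
  have "(transpose_mat C * 1\<^sub>m 1 * C) $$ (0, 0) = ?c * ?c"
    using C(2) by (simp add: scalar_prod_def)
  then have "?c * ?c = 1" unfolding C(3) by simp
  then have "?c = 1 \<or> ?c = -1" by (simp add: square_eq_1_iff)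
  then have "Im ?c = 0" by auto
  then show "A $$ (i, j) = 0" using ij C(2) assms(1) unfolding C(1) complex_to_real_mat_def by (auto simp: less_2_cases_iff)
qed (use assms in auto)

text \<open>The elements \<open>q\<close> of \<open>O\<^sup>*(1)\<close> have no \<open>j\<close>- and \<open>k\<close>-components, so over the reals they preserve the
  even and the odd coordinates.\<close>

lemma O_star_one_excluded:
  assumes "n = 4" "conj_into n H (quat_to_real_mat ` O_star 1)"
  shows False
proof (rule no_block_splitting[OF assms(2), of even 0 1])
  fix A i j assume A: "A \<in> quat_to_real_mat ` O_star 1" and ij: "i < n" "j < n" "even i \<noteq> even j"
  obtain Q where Q: "A = quat_to_real_mat Q" "Q \<in> carrier_mat 1 1"
      "transpose_mat (map_mat qcnj Q) * (quat_i \<cdot>\<^sub>m 1\<^sub>m 1) * Q = quat_i \<cdot>\<^sub>m 1\<^sub>m 1"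
    using A unfolding O_star_def sesquilinear_isometries_def GL_iff by blast
  let ?q = "Q $$ (0, 0)"
  have "(transpose_mat (map_mat qcnj Q) * (quat_i \<cdot>\<^sub>m 1\<^sub>m 1) * Q) $$ (0, 0) = qcnj ?q * quat_i * ?q"
    using Q(2) by (simp add: scalar_prod_def)
  then have "qcnj ?q * quat_i * ?q = quat_i" unfolding Q(3) by simp
  then have e: "(qRe ?q)^2 + (qI ?q)^2 - (qJ ?q)^2 - (qK ?q)^2 = 1"
    "qI ?q * qJ ?q = qRe ?q * qK ?q" "qI ?q * qK ?q = - qRe ?q * qJ ?q"
    by (simp_all add: qcnj_def quat_i_def times_quat_def power2_eq_square algebra_simps)
  \<comment> \<open>The vanishing \<open>j\<close>- and \<open>k\<close>-components of \<open>qcnj q * quat_i * q\<close> are, up to constant factors, the real and imaginary part of a product of two complex numbers, whence one factor is zero.\<close>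
  have "((qRe ?q)^2 + (qI ?q)^2) * ((qJ ?q)^2 + (qK ?q)^2)
      = (qI ?q * qJ ?q - qRe ?q * qK ?q)^2 + (qI ?q * qK ?q + qRe ?q * qJ ?q)^2"
    by (simp add: power2_eq_square algebra_simps)
  also have "\<dots> = 0" unfolding e(2,3) by simp
  finally have "(qRe ?q)^2 + (qI ?q)^2 = 0 \<or> (qJ ?q)^2 + (qK ?q)^2 = 0" by simp
  moreover have "(qRe ?q)^2 + (qI ?q)^2 \<noteq> 0"
  proof
    assume "(qRe ?q)^2 + (qI ?q)^2 = 0"
    moreover have "0 \<le> (qJ ?q)^2" "0 \<le> (qK ?q)^2" by simp_all
    ultimately show False using e(1) by linarith
  qed
  ultimately have "qJ ?q = 0" "qK ?q = 0" by (auto simp: sum_power2_eq_zero_iff)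
  moreover have "i = 0 \<or> i = 1 \<or> i = 2 \<or> i = 3" "j = 0 \<or> j = 1 \<or> j = 2 \<or> j = 3" using ij(1,2) assms(1) by auto
  ultimately show "A $$ (i, j) = 0"
    using ij(3) Q(2) unfolding Q(1) quat_to_real_mat_def complex_to_real_mat_def quat_to_complex_mat_blocks
    by (auto simp: quat_fst_def quat_snd_def complex_eq_iff)
qed (use assms in auto)

theorem classification:
  assumes F0: "F0 \<in> Inv" "F0 \<noteq> 0\<^sub>m n n"
  shows "(has_invariants n H TYPE(real) 1 0 \<and> (\<exists>p q. p + q = n \<and> conj_into n H (O_real p q))) \<or>
    (has_invariants n H TYPE(real) 0 1 \<and> 2 dvd n \<and> conj_into n H (Sp_real (n div 2))) \<or>
    (has_invariants n H TYPE(complex) 2 0 \<and> 2 dvd n \<and> n \<ge> 4 \<and>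
       conj_into n H (complex_to_real_mat ` O_complex (n div 2))) \<or>
    (has_invariants n H TYPE(complex) 0 2 \<and> 4 dvd n \<and> conj_into n H (complex_to_real_mat ` Sp_complex (n div 4))) \<or>
    (has_invariants n H TYPE(complex) 1 1 \<and> (\<exists>p q. p + q = n \<and> 2 dvd p \<and> 2 dvd q \<and>
       conj_into n H (complex_to_real_mat ` U_complex (p div 2) (q div 2)))) \<or>
    (has_invariants n H TYPE(quat) 1 3 \<and> (n \<ge> 8 \<or> n = 4) \<and> (\<exists>p q. p + q = n \<and> 4 dvd p \<and> 4 dvd q \<and>
       conj_into n H (quat_to_real_mat ` Sp_quat (p div 4) (q div 4)))) \<or>
    (has_invariants n H TYPE(quat) 3 1 \<and> 4 dvd n \<and> n \<ge> 8 \<and>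
       conj_into n H (quat_to_real_mat ` O_star (n div 4)))"
    (is "?R1 \<or> ?R2 \<or> ?C1 \<or> ?C2 \<or> ?C3 \<or> ?H1 \<or> ?H2")
proof (cases rule: End_trichotomy)
  case real
  obtain \<epsilon> where e: "\<epsilon> = 1 \<or> \<epsilon> = (-1::real)" "F0 + \<epsilon> \<cdot>\<^sub>m transpose_mat F0 \<noteq> 0\<^sub>m n n"
    "transpose_mat (F0 + \<epsilon> \<cdot>\<^sub>m transpose_mat F0) = \<epsilon> \<cdot>\<^sub>m (F0 + \<epsilon> \<cdot>\<^sub>m transpose_mat F0)"
    using symmetrize[OF Inv_carrier[OF F0(1)] F0(2)] by blast
  define B where "B = F0 + \<epsilon> \<cdot>\<^sub>m transpose_mat F0"
  have B: "B \<in> Inv" "B \<noteq> 0\<^sub>m n n" "transpose_mat B = \<epsilon> \<cdot>\<^sub>m B"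
    using Inv_symmetrize[OF F0(1)] e(2,3) unfolding B_def by blast+
  note inv = invariants_real[OF real B]
  show ?thesis using e(1)
  proof
    assume "\<epsilon> = 1"
    then show ?thesis using inv(1) real_symmetric_case[OF B(1,2)] B(3) by simp
  next
    assume "\<epsilon> = -1"
    then show ?thesis using inv(2) real_skew_case[OF B(1,2)] B(3) by simp
  qed
next
  case (complex I)
  show ?thesis
  proof (rule complex_unit_form[OF complex(1,2) F0])
    fix B assume hermitian: "B \<in> Inv" "B \<noteq> 0\<^sub>m n n" "transpose_mat B = B" "transpose_mat I * B = (-1) \<cdot>\<^sub>m (B * I)"
    note [simp] = End_carrier[OF complex(1)] Inv_carrier[OF hermitian(1)]
    have "transpose_mat (B * I) = (-1) \<cdot>\<^sub>m (B * I)" using hermitian(3,4) by (simp add: mat_transpose_simps)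
    from invariants_complex[OF complex hermitian(1,2) _ this, of 1] hermitian(3)
    have "has_invariants n H TYPE(complex) 1 1" by simp
    then show ?thesis using complex_hermitian_case[OF complex(1,2) hermitian] by blast
  next
    fix B \<epsilon> assume bilinear: "B \<in> Inv" "B \<noteq> 0\<^sub>m n n" "\<epsilon> = 1 \<or> \<epsilon> = (-1::real)" "transpose_mat B = \<epsilon> \<cdot>\<^sub>m B"
      "transpose_mat I * B = B * I"
    note [simp] = End_carrier[OF complex(1)] Inv_carrier[OF bilinear(1)]
    have "transpose_mat (B * I) = transpose_mat I * (\<epsilon> \<cdot>\<^sub>m B)" using bilinear(4) by (simp add: mat_transpose_simps)
    also have "\<dots> = \<epsilon> \<cdot>\<^sub>m (B * I)" using bilinear(5) by (simp add: mat_ring_simps)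
    finally have t: "transpose_mat (B * I) = \<epsilon> \<cdot>\<^sub>m (B * I)" .
    note inv = invariants_complex[OF complex bilinear(1,2,4) t]
    show ?thesis using bilinear(3)
    proof
      assume e: "\<epsilon> = 1"
      then have "has_invariants n H TYPE(complex) 2 0" using inv by (simp add: numeral_2_eq_2)
      moreover have c: "2 dvd n" "conj_into n H (complex_to_real_mat ` O_complex (n div 2))"
        using complex_symmetric_case[OF complex(1,2) bilinear(1,2) _ bilinear(5)] bilinear(4) e by simp_all
      moreover have "n \<noteq> 2" using O_complex_one_excluded c(2) by (metis div_self zero_neq_numeral)
      moreover from \<open>2 dvd n\<close> \<open>n \<noteq> 2\<close> have "n \<ge> 4" using n by (auto elim!: dvdE)
      ultimately show ?thesis by blast
    next
      assume e: "\<epsilon> = -1"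
      then have "has_invariants n H TYPE(complex) 0 2" using inv by (simp add: numeral_2_eq_2)
      moreover have "4 dvd n \<and> conj_into n H (complex_to_real_mat ` Sp_complex (n div 4))"
        using complex_skew_case[OF complex(1,2) bilinear(1,2) _ bilinear(5)] bilinear(4) e by simp
      ultimately show ?thesis by blast
    qed
  qed
next
  case (quaternion I J)
  obtain B \<epsilon> where B: "B \<in> Inv" "B \<noteq> 0\<^sub>m n n" "\<epsilon> = 1 \<or> \<epsilon> = (-1::real)" "transpose_mat B = \<epsilon> \<cdot>\<^sub>m B"
      "transpose_mat I * B = (-1) \<cdot>\<^sub>m (B * I)" "transpose_mat J * B = (-1) \<cdot>\<^sub>m (B * J)"
    using quaternion_unit_form[OF quaternion(1-5) F0] .
  interpret q: quaternion_form n H I J B \<epsilon>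
    by unfold_locales (rule quaternion B)+
  note inv = invariants_quaternion[OF quaternion B(1,2,4-6)]
  show ?thesis using B(3)
  proof
    assume e: "\<epsilon> = 1"
    obtain p q where pq: "p + q = n \<and> 4 dvd p \<and> 4 dvd q \<and> conj_into n H (quat_to_real_mat ` Sp_quat (p div 4) (q div 4))"
      using q.quaternion_hermitian_case[OF e] by blast
    then have "4 dvd n" by auto
    then have "n \<ge> 8 \<or> n = 4" using n by (auto elim!: dvdE)
    then show ?thesis using inv(1)[OF e] pq by blast
  next
    assume e: "\<epsilon> = -1"
    have c: "4 dvd n" "conj_into n H (quat_to_real_mat ` O_star (n div 4))" using q.quaternion_skew_case[OF e] by simp_all
    have "n \<noteq> 4" using O_star_one_excluded c(2) by (metis div_self zero_neq_numeral)
    then have "n \<ge> 8" using c(1) n by (auto elim!: dvdE)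
    then show ?thesis using inv(2)[OF e] c by blast
  qed
qed

end

lemma subspaceI_vec:
  assumes "W \<subseteq> carrier_vec n" "0\<^sub>v n \<in> W" "\<And>x y. x \<in> W \<Longrightarrow> y \<in> W \<Longrightarrow> x + y \<in> W"
    "\<And>(c::real) x. x \<in> W \<Longrightarrow> c \<cdot>\<^sub>v x \<in> W"
  shows "VectorSpace.subspace class_ring W (module_vec TYPE(real) n)"
proof (rule VectorSpace.subspace.intro[OF vec_vs])
  show "LinearCombinations.submodule class_ring W (module_vec TYPE(real) n)"
    by (rule submodule.intro[OF vec_module]) (use assms in \<open>simp_all add: module_vec_simps\<close>)
qed

lemma irreducible_rep_group:
  assumes \<kappa>: "\<kappa> \<in> hom G (GL TYPE(real) n)" and irr: "irreducible_rep G n \<kappa>"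
  shows "irreducible_group n (\<kappa> ` carrier G)"
proof
  show "\<kappa> ` carrier G \<subseteq> carrier (GL TYPE(real) n)" using \<kappa> by (auto simp: hom_def)
  show "0 < n" using irr by (simp add: irreducible_rep_def)
  fix W assume W: "W \<subseteq> carrier_vec n" "0\<^sub>v n \<in> W" "\<And>x y. x \<in> W \<Longrightarrow> y \<in> W \<Longrightarrow> x + y \<in> W"
    "\<And>c x. x \<in> W \<Longrightarrow> c \<cdot>\<^sub>v x \<in> W" and inv: "\<And>h w. h \<in> \<kappa> ` carrier G \<Longrightarrow> w \<in> W \<Longrightarrow> h *\<^sub>v w \<in> W"
  have "VectorSpace.subspace class_ring W (module_vec TYPE(real) n)" by (rule subspaceI_vec[OF W])
  moreover have "\<forall>g\<in>carrier G. \<forall>w\<in>W. \<kappa> g *\<^sub>v w \<in> W" using inv by blast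
  ultimately show "W = {0\<^sub>v n} \<or> W = carrier_vec n" using irr unfolding irreducible_rep_def by blast
qed

text \<open>An isomorphism onto the dual representation is, read as a Gram matrix, an invariant form.\<close>

lemma self_dual_invariant_form:
  assumes G: "group G" and \<kappa>: "\<kappa> \<in> hom G (GL TYPE(real) n)" and n: "0 < n" and sd: "self_dual_rep G n \<kappa>"
  obtains F where "F \<in> carrier_mat n n" "invariant_form n (\<kappa> ` carrier G) F" "F \<noteq> 0\<^sub>m n n"
proof -
  obtain P where P: "P \<in> carrier (GL TYPE(real) n)" and eq: "\<And>g. g \<in> carrier G \<Longrightarrow> P * \<kappa> g = transpose_mat (\<kappa> (inv\<^bsub>G\<^esub> g)) * P"
    using sd unfolding self_dual_rep_def isomorphic_reps_def dual_rep_def by blast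
  obtain Q where Pc: "P \<in> carrier_mat n n" and Q: "Q \<in> carrier_mat n n" "Q * P = 1\<^sub>m n" using P unfolding GL_iff by blast
  have grp: "group (GL TYPE(real) n)" by (rule GL_group)
  interpret h: group_hom G "GL TYPE(real) n" \<kappa> using G grp \<kappa> by (simp add: group_hom_def group_hom_axioms_def)
  have c: "\<kappa> g \<in> carrier_mat n n" if "g \<in> carrier G" for g
  proof -
    have "\<kappa> g \<in> carrier (GL TYPE(real) n)" using h.hom_closed[OF that] .
    then show ?thesis unfolding GL_iff by blast
  qed
  have sub: "\<kappa> ` carrier G \<subseteq> carrier_mat n n" using c by blast
  have "transpose_mat (\<kappa> g) * P * \<kappa> g = P" if g: "g \<in> carrier G" for g
  proof -
    have g': "inv\<^bsub>G\<^esub> g \<in> carrier G" using g by simp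
    have t: "transpose_mat (\<kappa> g) \<in> carrier_mat n n" "transpose_mat (\<kappa> (inv\<^bsub>G\<^esub> g)) \<in> carrier_mat n n"
      using c[OF g] c[OF g'] by simp_all
    have "\<kappa> (inv\<^bsub>G\<^esub> g) * \<kappa> g = \<kappa> (inv\<^bsub>G\<^esub> g \<otimes>\<^bsub>G\<^esub> g)"
      using h.hom_mult[OF g' g] by (simp add: GL_def units_of_def ring_mat_def)
    also have "\<dots> = \<kappa> \<one>\<^bsub>G\<^esub>" using g by simp
    also have "\<dots> = 1\<^sub>m n" using h.hom_one by (simp add: GL_def units_of_def ring_mat_def)
    finally have one: "\<kappa> (inv\<^bsub>G\<^esub> g) * \<kappa> g = 1\<^sub>m n" .
    have "transpose_mat (\<kappa> g) * P * \<kappa> g = transpose_mat (\<kappa> g) * (transpose_mat (\<kappa> (inv\<^bsub>G\<^esub> g)) * P)"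
      using assoc_mult_mat[OF t(1) Pc c[OF g]] eq[OF g] by simp
    also have "\<dots> = transpose_mat (\<kappa> (inv\<^bsub>G\<^esub> g) * \<kappa> g) * P"
      using assoc_mult_mat[OF t(1,2) Pc] transpose_mult[OF c[OF g'] c[OF g]] by simp
    finally show ?thesis unfolding one using Pc by simp
  qed
  then have "invariant_form n (\<kappa> ` carrier G) P" unfolding invariant_form_iff[OF Pc sub] by blast
  moreover have "P \<noteq> 0\<^sub>m n n"
  proof
    assume "P = 0\<^sub>m n n"
    then have "1\<^sub>m n = (0\<^sub>m n n :: real mat)" using Q right_mult_zero_mat[OF Q(1), of n] by simp
    then have "1\<^sub>m n $$ (0, 0) = (0\<^sub>m n n :: real mat) $$ (0, 0)" by (simp only:)
    then show False using n by simp
  qed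
  ultimately show ?thesis using that Pc by blast
qed

theorem proposition5:
  fixes G :: "('g, 'r) monoid_scheme" and \<kappa> :: "'g \<Rightarrow> real mat" and n :: nat
  shows
    "(group G \<and> \<kappa> \<in> hom G (GL TYPE(real) n) \<and> irreducible_rep G n \<kappa> \<and> self_dual_rep G n \<kappa> \<longrightarrow>
       (has_invariants n (\<kappa> ` carrier G) TYPE(real) 1 0 \<and>
          (\<exists>p q. p + q = n \<and> conj_into n (\<kappa> ` carrier G) (O_real p q))) \<or>
       (has_invariants n (\<kappa> ` carrier G) TYPE(real) 0 1 \<and>
          2 dvd n \<and> conj_into n (\<kappa> ` carrier G) (Sp_real (n div 2))) \<or>
       (has_invariants n (\<kappa> ` carrier G) TYPE(complex) 2 0 \<and>
          2 dvd n \<and> n \<ge> 4 \<and>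
          conj_into n (\<kappa> ` carrier G) (complex_to_real_mat ` O_complex (n div 2))) \<or>
       (has_invariants n (\<kappa> ` carrier G) TYPE(complex) 0 2 \<and>
          4 dvd n \<and> conj_into n (\<kappa> ` carrier G) (complex_to_real_mat ` Sp_complex (n div 4))) \<or>
       (has_invariants n (\<kappa> ` carrier G) TYPE(complex) 1 1 \<and>
          (\<exists>p q. p + q = n \<and> 2 dvd p \<and> 2 dvd q \<and>
             conj_into n (\<kappa> ` carrier G) (complex_to_real_mat ` U_complex (p div 2) (q div 2)))) \<or>
       (has_invariants n (\<kappa> ` carrier G) TYPE(quat) 1 3 \<and>
          (n \<ge> 8 \<or> n = 4) \<and>
          (\<exists>p q. p + q = n \<and> 4 dvd p \<and> 4 dvd q \<and>
             conj_into n (\<kappa> ` carrier G) (quat_to_real_mat ` Sp_quat (p div 4) (q div 4)))) \<or>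
       (has_invariants n (\<kappa> ` carrier G) TYPE(quat) 3 1 \<and>
          4 dvd n \<and> n \<ge> 8 \<and>
          conj_into n (\<kappa> ` carrier G) (quat_to_real_mat ` O_star (n div 4))))
     \<and>
     (2 dvd n \<longrightarrow>
        subgrp (O_complex (n div 2)) (n div 2)
          \<cong> subgrp (O_split_realized n \<inter> GL_complex_in_real (n div 2)) n)
     \<and>
     (4 dvd n \<longrightarrow>
        subgrp (Sp_complex (n div 4)) (n div 2)
          \<cong> subgrp (Sp_real_realized n \<inter> GL_complex_in_real (n div 2)) n)
     \<and>
     (\<forall>p q. p + q = n \<and> 2 dvd p \<and> 2 dvd q \<longrightarrow>
        subgrp (U_complex (p div 2) (q div 2)) (n div 2)
          \<cong> subgrp (O_real_part (p div 2) (q div 2) \<inter> Sp_imaginary_part (p div 2) (q div 2)) n)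
     \<and>
     (\<forall>p q. p + q = n \<and> 4 dvd p \<and> 4 dvd q \<longrightarrow>
        subgrp (Sp_quat (p div 4) (q div 4)) (n div 4)
          \<cong> subgrp (U_realized (p div 4) (q div 4) \<inter> Sp_complex_realized (p div 4) (q div 4)) (n div 2))
     \<and>
     (4 dvd n \<longrightarrow>
        subgrp (O_star (n div 4)) (n div 4)
          \<cong> subgrp (U_skew_realized (n div 4) \<inter> O_complex_realized (n div 4)) (n div 2))"
proof (intro conjI impI allI)
  assume asm: "group G \<and> \<kappa> \<in> hom G (GL TYPE(real) n) \<and> irreducible_rep G n \<kappa> \<and> self_dual_rep G n \<kappa>"
  interpret irreducible_group n "\<kappa> ` carrier G" using asm irreducible_rep_group by blast
  obtain F where F: "F \<in> carrier_mat n n" "invariant_form n (\<kappa> ` carrier G) F" "F \<noteq> 0\<^sub>m n n"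
    using self_dual_invariant_form[of G \<kappa> n] asm n by blast
  have "F \<in> Inv" using F by simp
  note classification[OF this F(3)]
  then show "(has_invariants n (\<kappa> ` carrier G) TYPE(real) 1 0 \<and>
          (\<exists>p q. p + q = n \<and> conj_into n (\<kappa> ` carrier G) (O_real p q))) \<or>
       (has_invariants n (\<kappa> ` carrier G) TYPE(real) 0 1 \<and>
          2 dvd n \<and> conj_into n (\<kappa> ` carrier G) (Sp_real (n div 2))) \<or>
       (has_invariants n (\<kappa> ` carrier G) TYPE(complex) 2 0 \<and>
          2 dvd n \<and> n \<ge> 4 \<and>
          conj_into n (\<kappa> ` carrier G) (complex_to_real_mat ` O_complex (n div 2))) \<or>
       (has_invariants n (\<kappa> ` carrier G) TYPE(complex) 0 2 \<and>
          4 dvd n \<and> conj_into n (\<kappa> ` carrier G) (complex_to_real_mat ` Sp_complex (n div 4))) \<or>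
       (has_invariants n (\<kappa> ` carrier G) TYPE(complex) 1 1 \<and>
          (\<exists>p q. p + q = n \<and> 2 dvd p \<and> 2 dvd q \<and>
             conj_into n (\<kappa> ` carrier G) (complex_to_real_mat ` U_complex (p div 2) (q div 2)))) \<or>
       (has_invariants n (\<kappa> ` carrier G) TYPE(quat) 1 3 \<and>
          (n \<ge> 8 \<or> n = 4) \<and>
          (\<exists>p q. p + q = n \<and> 4 dvd p \<and> 4 dvd q \<and>
             conj_into n (\<kappa> ` carrier G) (quat_to_real_mat ` Sp_quat (p div 4) (q div 4)))) \<or>
       (has_invariants n (\<kappa> ` carrier G) TYPE(quat) 3 1 \<and>
          4 dvd n \<and> n \<ge> 8 \<and>
          conj_into n (\<kappa> ` carrier G) (quat_to_real_mat ` O_star (n div 4)))"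
    .
qed (rule group_isomorphisms; assumption)+

end
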